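(* Let $K$ be a field of characteristic $0$ and let $X$ be a topological space with $\mathrm{cat}_{LS}(X)\leq 1$. Then $X$ is formal, i.e. the cochain dg-algebra $C^\ast(X;K)$ is a formal dg-algebra.
   Context: Throughout, $K$ is a field of characteristic $0$. The Lusternik-Schnirelmann category $\mathrm{cat}_{LS}(X)$ of a topological space $X$ is the least integer $n$ such that there is a covering of $X$ by $n+1$ open subsets $U_i$ that are all contractible in $X$, i.e. each inclusion $U_i\hookrightarrow X$ is null-homotopic. $C^\ast(X;K)$ denotes the (singular) cochain complex of $X$ with coefficients in $K$, regarded as a dg-algebra over $K$ with the cup product; its cohomology algebra is $H^\ast(X;K)$, regarded as a dg-algebra with zero differential. An $A_\infty$-algebra $(A,m)$ over $K$ is a $\mathbb{Z}$-graded $K$-vector space $A=\bigoplus_{i\in\mathbb{Z}}A_i$ with $K$-linear maps $m_n:A^{\otimes n}\to A$ of degree $2-n$ ($n\ge 1$) such that for all $n\geq 1$ $$\sum_{r+s+t=n}(-1)^{r+st}\,m_{r+1+t}(\mathrm{Id}^{\otimes r}\otimes m_s\otimes \mathrm{Id}^{\otimes t})=0,$$ where $s\ge 1$ and $r,t\ge 0$ (Koszul sign rule when applied to elements). A dg-algebra is an $A_\infty$-algebra with $m_i=0$ for $i\ge 3$; equivalently, a $\mathbb{Z}$-graded $K$-vector space with an associative product $m_2$ and a differential $d=m_1$ of degree $+1$ satisfying the graded Leibniz rule. A morphism of $A_\infty$-algebras $f:(A,m^A)\to(B,m^B)$ is a family of linear maps $f_n:A^{\otimes n}\to B$ of degree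 $1-n$ ($n\ge1$) such that for all $n\ge 1$ $$\sum_{r+s+t=n}(-1)^{r+st}f_{r+1+t}(\mathrm{Id}^{\otimes r}\otimes m^A_s\otimes \mathrm{Id}^{\otimes t})=\sum_{k=1}^{n}\ \sum_{i_1+\cdots+i_k=n}(-1)^{u_k}m^B_k(f_{i_1}\otimes\cdots\otimes f_{i_k}),$$ where $u_k=\sum_{t=1}^{k-1}t(i_{k-t}-1)$. It is an $A_\infty$-quasi-isomorphism if $f_1$ induces an isomorphism on cohomology with respect to $m_1^A$ and $m_1^B$. A dg-algebra $A$ is formal if it is $A_\infty$-quasi-isomorphic to a dg-algebra with zero differential; equivalently, if it is $A_\infty$-quasi-isomorphic to its cohomology algebra $H(A)$; equivalently, if it is connected to $H(A)$ by a zig-zag of quasi-isomorphisms of dg-algebras. A space $X$ is called formal if $C^\ast(X;K)$ is a formal dg-algebra. *)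

theory Defs
  imports
    "HOL-Homology.Homology"
    "HOL-Library.Function_Algebras"
    "HOL-Library.Extended_Nat"
begin

section \<open>Lusternik-Schnirelmann category\<close>

text \<open>As for \<^const>\<open>contractible_space\<close>, the point \<open>a\<close> is automatically in \<open>X\<close>
  unless \<open>U\<close> is empty.\<close>

definition contractible_in :: "'x topology \<Rightarrow> 'x set \<Rightarrow> bool" where
  "contractible_in X U \<longleftrightarrow>
     (\<exists>a. homotopic_with (\<lambda>_. True) (subtopology X U) X id (\<lambda>_. a))"

text \<open>The value is \<open>\<infinity>\<close> if there is no finite covering of the required kind.\<close>

definition cat_LS :: "'x topology \<Rightarrow> enat" where
  "cat_LS X = Inf {enat n |n. \<exists>U :: nat \<Rightarrow> 'x set.
     (\<forall>i\<le>n. openin X (U i) \<and> contractible_in X (U i)) \<and> (\<Union>i\<le>n. U i) = topspace X}"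


section \<open>A-infinity algebras\<close>

text \<open>A graded vector space is given by the linearly independent family \<open>part A i\<close>
  (\<open>i\<close> an integer) of subspaces of an ambient vector space on the type \<^typ>\<open>'a\<close> with scalar
  multiplication \<open>smul A\<close>; the graded space is their internal direct sum, which need not be
  the whole ambient space. The operation \<open>m\<^sub>n\<close> is \<open>ops A\<close> on lists of length \<open>n\<close>.
  Multilinear maps are determined by their values on homogeneous elements, so only these
  matter.\<close>

record ('k, 'a) graded_ops =
  smul :: "'k \<Rightarrow> 'a \<Rightarrow> 'a"
  part :: "int \<Rightarrow> 'a set"
  ops :: "'a list \<Rightarrow> 'a"

definition graded_vector_space :: "('k::field, 'a::ab_group_add) graded_ops \<Rightarrow> bool" where
  "graded_vector_space A \<longleftrightarrow>
     vector_space (smul A) \<and>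
     (\<forall>i. module.subspace (smul A) (part A i)) \<and>
     (\<forall>I x. finite I \<longrightarrow> (\<forall>i\<in>I. x i \<in> part A i) \<longrightarrow> (\<Sum>i\<in>I. x i) = 0 \<longrightarrow> (\<forall>i\<in>I. x i = 0))"

definition homogeneous :: "('k, 'a) graded_ops \<Rightarrow> int list \<Rightarrow> 'a list \<Rightarrow> bool" where
  "homogeneous A ds xs \<longleftrightarrow> list_all2 (\<lambda>d x. x \<in> part A d) ds xs"

definition graded_multilinear ::
    "('k::field, 'a::ab_group_add) graded_ops \<Rightarrow> ('k, 'b::ab_group_add) graded_ops \<Rightarrow>
     nat \<Rightarrow> int \<Rightarrow> ('a list \<Rightarrow> 'b) \<Rightarrow> bool" where
  "graded_multilinear A B n e f \<longleftrightarrow>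
     (\<forall>ds xs. length xs = n \<longrightarrow> homogeneous A ds xs \<longrightarrow>
        f xs \<in> part B (sum_list ds + e) \<and>
        (\<forall>i<n. \<forall>c. \<forall>y\<in>part A (ds ! i).
           f (xs[i := smul A c (xs ! i) + y]) = smul B c (f xs) + f (xs[i := y])))"

text \<open>For \<open>n = length xs\<close>, this is
  \<open>\<Sum> (-1)\<^bsup>r+st\<^esup> g\<^bsub>r+1+t\<^esub> (Id\<^bsup>r\<^esup> \<otimes> m\<^sub>s \<otimes> Id\<^bsup>t\<^esup>)\<close> over \<open>r + s + t = n\<close>, \<open>s \<ge> 1\<close>, on elements \<open>xs\<close> of
  degrees \<open>ds\<close>; moving \<open>m\<^sub>s\<close>, of degree \<open>2 - s\<close>, past the first \<open>r\<close> elements gives the last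
  summand of the exponent.\<close>

definition insertion_sum ::
    "('k::field, 'a) graded_ops \<Rightarrow> ('k \<Rightarrow> 'b \<Rightarrow> 'b::ab_group_add) \<Rightarrow> ('a list \<Rightarrow> 'b) \<Rightarrow>
     int list \<Rightarrow> 'a list \<Rightarrow> 'b" where
  "insertion_sum A sm g ds xs =
     (\<Sum>(r, s, t) \<in> {(r, s, t). r + s + t = length xs \<and> s \<ge> 1}.
        sm ((- 1) powi (int r + int s * int t + (2 - int s) * sum_list (take r ds)))
          (g (take r xs @ ops A (take s (drop r xs)) # drop (r + s) xs)))"

definition A_inf_algebra :: "('k::field, 'a::ab_group_add) graded_ops \<Rightarrow> bool" where
  "A_inf_algebra A \<longleftrightarrow>
     graded_vector_space A \<and>
     (\<forall>n\<ge>1. graded_multilinear A A n (2 - int n) (ops A)) \<and>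
     (\<forall>ds xs. xs \<noteq> [] \<longrightarrow> homogeneous A ds xs \<longrightarrow>
        insertion_sum A (smul A) (ops A) ds xs = 0)"

definition dg_algebra :: "('k::field, 'a::ab_group_add) graded_ops \<Rightarrow> bool" where
  "dg_algebra A \<longleftrightarrow>
     A_inf_algebra A \<and>
     (\<forall>ds xs. length xs \<ge> 3 \<longrightarrow> homogeneous A ds xs \<longrightarrow> ops A xs = 0)"

definition zero_differential :: "('k, 'a::zero) graded_ops \<Rightarrow> bool" where
  "zero_differential A \<longleftrightarrow> (\<forall>i. \<forall>x\<in>part A i. ops A [x] = 0)"


section \<open>Morphisms and formality\<close>

fun map_blocks :: "('a list \<Rightarrow> 'b) \<Rightarrow> nat list \<Rightarrow> 'a list \<Rightarrow> 'b list" where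
  "map_blocks f [] xs = []"
| "map_blocks f (i # is) xs = f (take i xs) # map_blocks f is (drop i xs)"

text \<open>\<open>u\<^sub>k = \<Sum>\<^bsub>t=1..k-1\<^esub> t (i\<^bsub>k-t\<^esub> - 1)\<close>, where \<open>i\<^sub>j\<close> is \<open>is ! (j - 1)\<close>.\<close>

definition block_sign :: "nat list \<Rightarrow> int" where
  "block_sign is = (\<Sum>t = 1..<length is. int t * (int (is ! (length is - t - 1)) - 1))"

text \<open>The Koszul sign for evaluating \<open>f\<^bsub>i\<^sub>1\<^esub> \<otimes> \<dots> \<otimes> f\<^bsub>i\<^sub>k\<^esub>\<close> on elements of degrees \<open>ds\<close>: each factor,
  of degree \<open>1 - i\<^sub>j\<close>, moves past all elements of the preceding blocks.\<close>

definition block_koszul :: "nat list \<Rightarrow> int list \<Rightarrow> int" where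
  "block_koszul is ds =
     (\<Sum>j<length is. (1 - int (is ! j)) * sum_list (take (sum_list (take j is)) ds))"

definition A_inf_morphism ::
    "('k::field, 'a::ab_group_add) graded_ops \<Rightarrow> ('k, 'b::ab_group_add) graded_ops \<Rightarrow>
     ('a list \<Rightarrow> 'b) \<Rightarrow> bool" where
  "A_inf_morphism A B f \<longleftrightarrow>
     (\<forall>n\<ge>1. graded_multilinear A B n (1 - int n) f) \<and>
     (\<forall>ds xs. xs \<noteq> [] \<longrightarrow> homogeneous A ds xs \<longrightarrow>
        insertion_sum A (smul B) f ds xs =
        (\<Sum>k = 1..length xs.
           \<Sum>is \<in> {is. length is = k \<and> sum_list is = length xs \<and> (\<forall>i\<in>set is. i \<ge> 1)}.
             smul B ((- 1) powi (block_sign is + block_koszul is ds))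
               (ops B (map_blocks f is xs))))"

definition cocycles :: "('k, 'a::zero) graded_ops \<Rightarrow> int \<Rightarrow> 'a set" where
  "cocycles A i = {x \<in> part A i. ops A [x] = 0}"

definition coboundaries :: "('k, 'a) graded_ops \<Rightarrow> int \<Rightarrow> 'a set" where
  "coboundaries A i = (\<lambda>y. ops A [y]) ` part A (i - 1)"

definition cohomology_class :: "('k, 'a::plus) graded_ops \<Rightarrow> int \<Rightarrow> 'a \<Rightarrow> 'a set" where
  "cohomology_class A i z = (\<lambda>b. z + b) ` coboundaries A i"

definition cohomology :: "('k, 'a::ab_group_add) graded_ops \<Rightarrow> int \<Rightarrow> 'a set set" where
  "cohomology A i = cohomology_class A i ` cocycles A i"

definition cohomology_map ::
    "('k, 'b::ab_group_add) graded_ops \<Rightarrow> ('a list \<Rightarrow> 'b) \<Rightarrow> int \<Rightarrow> 'a set \<Rightarrow> 'b set" where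
  "cohomology_map B f i c = (\<Union>z\<in>c. cohomology_class B i (f [z]))"

definition A_inf_quasi_isomorphism ::
    "('k::field, 'a::ab_group_add) graded_ops \<Rightarrow> ('k, 'b::ab_group_add) graded_ops \<Rightarrow>
     ('a list \<Rightarrow> 'b) \<Rightarrow> bool" where
  "A_inf_quasi_isomorphism A B f \<longleftrightarrow>
     A_inf_morphism A B f \<and>
     (\<forall>i. bij_betw (cohomology_map B f i) (cohomology A i) (cohomology B i))"

text \<open>The algebra \<open>B\<close> may be sought on the type of \<open>A\<close> without loss of generality: up to
  isomorphism it is the cohomology algebra of \<open>A\<close>, and the cohomology embeds as a complement
  of the coboundaries in the cocycles. The direction of the
  quasi-isomorphism is immaterial, since over a field A-infinity quasi-isomorphisms are
  invertible up to homotopy.\<close>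

definition formal_dg_algebra :: "('k::field, 'a::ab_group_add) graded_ops \<Rightarrow> bool" where
  "formal_dg_algebra A \<longleftrightarrow>
     dg_algebra A \<and>
     (\<exists>(B :: ('k, 'a) graded_ops) f.
        dg_algebra B \<and> zero_differential B \<and> A_inf_quasi_isomorphism B A f)"


section \<open>Singular cochains\<close>

text \<open>The family of all cochains \<open>\<phi> n\<close> of degree \<open>n\<close>. The degree is kept as an argument
  because one function can be a singular simplex of several dimensions in the sense of
  \<^const>\<open>singular_simplex\<close>.\<close>

type_synonym ('x, 'k) cochains = "nat \<Rightarrow> ((nat \<Rightarrow> real) \<Rightarrow> 'x) \<Rightarrow> 'k"

definition singular_cochains :: "'x topology \<Rightarrow> int \<Rightarrow> ('x, 'k::zero) cochains set" where
  "singular_cochains X i =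
     {\<phi>. \<forall>n \<sigma>. \<phi> n \<sigma> \<noteq> 0 \<longrightarrow> int n = i \<and> singular_simplex n X \<sigma>}"

definition coboundary :: "'x topology \<Rightarrow> ('x, 'k::field) cochains \<Rightarrow> ('x, 'k) cochains" where
  "coboundary X \<phi> = (\<lambda>n \<sigma>.
     if n \<ge> 1 \<and> singular_simplex n X \<sigma>
     then \<Sum>k\<le>n. (- 1) ^ k * \<phi> (n - 1) (singular_face n k \<sigma>) else 0)"

definition front_face :: "nat \<Rightarrow> ((nat \<Rightarrow> real) \<Rightarrow> 'x) \<Rightarrow> (nat \<Rightarrow> real) \<Rightarrow> 'x" where
  "front_face p \<sigma> = restrict \<sigma> (standard_simplex p)"

text \<open>The \<open>q\<close>-face of a \<open>(p + q)\<close>-simplex spanned by its last \<open>q + 1\<close> vertices.\<close>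

definition back_face :: "nat \<Rightarrow> nat \<Rightarrow> ((nat \<Rightarrow> real) \<Rightarrow> 'x) \<Rightarrow> (nat \<Rightarrow> real) \<Rightarrow> 'x" where
  "back_face p q \<sigma> =
     restrict (\<lambda>v. \<sigma> (\<lambda>i. if i < p then 0 else v (i - p))) (standard_simplex q)"

definition cup_product ::
    "'x topology \<Rightarrow> ('x, 'k::field) cochains \<Rightarrow> ('x, 'k) cochains \<Rightarrow> ('x, 'k) cochains" where
  "cup_product X \<phi> \<psi> = (\<lambda>n \<sigma>.
     if singular_simplex n X \<sigma>
     then \<Sum>p\<le>n. \<phi> p (front_face p \<sigma>) * \<psi> (n - p) (back_face p (n - p) \<sigma>) else 0)"

definition cochain_algebra :: "'x topology \<Rightarrow> ('k::field, ('x, 'k) cochains) graded_ops" where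
  "cochain_algebra X =
     \<lparr> smul = (\<lambda>c \<phi> n \<sigma>. c * \<phi> n \<sigma>),
       part = singular_cochains X,
       ops = (\<lambda>\<phi>s. case \<phi>s of
                [\<phi>] \<Rightarrow> coboundary X \<phi>
              | [\<phi>, \<psi>] \<Rightarrow> cup_product X \<phi> \<psi>
              | _ \<Rightarrow> 0) \<rparr>"

definition formal_space :: "'k::field itself \<Rightarrow> 'x topology \<Rightarrow> bool" where
  "formal_space K X \<longleftrightarrow>
     formal_dg_algebra (cochain_algebra X :: ('k, ('x, 'k) cochains) graded_ops)"

end

theory Submission
  imports Defs
begin

text \<open>
  Let the open sets \<open>U\<close> and \<open>V\<close> cover \<open>X\<close> and be contractible in \<open>X\<close>. The classical argument that
  cup products of positive-degree classes vanish goes as follows. Restriction of a class \<open>x\<close> of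
  positive degree to \<open>U\<close> is zero, so it has a representative \<open>i x\<close> that vanishes on all simplices
  in \<open>U\<close>, and likewise a representative \<open>j x\<close> that vanishes on all simplices in \<open>V\<close>. A product
  \<open>i x \<cdot> j y\<close> vanishes on every simplex that lies in \<open>U\<close> or in \<open>V\<close>, and the cochains with this
  property form an ideal \<open>J\<close>, which is acyclic by barycentric subdivision.

  The same idea kills all higher obstructions to formality at once. The representatives depend
  linearly on the cocycle, and so does a cochain \<open>h x\<close> with \<open>d (h x) = j x - i x\<close>. Put
  \<open>N(x\<^sub>1,\<dots>,x\<^sub>n) = i x\<^sub>1 \<cdot> h x\<^sub>2 \<cdots> h x\<^sub>n\<close>. Differentiating the factor \<open>h x\<^sub>k\<close> produces, up to sign,
  \<open>i x\<^sub>1 \<cdot> h x\<^sub>2 \<cdots> h x\<^bsub>k-1\<^esub> \<cdot> i x\<^sub>k \<cdot> h x\<^bsub>k+1\<^esub> \<cdots> h x\<^sub>n = N(x\<^sub>1,\<dots>,x\<^bsub>k-1\<^esub>) \<cdot> N(x\<^sub>k,\<dots>,x\<^sub>n)\<close>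
  and the same expression with \<open>j x\<^sub>k\<close> in place of \<open>i x\<^sub>k\<close>; the latter is in \<open>J\<close>, because \<open>i x\<^sub>1\<close>
  vanishes on the simplices of \<open>U\<close> and \<open>j x\<^sub>k\<close> on those of \<open>V\<close>. So modulo \<open>J\<close> the maps \<open>N\<close> are the
  components of an A-infinity morphism from the positive-degree cohomology with zero product
  (\<open>conv_naive_mod_J\<close>). A contraction \<open>s\<close> of \<open>J\<close>, that is a linear map with \<open>ds + sd = 1\<close> on \<open>J\<close>,
  corrects them recursively to maps for which the equation holds exactly (\<open>d_lift\<close>).

  To avoid signs, this part of the proof takes place in an ungraded ring with a differential \<open>d\<close>
  and an involution \<open>\<tau>\<close>, which is \<open>(-1)\<^sup>n\<close> in degree \<open>n\<close>: the families of cochains of all degrees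
  form such a ring. The sign conventions for A-infinity morphisms are recovered by inserting powers
  of \<open>\<tau>\<close> in the arguments (\<open>d_twisted_lift\<close>).

  Degree \<open>0\<close> needs separate treatment. If \<open>U\<close> and \<open>V\<close> meet, a cocycle of degree \<open>0\<close> is a multiple
  of the unit, because it is constant on \<open>U\<close> and on \<open>V\<close>, and the morphism is extended strictly
  unitally. If they are disjoint, each simplex of \<open>X\<close> lies in \<open>U\<close> or in \<open>V\<close>, and the positive-degree
  cohomology is zero. In both cases the result is a quasi-isomorphism from the cohomology,
  realised as a complement of the coboundaries in the cocycles, to the cochain algebra
  (\<open>graded_null_product_ring.formal\<close>).

  The topological input is explicit as well: \<open>i\<close> and \<open>j\<close> come from the operator that sends a
  singular simplex of a set contractible in \<open>X\<close> to the cone on it traced out by the contraction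
  (\<open>homotopy_term_cone_op\<close>), and \<open>s\<close> is dual to a chain homotopy between the identity and a chain
  map with values in the chains of small simplices (\<open>small_op_homotopy\<close>).
\<close>


section \<open>A Maurer-Cartan equation in a differential ring\<close>

text \<open>The involution \<open>\<tau>\<close> stands for the sign \<open>(-1)\<^sup>n\<close> in degree \<open>n\<close>. It replaces the grading, so that the
  product and the differential can be handled without reference to degrees.\<close>

locale dg_ring = vector_space sm
  for sm :: "'k::field \<Rightarrow> 'a::ab_group_add \<Rightarrow> 'a" +
  fixes mul :: "'a \<Rightarrow> 'a \<Rightarrow> 'a" (infixl "\<odot>" 70)
    and d :: "'a \<Rightarrow> 'a"
    and \<tau> :: "'a \<Rightarrow> 'a"
  assumes linear_d: "Vector_Spaces.linear sm sm d"
    and linear_\<tau>: "Vector_Spaces.linear sm sm \<tau>"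
    and mul_add_left: "(x + y) \<odot> z = x \<odot> z + y \<odot> z"
    and mul_add_right: "x \<odot> (y + z) = x \<odot> y + x \<odot> z"
    and mul_scale_left: "sm c x \<odot> y = sm c (x \<odot> y)"
    and mul_scale_right: "x \<odot> sm c y = sm c (x \<odot> y)"
    and mul_assoc: "(x \<odot> y) \<odot> z = x \<odot> (y \<odot> z)"
    and \<tau>_mul: "\<tau> (x \<odot> y) = \<tau> x \<odot> \<tau> y"
    and \<tau>_\<tau>: "\<tau> (\<tau> x) = x"
    and d_d: "d (d x) = 0"
    and d_\<tau>: "d (\<tau> x) = - \<tau> (d x)"
    and leibniz: "d (x \<odot> y) = d x \<odot> y + \<tau> x \<odot> d y"
begin

sublocale d: Vector_Spaces.linear sm sm d by (rule linear_d)
sublocale \<tau>: Vector_Spaces.linear sm sm \<tau> by (rule linear_\<tau>)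

lemma mul_zero_left [simp]: "0 \<odot> x = 0"
  using mul_add_left[of 0 0 x] by simp

lemma mul_zero_right [simp]: "x \<odot> 0 = 0"
  using mul_add_right[of x 0 0] by simp

lemma mul_minus_left: "(- x) \<odot> y = - (x \<odot> y)"
  using mul_add_left[of x "- x" y] by (simp add: eq_neg_iff_add_eq_0 add.commute)

lemma mul_minus_right: "x \<odot> (- y) = - (x \<odot> y)"
  using mul_add_right[of x y "- y"] by (simp add: eq_neg_iff_add_eq_0 add.commute)

lemma mul_diff_left: "(x - y) \<odot> z = x \<odot> z - y \<odot> z"
  using mul_add_left[of x "- y" z] by (simp add: mul_minus_left)

lemma mul_diff_right: "x \<odot> (y - z) = x \<odot> y - x \<odot> z"
  using mul_add_right[of x y "- z"] by (simp add: mul_minus_right)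

lemma mul_sum_left: "(\<Sum>p\<in>P. g p) \<odot> x = (\<Sum>p\<in>P. g p \<odot> x)"
  by (induction P rule: infinite_finite_induct) (simp_all add: mul_add_left)

lemma mul_sum_right: "x \<odot> (\<Sum>p\<in>P. g p) = (\<Sum>p\<in>P. x \<odot> g p)"
  by (induction P rule: infinite_finite_induct) (simp_all add: mul_add_right)

text \<open>Up to the signs hidden in \<open>\<tau>\<close>, this is the product in the convolution algebra of maps from the
  tensor coalgebra to the ring, evaluated at \<open>F\<close> and \<open>F\<close>. A solution of \<open>d F = - conv F\<close> is a
  Maurer-Cartan element, that is an A-infinity morphism from a space with zero operations.\<close>

definition conv :: "('a list \<Rightarrow> 'a) \<Rightarrow> 'a list \<Rightarrow> 'a" where
  "conv F xs = (\<Sum>p\<in>{1..<length xs}. \<tau> (F (take p xs)) \<odot> F (drop p xs))"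

lemma conv_cong [fundef_cong]:
  assumes "xs = ys"
    and "\<And>zs. length zs < length ys \<Longrightarrow> F zs = G zs"
  shows "conv F xs = conv G ys"
  unfolding conv_def using assms by (intro sum.cong) auto

text \<open>The Bianchi identity. Differentiating \<open>conv F\<close> and substituting \<open>d F = - conv F\<close> gives the sum over
  all splittings of the list into three blocks twice, with opposite signs, by associativity. Since
  only proper blocks occur, the equation is needed only for shorter lists; this lets the
  recursion in \<open>d_lift\<close> proceed.\<close>

lemma d_conv:
  assumes "\<And>p. 1 \<le> p \<Longrightarrow> p < length xs \<Longrightarrow> d (F (take p xs)) = - conv F (take p xs)"
    and "\<And>p. 1 \<le> p \<Longrightarrow> p < length xs \<Longrightarrow> d (F (drop p xs)) = - conv F (drop p xs)"
  shows "d (conv F xs) = 0"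
proof -
  let ?n = "length xs"
  define G where "G r p = F (take r xs) \<odot> (\<tau> (F (take (p - r) (drop r xs))) \<odot> F (drop p xs))" for r p
  have left: "\<tau> (conv F (take p xs)) \<odot> F (drop p xs) = (\<Sum>r\<in>{1..<p}. G r p)"
    if "p < ?n" for p
  proof -
    have "\<tau> (conv F (take p xs)) \<odot> F (drop p xs)
        = (\<Sum>r\<in>{1..<p}. (F (take r (take p xs)) \<odot> \<tau> (F (drop r (take p xs)))) \<odot> F (drop p xs))"
      using that by (simp add: conv_def \<tau>.sum mul_sum_left \<tau>_mul \<tau>_\<tau>)
    also have "\<dots> = (\<Sum>r\<in>{1..<p}. G r p)"
      by (intro sum.cong) (auto simp: G_def mul_assoc min_def drop_take)
    finally show ?thesis .
  qed
  have right: "F (take p xs) \<odot> conv F (drop p xs) = (\<Sum>q\<in>{p<..<?n}. G p q)"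
    if "p < ?n" for p
  proof -
    have "F (take p xs) \<odot> conv F (drop p xs)
        = (\<Sum>r\<in>{1..<?n - p}. F (take p xs) \<odot> (\<tau> (F (take r (drop p xs))) \<odot> F (drop r (drop p xs))))"
      by (simp add: conv_def mul_sum_right)
    also have "\<dots> = (\<Sum>q\<in>{p<..<?n}. G p q)"
      by (rule sum.reindex_bij_witness[of _ "\<lambda>q. q - p" "\<lambda>r. r + p"]) (auto simp: G_def)
    finally show ?thesis .
  qed
  have "d (conv F xs) = (\<Sum>p\<in>{1..<?n}. \<tau> (conv F (take p xs)) \<odot> F (drop p xs)
                                        - F (take p xs) \<odot> conv F (drop p xs))"
    unfolding conv_def[of F xs] d.sum
    by (intro sum.cong refl)
       (simp add: leibniz d_\<tau> \<tau>_\<tau> assms \<tau>.neg mul_minus_left mul_minus_right)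
  also have "\<dots> = (\<Sum>p\<in>{1..<?n}. (\<Sum>r\<in>{1..<p}. G r p)) - (\<Sum>p\<in>{1..<?n}. (\<Sum>q\<in>{p<..<?n}. G p q))"
    by (simp add: left right sum_subtractf)
  also have "(\<Sum>p\<in>{1..<?n}. (\<Sum>q\<in>{p<..<?n}. G p q)) = (\<Sum>q\<in>{1..<?n}. (\<Sum>p\<in>{1..<q}. G p q))"
    by (subst (1 2) sum.Sigma; simp?)
       (rule sum.reindex_bij_witness[of _ "\<lambda>(q, p). (p, q)" "\<lambda>(p, q). (q, p)"]; auto)
  finally show ?thesis by simp
qed

end

text \<open>Linearity in each position is stated in the form used in \<^const>\<open>graded_multilinear\<close>.\<close>

definition multilinear :: "('k \<Rightarrow> 'a \<Rightarrow> 'a::ab_group_add) \<Rightarrow> ('a list \<Rightarrow> 'a) \<Rightarrow> bool" where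
  "multilinear sm F \<longleftrightarrow> (\<forall>xs k c y. k < length xs \<longrightarrow>
     F (xs[k := sm c (xs ! k) + y]) = sm c (F xs) + F (xs[k := y]))"

lemma multilinearD:
  "multilinear sm F \<Longrightarrow> k < length xs \<Longrightarrow>
     F (xs[k := sm c (xs ! k) + y]) = sm c (F xs) + F (xs[k := y])"
  by (simp add: multilinear_def)

text \<open>In the application, \<open>I\<^sub>0\<close> and \<open>I\<^sub>1\<close> are the cochains that vanish on the simplices in \<open>U\<close> and in
  \<open>V\<close>, the ideal \<open>J\<close> consists of those that vanish on both kinds of simplices, \<open>h\<^sub>0\<close> and \<open>h\<^sub>1\<close> are dual to
  the cone operators, and \<open>s\<close> contracts \<open>J\<close>.\<close>

locale null_product_ring = dg_ring sm mul d \<tau>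
  for sm :: "'k::field \<Rightarrow> 'a::ab_group_add \<Rightarrow> 'a"
    and mul (infixl "\<odot>" 70) and d \<tau> +
  fixes I\<^sub>0 I\<^sub>1 J :: "'a set"
    and h\<^sub>0 h\<^sub>1 s :: "'a \<Rightarrow> 'a"
  assumes linear_h\<^sub>0: "Vector_Spaces.linear sm sm h\<^sub>0"
    and linear_h\<^sub>1: "Vector_Spaces.linear sm sm h\<^sub>1"
    and linear_s: "Vector_Spaces.linear sm sm s"
    and subspace_J: "subspace J"
    and I\<^sub>0_mul: "x \<in> I\<^sub>0 \<Longrightarrow> x \<odot> y \<in> I\<^sub>0"
    and I\<^sub>0_\<tau>: "x \<in> I\<^sub>0 \<Longrightarrow> \<tau> x \<in> I\<^sub>0"
    and I\<^sub>0_I\<^sub>1: "x \<in> I\<^sub>0 \<Longrightarrow> y \<in> I\<^sub>1 \<Longrightarrow> x \<odot> y \<in> J"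
    and J_mul_left: "x \<in> J \<Longrightarrow> y \<odot> x \<in> J"
    and J_mul_right: "x \<in> J \<Longrightarrow> x \<odot> y \<in> J"
    and J_\<tau>: "x \<in> J \<Longrightarrow> \<tau> x \<in> J"
    and J_s: "x \<in> J \<Longrightarrow> s x \<in> J"
    and contraction_s: "x \<in> J \<Longrightarrow> d (s x) + s (d x) = x"
begin

sublocale h\<^sub>0: Vector_Spaces.linear sm sm h\<^sub>0 by (rule linear_h\<^sub>0)
sublocale h\<^sub>1: Vector_Spaces.linear sm sm h\<^sub>1 by (rule linear_h\<^sub>1)
sublocale s: Vector_Spaces.linear sm sm s by (rule linear_s)

definition i :: "'a \<Rightarrow> 'a" where "i x = x - d (h\<^sub>0 x)"
definition j :: "'a \<Rightarrow> 'a" where "j x = x - d (h\<^sub>1 x)"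
definition h :: "'a \<Rightarrow> 'a" where "h x = h\<^sub>0 x - h\<^sub>1 x"

definition liftable :: "'a set" where
  "liftable = {x. d x = 0 \<and> i x \<in> I\<^sub>0 \<and> j x \<in> I\<^sub>1}"

text \<open>An explicit solution of the Maurer-Cartan equation modulo \<open>J\<close>.\<close>

fun naive :: "'a list \<Rightarrow> 'a" where
  "naive [] = 0"
| "naive (x # ys) = foldl (\<lambda>a y. a \<odot> h y) (i x) ys"

text \<open>The correction makes sense because \<^const>\<open>conv\<close> evaluates its argument at proper blocks only.
  On liftable lists the argument of \<open>s\<close> is a cocycle in \<open>J\<close>, and \<open>s\<close> picks a primitive of it.\<close>

function lift :: "'a list \<Rightarrow> 'a" where
  "lift xs = naive xs - s (conv lift xs + d (naive xs))"
  by auto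
termination by (relation "measure length") auto

declare lift.simps [simp del]

lemma naive_snoc: "xs \<noteq> [] \<Longrightarrow> naive (xs @ [y]) = naive xs \<odot> h y"
  by (cases xs) simp_all

lemma d_i: "d x = 0 \<Longrightarrow> d (i x) = 0"
  by (simp add: i_def d.diff d_d)

lemma d_h: "d (h x) = j x - i x"
  by (simp add: h_def i_def j_def d.diff)

lemma naive_in_I\<^sub>0:
  assumes "xs \<noteq> []" "set xs \<subseteq> liftable"
  shows "naive xs \<in> I\<^sub>0"
  using assms
proof (induction xs rule: rev_induct)
  case (snoc y xs)
  then show ?case
    by (cases "xs = []") (simp_all add: naive_snoc I\<^sub>0_mul liftable_def)
qed simp

text \<open>Appending \<open>y\<close> multiplies the error for \<open>xs\<close> by \<open>h y\<close>, which stays in \<open>J\<close>. The new terms come from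
  \<open>d (h y) = j y - i y\<close>: the one with \<open>i y\<close> is the new last summand of \<^const>\<open>conv\<close>, and the one with
  \<open>j y\<close> is in \<open>I\<^sub>0 I\<^sub>1\<close>.\<close>

lemma conv_naive_mod_J:
  assumes "xs \<noteq> []" "set xs \<subseteq> liftable"
  shows "conv naive xs + d (naive xs) \<in> J"
  using assms
proof (induction xs rule: rev_induct)
  case (snoc y xs)
  show ?case
  proof (cases "xs = []")
    case True
    with snoc.prems show ?thesis
      by (simp add: conv_def liftable_def d_i subspace_0[OF subspace_J])
  next
    case False
    let ?n = "length xs"
    have "conv naive (xs @ [y]) = (\<Sum>p\<in>{1..<Suc ?n}. \<tau> (naive (take p (xs @ [y]))) \<odot> naive (drop p (xs @ [y])))"
      by (simp add: conv_def)
    also have "\<dots> = (\<Sum>p\<in>{1..<?n}. \<tau> (naive (take p (xs @ [y]))) \<odot> naive (drop p (xs @ [y])))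
                   + \<tau> (naive xs) \<odot> i y"
      using False by (subst sum.atLeastLessThan_Suc) (auto simp: Suc_le_eq)
    also have "(\<Sum>p\<in>{1..<?n}. \<tau> (naive (take p (xs @ [y]))) \<odot> naive (drop p (xs @ [y])))
             = (\<Sum>p\<in>{1..<?n}. (\<tau> (naive (take p xs)) \<odot> naive (drop p xs)) \<odot> h y)"
      by (intro sum.cong) (auto simp: naive_snoc mul_assoc)
    also have "\<dots> = conv naive xs \<odot> h y"
      by (simp add: conv_def mul_sum_left)
    finally have "conv naive (xs @ [y]) + d (naive (xs @ [y]))
        = (conv naive xs + d (naive xs)) \<odot> h y + \<tau> (naive xs) \<odot> j y"
      using False by (simp add: naive_snoc leibniz d_h mul_add_left mul_diff_right)
    moreover have "(conv naive xs + d (naive xs)) \<odot> h y \<in> J"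
      using snoc False by (simp add: J_mul_right)
    moreover have "\<tau> (naive xs) \<odot> j y \<in> J"
      using snoc.prems False naive_in_I\<^sub>0[of xs] by (simp add: I\<^sub>0_I\<^sub>1 I\<^sub>0_\<tau> liftable_def)
    ultimately show ?thesis
      by (simp add: subspace_add[OF subspace_J])
  qed
qed simp

text \<open>By induction on the length, \<open>lift\<close> and \<open>naive\<close> agree modulo \<open>J\<close> on shorter lists, so the error \<open>g\<close> of
  \<open>naive\<close> relative to \<open>conv lift\<close> is in \<open>J\<close>. By \<open>d_conv\<close> it is a cocycle, hence \<open>d (s g) = g\<close>, and
  subtracting \<open>s g\<close> removes the error.\<close>

theorem d_lift:
  assumes "xs \<noteq> []" "set xs \<subseteq> liftable"
  shows "d (lift xs) = - conv lift xs"
proof -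
  have "d (lift xs) = - conv lift xs \<and> lift xs - naive xs \<in> J"
    using assms
  proof (induction xs rule: length_induct)
    case (1 xs)
    let ?g = "conv lift xs + d (naive xs)"
    have IH: "d (lift ys) = - conv lift ys" "lift ys - naive ys \<in> J"
      if "length ys < length xs" "ys \<noteq> []" "set ys \<subseteq> set xs" for ys
      using 1 that by auto
    have sub: "take p xs \<noteq> []" "set (take p xs) \<subseteq> set xs" "length (take p xs) < length xs"
         "drop p xs \<noteq> []" "set (drop p xs) \<subseteq> set xs" "length (drop p xs) < length xs"
      if "1 \<le> p" "p < length xs" for p
      using that by (auto dest: in_set_takeD in_set_dropD)
    have mul: "\<tau> (lift a) \<odot> lift b - \<tau> (naive a) \<odot> naive b \<in> J"
      if "lift a - naive a \<in> J" "lift b - naive b \<in> J" for a b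
    proof -
      have "\<tau> (lift a) \<odot> lift b - \<tau> (naive a) \<odot> naive b
          = \<tau> (lift a - naive a) \<odot> lift b + \<tau> (naive a) \<odot> (lift b - naive b)"
        by (simp add: \<tau>.diff mul_diff_left mul_diff_right)
      then show ?thesis
        using that by (simp add: subspace_add[OF subspace_J] J_\<tau> J_mul_left J_mul_right)
    qed
    have "conv lift xs - conv naive xs \<in> J"
      unfolding conv_def sum_subtractf[symmetric]
      by (intro subspace_sum[OF subspace_J] mul IH(2)) (use sub in auto)
    with conv_naive_mod_J[of xs] 1(2,3) have gJ: "?g \<in> J"
      using subspace_add[OF subspace_J, of "conv lift xs - conv naive xs" "conv naive xs + d (naive xs)"]
      by simp
    have "d (conv lift xs) = 0"
      by (intro d_conv IH(1)) (use sub in auto)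
    then have "d ?g = 0"
      by (simp add: d.add d_d)
    with contraction_s[OF gJ] have "d (s ?g) = ?g"
      by (simp add: s.zero)
    then have "d (lift xs) = - conv lift xs"
      by (subst lift.simps) (simp add: d.diff)
    moreover have "lift xs - naive xs \<in> J"
      using J_s[OF gJ] subspace_neg[OF subspace_J] by (subst lift.simps) simp
    ultimately show ?case ..
  qed
  then show ?thesis ..
qed

lemma lift_singleton: "d x = 0 \<Longrightarrow> lift [x] = i x"
  by (simp add: lift.simps[of "[x]"] conv_def d_i s.zero)

lemma linear_i: "i (sm c x + y) = sm c (i x) + i y"
  by (simp add: i_def h\<^sub>0.add h\<^sub>0.scale d.add d.scale scale_right_diff_distrib)

lemma linear_h: "h (sm c x + y) = sm c (h x) + h y"
  by (simp add: h_def h\<^sub>0.add h\<^sub>0.scale h\<^sub>1.add h\<^sub>1.scale scale_right_diff_distrib)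

lemma multilinear_conv:
  assumes "\<And>ys k c y. length ys < length xs \<Longrightarrow> k < length ys \<Longrightarrow>
      F (ys[k := sm c (ys ! k) + y]) = sm c (F ys) + F (ys[k := y])"
    and "k < length xs"
  shows "conv F (xs[k := sm c (xs ! k) + y]) = sm c (conv F xs) + conv F (xs[k := y])"
proof -
  let ?u = "xs[k := sm c (xs ! k) + y]" and ?v = "xs[k := y]"
  have "\<tau> (F (take p ?u)) \<odot> F (drop p ?u)
      = sm c (\<tau> (F (take p xs)) \<odot> F (drop p xs)) + \<tau> (F (take p ?v)) \<odot> F (drop p ?v)"
    if p: "1 \<le> p" "p < length xs" for p
  proof (cases "k < p")
    case True
    then show ?thesis
      using p assms(1)[of "take p xs" k c y] assms(2)
      by (simp add: take_update_swap \<tau>.add \<tau>.scale mul_add_left mul_scale_left)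
  next
    case False
    then show ?thesis
      using p assms(1)[of "drop p xs" "k - p" c y] assms(2)
      by (simp add: drop_update_swap mul_add_right mul_scale_right)
  qed
  then show ?thesis
    by (simp add: conv_def scale_sum_right flip: sum.distrib)
qed

lemma multilinear_naive: "multilinear sm naive"
  unfolding multilinear_def
proof (intro allI impI)
  fix xs :: "'a list" and k c y
  assume "k < length xs"
  then show "naive (xs[k := sm c (xs ! k) + y]) = sm c (naive xs) + naive (xs[k := y])"
  proof (induction xs rule: rev_induct)
    case (snoc z xs)
    show ?case
    proof (cases "xs = []")
      case True
      with snoc.prems show ?thesis by (simp add: linear_i)
    next
      case False
      then show ?thesis
        using snoc
        by (cases "k < length xs")
           (auto simp: list_update_append nth_append naive_snoc linear_h mul_add_left mul_add_right
             mul_scale_left mul_scale_right)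
    qed
  qed simp
qed

lemma multilinear_lift: "multilinear sm lift"
  unfolding multilinear_def
proof (intro allI impI)
  fix xs :: "'a list" and k c y
  assume "k < length xs"
  then show "lift (xs[k := sm c (xs ! k) + y]) = sm c (lift xs) + lift (xs[k := y])"
  proof (induction xs arbitrary: k c y rule: length_induct)
    case (1 xs)
    let ?u = "xs[k := sm c (xs ! k) + y]" and ?v = "xs[k := y]"
    have "conv lift ?u = sm c (conv lift xs) + conv lift ?v"
      using 1 by (intro multilinear_conv) auto
    moreover have "naive ?u = sm c (naive xs) + naive ?v"
      by (rule multilinearD[OF multilinear_naive 1(2)])
    ultimately show ?case
      unfolding lift.simps[of ?u] lift.simps[of xs] lift.simps[of ?v]
      by (simp add: d.add d.scale s.add s.scale s.diff scale_right_diff_distrib scale_right_distrib)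
  qed
qed

end


section \<open>A-infinity identities for differential graded algebras\<close>

text \<open>The operations of the algebras considered here all have this form; for \<^const>\<open>cochain_algebra\<close> it is
  the defining one.\<close>

definition dg_ops :: "('a \<Rightarrow> 'a) \<Rightarrow> ('a \<Rightarrow> 'a \<Rightarrow> 'a) \<Rightarrow> 'a list \<Rightarrow> 'a::zero" where
  "dg_ops d mul xs = (case xs of [x] \<Rightarrow> d x | [x, y] \<Rightarrow> mul x y | _ \<Rightarrow> 0)"

lemma dg_ops_simps [simp]:
  "dg_ops d mul [x] = d x" "dg_ops d mul [x, y] = mul x y"
  by (simp_all add: dg_ops_def)

lemma dg_ops_long: "3 \<le> length xs \<Longrightarrow> dg_ops d mul xs = 0"
  by (auto simp: dg_ops_def split: list.split)

lemma minus_one_powi: "(- 1 :: 'k::field) powi m = (if even m then 1 else - 1)"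
  by (auto simp: power_int_def even_nat_iff)

text \<open>Only \<open>s = 1\<close> and \<open>s = 2\<close> contribute, as the higher operations are zero. The assumption on \<open>g\<close> says
  that \<open>g\<close> vanishes when a zero is inserted, which holds for multilinear maps; in the \<open>s = 2\<close> sum the
  exponent \<open>r + 2t\<close> has the parity of \<open>r\<close>.\<close>

lemma insertion_sum_dg:
  assumes "ops A = dg_ops d mul" and "\<And>c. sm c 0 = 0"
    and "\<And>r s. 3 \<le> s \<Longrightarrow> r + s \<le> length xs \<Longrightarrow> g (take r xs @ 0 # drop (r + s) xs) = 0"
  shows "insertion_sum A sm g ds xs =
      (\<Sum>r<length xs. sm ((- 1) powi (int r + int (length xs - Suc r) + sum_list (take r ds)))
         (g (take r xs @ d (xs ! r) # drop (Suc r) xs)))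
    + (\<Sum>r<length xs - 1. sm ((- 1) powi int r)
         (g (take r xs @ mul (xs ! r) (xs ! Suc r) # drop (Suc (Suc r)) xs)))"
proof -
  let ?n = "length xs"
  let ?T = "\<lambda>(r, s, t). sm ((- 1) powi (int r + int s * int t + (2 - int s) * sum_list (take r ds)))
          (g (take r xs @ ops A (take s (drop r xs)) # drop (r + s) xs))"
  define S where "S k = {(r, s, t). r + s + t = ?n \<and> s = k}" for k :: nat
  define S3 where "S3 = {(r, s, t). r + s + t = ?n \<and> s \<ge> (3 :: nat)}"
  have "finite {(r, s, t). r + s + t = ?n}"
    by (rule finite_subset[of _ "{..?n} \<times> {..?n} \<times> {..?n}"]) auto
  then have fin: "finite (S 1)" "finite (S 2)" "finite S3"
    by (auto intro: rev_finite_subset simp: S_def S3_def)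
  have "{(r, s, t). r + s + t = ?n \<and> s \<ge> 1} = S 1 \<union> S 2 \<union> S3"
    by (auto simp: S_def S3_def)
  moreover have "S 1 \<inter> S 2 = {}" "(S 1 \<union> S 2) \<inter> S3 = {}"
    by (auto simp: S_def S3_def)
  ultimately have "insertion_sum A sm g ds xs = sum ?T (S 1) + sum ?T (S 2) + sum ?T S3"
    unfolding insertion_sum_def using fin by (simp add: sum.union_disjoint)
  also have "sum ?T S3 = 0"
    by (rule sum.neutral) (auto simp: S3_def assms dg_ops_long)
  also have "sum ?T (S 1) = (\<Sum>r<?n. sm ((- 1) powi (int r + int (?n - Suc r) + sum_list (take r ds)))
         (g (take r xs @ d (xs ! r) # drop (Suc r) xs)))"
    by (rule sum.reindex_bij_witness[of _ "\<lambda>r. (r, 1, ?n - Suc r)" fst])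
       (auto simp: S_def assms(1) take_Suc_conv_app_nth hd_drop_conv_nth take_Suc eq_commute[of "Suc _" "length xs"])
  also have "sum ?T (S 2) = (\<Sum>r<?n - 1. sm ((- 1) powi int r)
         (g (take r xs @ mul (xs ! r) (xs ! Suc r) # drop (Suc (Suc r)) xs)))"
  proof (rule sum.reindex_bij_witness[of _ "\<lambda>r. (r, 2, ?n - Suc (Suc r))" fst])
    fix q assume q: "q \<in> S 2"
    then obtain r t where rt: "q = (r, 2, t)" "r + 2 + t = ?n" by (auto simp: S_def)
    then have "drop r xs = xs ! r # xs ! Suc r # drop (Suc (Suc r)) xs"
      by (simp add: Cons_nth_drop_Suc)
    then have "take 2 (drop r xs) = [xs ! r, xs ! Suc r]" by simp
    then show "sm ((- 1) powi int (fst q))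
         (g (take (fst q) xs @ mul (xs ! fst q) (xs ! Suc (fst q)) # drop (Suc (Suc (fst q))) xs)) = ?T q"
      by (simp add: rt(1) assms(1) minus_one_powi)
  qed (auto simp: S_def)
  finally show ?thesis by simp
qed

lemma homogeneous_length: "homogeneous A ds xs \<Longrightarrow> length ds = length xs"
  by (simp add: homogeneous_def list_all2_lengthD)

lemma homogeneous_Cons_right:
  "homogeneous A ds (x # xs) \<longleftrightarrow> (\<exists>i ds'. ds = i # ds' \<and> x \<in> part A i \<and> homogeneous A ds' xs)"
  by (auto simp: homogeneous_def list_all2_Cons2)

lemma homogeneous_Nil_right [simp]: "homogeneous A ds [] \<longleftrightarrow> ds = []"
  by (simp add: homogeneous_def)

lemma homogeneous_take_drop:
  "homogeneous A ds xs \<Longrightarrow> homogeneous A (take p ds) (take p xs) \<and> homogeneous A (drop p ds) (drop p xs)"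
  by (simp add: homogeneous_def list_all2_takeI list_all2_dropI)

lemma dg_algebraI:
  fixes A :: "('k::field, 'a::ab_group_add) graded_ops"
  assumes ops: "ops A = dg_ops d mul" and gvs: "graded_vector_space A"
    and zero: "d 0 = 0" "\<And>x. mul 0 x = 0" "\<And>x. mul x 0 = 0"
    and d: "\<And>i x. x \<in> part A i \<Longrightarrow> d x \<in> part A (i + 1)"
      "\<And>i c x y. x \<in> part A i \<Longrightarrow> y \<in> part A i \<Longrightarrow> d (smul A c x + y) = smul A c (d x) + d y"
    and mul: "\<And>i j x y. x \<in> part A i \<Longrightarrow> y \<in> part A j \<Longrightarrow> mul x y \<in> part A (i + j)"
      "\<And>i j c x x' y. x \<in> part A i \<Longrightarrow> x' \<in> part A i \<Longrightarrow> y \<in> part A j \<Longrightarrow>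
         mul (smul A c x + x') y = smul A c (mul x y) + mul x' y"
      "\<And>i j c x y y'. x \<in> part A i \<Longrightarrow> y \<in> part A j \<Longrightarrow> y' \<in> part A j \<Longrightarrow>
         mul x (smul A c y + y') = smul A c (mul x y) + mul x y'"
    and d_d: "\<And>i x. x \<in> part A i \<Longrightarrow> d (d x) = 0"
    and leibniz: "\<And>i j x y. x \<in> part A i \<Longrightarrow> y \<in> part A j \<Longrightarrow>
         d (mul x y) = mul (d x) y + smul A ((- 1) powi i) (mul x (d y))"
    and assoc: "\<And>i j k x y z. x \<in> part A i \<Longrightarrow> y \<in> part A j \<Longrightarrow> z \<in> part A k \<Longrightarrow>
         mul (mul x y) z = mul x (mul y z)"
  shows "dg_algebra A"
proof -
  interpret vector_space "smul A" using gvs by (simp add: graded_vector_space_def)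
  have sub: "subspace (part A i)" for i using gvs by (simp add: graded_vector_space_def)
  have "graded_multilinear A A n (2 - int n) (ops A)" if n: "n \<ge> 1" for n
  proof -
    consider "n = 1" | "n = 2" | "n \<ge> 3" using n by linarith
    then show ?thesis
    proof cases
      case 3
      then show ?thesis
        by (simp add: graded_multilinear_def ops dg_ops_long subspace_0[OF sub])
    next
      case 1
      then show ?thesis
        by (auto simp: graded_multilinear_def ops length_Suc_conv homogeneous_Cons_right d)
    next
      case 2
      then show ?thesis
        using mul(1)
        by (auto simp: graded_multilinear_def ops length_Suc_conv numeral_2_eq_2 homogeneous_Cons_right
            mul(2,3) less_Suc_eq)
    qed
  qed
  moreover have "insertion_sum A (smul A) (ops A) ds xs = 0"
    if xs: "xs \<noteq> []" "homogeneous A ds xs" for ds xs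
  proof -
    have ops_zero: "ops A (us @ 0 # vs) = 0" for us vs
      by (auto simp: ops dg_ops_def zero append_eq_Cons_conv split: list.split)
    note ins = insertion_sum_dg[where A = A and sm = "smul A" and g = "ops A" and xs = xs and ds = ds,
        OF ops scale_zero_right ops_zero]
    consider "length xs = 1" | "length xs = 2" | "length xs = 3" | "length xs \<ge> 4"
      using xs(1) by (cases xs; cases "tl xs"; cases "tl (tl xs)"; cases "tl (tl (tl xs))") auto
    then show ?thesis
    proof cases
      case 1
      then obtain x where "xs = [x]" by (auto simp: length_Suc_conv)
      then show ?thesis using ins xs by (auto simp: ops homogeneous_Cons_right d_d)
    next
      case 2
      then obtain x y where "xs = [x, y]" by (auto simp: length_Suc_conv numeral_2_eq_2)
      then show ?thesis
        using ins xs
        by (auto simp: ops homogeneous_Cons_right leibniz numeral_2_eq_2 minus_one_powi)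
    next
      case 3
      then obtain x y z where "xs = [x, y, z]" by (auto simp: length_Suc_conv numeral_3_eq_3)
      then show ?thesis
        using ins xs
        by (auto simp: ops homogeneous_Cons_right numeral_2_eq_2 dg_ops_long minus_one_powi assoc
            lessThan_Suc)
    next
      case 4
      then show ?thesis using ins by (simp add: ops dg_ops_long)
    qed
  qed
  ultimately show ?thesis
    using gvs by (auto simp: dg_algebra_def A_inf_algebra_def ops dg_ops_long)
qed

lemma map_blocks_length: "length (map_blocks f is xs) = length is"
  by (induction f "is" xs rule: map_blocks.induct) auto

text \<open>On the target side only decompositions into one or two blocks contribute.\<close>

lemma block_sum_dg:
  fixes B :: "('k::field, 'b::ab_group_add) graded_ops"
  assumes ops: "ops B = dg_ops d mul" and "\<And>c. smul B c 0 = 0" "\<And>x. smul B 1 x = x" and "xs \<noteq> []"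
  shows "(\<Sum>k = 1..length xs.
           \<Sum>is \<in> {is. length is = k \<and> sum_list is = length xs \<and> (\<forall>i\<in>set is. i \<ge> 1)}.
             smul B ((- 1) powi (block_sign is + block_koszul is ds)) (ops B (map_blocks f is xs)))
    = d (f xs) + (\<Sum>p\<in>{1..<length xs}.
        smul B ((- 1) powi (int p - 1 + (1 - int (length xs - p)) * sum_list (take p ds)))
          (mul (f (take p xs)) (f (drop p xs))))"
proof -
  let ?n = "length xs"
  let ?T = "\<lambda>is. smul B ((- 1) powi (block_sign is + block_koszul is ds)) (ops B (map_blocks f is xs))"
  define I where "I k = {is. length is = k \<and> sum_list is = ?n \<and> (\<forall>i\<in>set is. i \<ge> 1)}" for k
  have n: "?n \<ge> 1" using assms(4) by (simp add: Suc_le_eq)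
  have I1: "I 1 = {[?n]}"
    using n by (auto simp: I_def length_Suc_conv)
  have I2: "sum ?T (I 2) = (\<Sum>p\<in>{1..<?n}.
        smul B ((- 1) powi (int p - 1 + (1 - int (?n - p)) * sum_list (take p ds)))
          (mul (f (take p xs)) (f (drop p xs))))"
    by (rule sum.reindex_bij_witness[of _ "\<lambda>p. [p, ?n - p]" hd])
       (auto simp: I_def length_Suc_conv numeral_2_eq_2 ops block_sign_def block_koszul_def
         eq_commute[of "_ + _" "length xs"])
  have "(\<Sum>k = 1..?n. sum ?T (I k)) = (\<Sum>k\<in>{1, 2}. sum ?T (I k))"
  proof (rule sum.mono_neutral_cong)
    fix k assume "k \<in> {1..?n} - {1, 2}"
    then show "sum ?T (I k) = 0"
      by (intro sum.neutral) (auto simp: I_def ops dg_ops_long map_blocks_length assms)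
  next
    fix k assume "k \<in> {1, 2} - {1..?n}"
    then show "sum ?T (I k) = 0"
      using n I2 by (cases "?n = 1") auto
  qed auto
  also have "\<dots> = d (f xs) + sum ?T (I 2)"
    by (simp add: I1[simplified] ops block_sign_def block_koszul_def assms)
  finally show ?thesis
    unfolding I2 unfolding I_def .
qed


subsection \<open>Complements and multilinear maps\<close>

lemma (in vector_space) subspace_complement_exists:
  assumes "subspace S" "subspace T" "S \<subseteq> T"
  obtains W where "subspace W" "W \<subseteq> T" "W \<inter> S = {0}" "\<And>x. x \<in> T \<Longrightarrow> \<exists>w\<in>W. x - w \<in> S"
proof -
  obtain B where B: "B \<subseteq> S" "independent B" "S \<subseteq> span B"
    using maximal_independent_subset by blast
  obtain C where C: "B \<subseteq> C" "C \<subseteq> T" "independent C" "T \<subseteq> span C"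
    using maximal_independent_subset_extend[of B T] B assms(3) by blast
  have spanB: "span B = S" using B assms(1) by (simp add: span_subspace)
  show thesis
  proof
    show "subspace (span (C - B))" by simp
    show "span (C - B) \<subseteq> T" using C(2) assms(2) by (meson Diff_subset span_minimal subset_trans)
    interpret vector_space_pair scale scale by unfold_locales
    obtain g where g: "Vector_Spaces.linear scale scale g" "\<forall>x\<in>C. g x = (if x \<in> B then x else 0)"
      using linear_independent_extend[OF C(3), of "\<lambda>x. if x \<in> B then x else 0"] by blast
    interpret g: Vector_Spaces.linear scale scale g by (rule g(1))
    have "g x = 0" if "x \<in> span (C - B)" for x
      by (rule g.eq_0_on_span[OF _ that]) (use g(2) in auto)
    moreover have "g x = x" if "x \<in> span B" for x
      by (rule linear_eq_on[OF g(1) linear_ident that]) (use g(2) C(1) in auto)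
    ultimately show "span (C - B) \<inter> S = {0}"
      by (force simp: spanB subspace_0[OF assms(1)] span_zero)
    fix x assume "x \<in> T"
    then have "x \<in> span ((C - B) \<union> B)" using C by (auto simp: Un_absorb2)
    then obtain w b where "w \<in> span (C - B)" "b \<in> span B" "x = w + b"
      unfolding span_Un by blast
    then show "\<exists>w\<in>span (C - B). x - w \<in> S"
      by (intro bexI[of _ w]) (auto simp: spanB)
  qed
qed

lemma (in vector_space) multilinear_zero:
  assumes "multilinear scale F"
  shows "F (us @ 0 # vs) = 0"
  using multilinearD[OF assms, of "length us" "us @ 0 # vs" 1 0] by simp

lemma (in vector_space) multilinear_scale:
  assumes "multilinear scale F"
  shows "F (us @ scale c x # vs) = scale c (F (us @ x # vs))"
  using multilinearD[OF assms, of "length us" "us @ x # vs" c 0] multilinear_zero[OF assms, of us vs]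
  by simp

lemma multilinear_zero_mem:
  assumes "vector_space sm" "multilinear sm F" "0 \<in> set xs"
  shows "F xs = 0"
  using vector_space.multilinear_zero[OF assms(1,2)] split_list[OF assms(3)] by auto


section \<open>A formality criterion\<close>

text \<open>Now the degrees enter. The homogeneous parts need not span the ring: for cochains it is the
  product over all degrees. The last assumption is the dichotomy between a space with only the
  constants in degree \<open>0\<close> and a space without cohomology in positive degrees; either way a cocycle
  of degree \<open>0\<close> acts on positive-degree cohomology as a scalar.\<close>

locale graded_null_product_ring = null_product_ring sm mul d \<tau> I\<^sub>0 I\<^sub>1 J h\<^sub>0 h\<^sub>1 s
  for sm :: "'k::field \<Rightarrow> 'a::ab_group_add \<Rightarrow> 'a"
    and mul (infixl "\<odot>" 70) and d \<tau> I\<^sub>0 I\<^sub>1 J h\<^sub>0 h\<^sub>1 s +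
  fixes part :: "int \<Rightarrow> 'a set" and one :: 'a
  assumes subspace_part: "subspace (part n)"
    and part_independent: "finite N \<Longrightarrow> (\<forall>n\<in>N. z n \<in> part n) \<Longrightarrow> (\<Sum>n\<in>N. z n) = 0 \<Longrightarrow> \<forall>n\<in>N. z n = 0"
    and part_neg: "n < 0 \<Longrightarrow> part n = {0}"
    and d_part: "x \<in> part n \<Longrightarrow> d x \<in> part (n + 1)"
    and mul_part: "x \<in> part m \<Longrightarrow> y \<in> part n \<Longrightarrow> x \<odot> y \<in> part (m + n)"
    and \<tau>_part: "x \<in> part n \<Longrightarrow> \<tau> x = sm ((- 1) powi n) x"
    and h\<^sub>0_part: "x \<in> part n \<Longrightarrow> h\<^sub>0 x \<in> part (n - 1)"
    and h\<^sub>1_part: "x \<in> part n \<Longrightarrow> h\<^sub>1 x \<in> part (n - 1)"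
    and s_part: "x \<in> part n \<Longrightarrow> s x \<in> part (n - 1)"
    and cocycle_I\<^sub>0: "x \<in> part n \<Longrightarrow> n > 0 \<Longrightarrow> d x = 0 \<Longrightarrow> x - d (h\<^sub>0 x) \<in> I\<^sub>0"
    and cocycle_I\<^sub>1: "x \<in> part n \<Longrightarrow> n > 0 \<Longrightarrow> d x = 0 \<Longrightarrow> x - d (h\<^sub>1 x) \<in> I\<^sub>1"
    and one_mul: "x \<in> part n \<Longrightarrow> one \<odot> x = x"
    and mul_one: "x \<in> part n \<Longrightarrow> x \<odot> one = x"
    and connected_or_acyclic:
      "(\<forall>x\<in>part 0. d x = 0 \<longrightarrow> (\<exists>c. x = sm c one)) \<or>
       (\<forall>n>0. \<forall>x\<in>part n. d x = 0 \<longrightarrow> x \<in> d ` part (n - 1))"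
begin

definition alg :: "('k, 'a) graded_ops" where
  "alg = \<lparr>smul = sm, part = part, ops = dg_ops d (\<odot>)\<rparr>"

lemma alg_simps [simp]: "smul alg = sm" "graded_ops.part alg = part" "ops alg = dg_ops d (\<odot>)"
  by (simp_all add: alg_def)

lemma dg_algebra_alg: "dg_algebra alg"
proof (rule dg_algebraI[where d = d and mul = "(\<odot>)"])
  show "graded_vector_space alg"
    unfolding graded_vector_space_def alg_simps
    using vector_space_axioms subspace_part part_independent by blast
qed (auto simp: d.zero d_part d.add d.scale mul_part mul_add_left mul_add_right mul_scale_left
      mul_scale_right d_d leibniz mul_assoc \<tau>_part)

lemma part_disjoint:
  assumes "x \<in> part m" "x \<in> part n" "m \<noteq> n"
  shows "x = 0"
proof -
  have "\<forall>i\<in>{m, n}. (if i = m then x else - x) = 0"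
    using assms subspace_neg[OF subspace_part] by (intro part_independent) auto
  then show ?thesis by simp
qed

lemma i_part: "x \<in> part n \<Longrightarrow> i x \<in> part n"
  unfolding i_def using d_part[OF h\<^sub>0_part] by (intro subspace_diff[OF subspace_part]) auto

lemma h_part: "x \<in> part n \<Longrightarrow> h x \<in> part (n - 1)"
  unfolding h_def using h\<^sub>0_part h\<^sub>1_part by (intro subspace_diff[OF subspace_part]) auto

lemma i_part_0: "x \<in> part 0 \<Longrightarrow> i x = x"
  using h\<^sub>0_part[of x 0] part_neg[of "-1"] by (simp add: i_def d.zero)

lemma \<tau>_in_part: "x \<in> part n \<Longrightarrow> \<tau> x \<in> part n"
  by (simp add: \<tau>_part subspace_scale[OF subspace_part])

lemma naive_part:
  assumes "xs \<noteq> []" "homogeneous alg ds xs"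
  shows "naive xs \<in> part (sum_list ds + 1 - int (length xs))"
  using assms
proof (induction xs arbitrary: ds rule: rev_induct)
  case (snoc y xs)
  then obtain es n where ds: "ds = es @ [n]" and es: "homogeneous alg es xs" and y: "y \<in> part n"
    by (auto simp: homogeneous_def list_all2_append2 list_all2_Cons2)
  show ?case
  proof (cases "xs = []")
    case True
    with es y show ?thesis by (simp add: ds i_part)
  next
    case False
    have eq: "sum_list es + 1 - int (length xs) + (n - 1) = sum_list ds + 1 - int (length (xs @ [y]))"
      by (simp add: ds)
    show ?thesis
      using mul_part[OF snoc.IH[OF False es] h_part[OF y]] unfolding eq naive_snoc[OF False] .
  qed
qed simp

lemma conv_part:
  assumes "\<And>p. 1 \<le> p \<Longrightarrow> p < length xs \<Longrightarrow> F (take p xs) \<in> part (sum_list (take p ds) + 1 - int p)"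
    and "\<And>p. 1 \<le> p \<Longrightarrow> p < length xs \<Longrightarrow>
      F (drop p xs) \<in> part (sum_list (drop p ds) + 1 - int (length xs - p))"
  shows "conv F xs \<in> part (sum_list ds + 2 - int (length xs))"
  unfolding conv_def
proof (rule subspace_sum[OF subspace_part])
  fix p assume p: "p \<in> {1..<length xs}"
  have "sum_list (take p ds) + sum_list (drop p ds) = sum_list ds"
    by (simp flip: sum_list_append)
  then have eq: "sum_list (take p ds) + 1 - int p + (sum_list (drop p ds) + 1 - int (length xs - p))
      = sum_list ds + 2 - int (length xs)"
    using p by auto
  have "\<tau> (F (take p xs)) \<odot> F (drop p xs)
      \<in> part (sum_list (take p ds) + 1 - int p + (sum_list (drop p ds) + 1 - int (length xs - p)))"
    by (intro mul_part \<tau>_in_part assms) (use p in auto)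
  then show "\<tau> (F (take p xs)) \<odot> F (drop p xs) \<in> part (sum_list ds + 2 - int (length xs))"
    unfolding eq .
qed

lemma lift_part:
  assumes "xs \<noteq> []" "homogeneous alg ds xs"
  shows "lift xs \<in> part (sum_list ds + 1 - int (length xs))"
  using assms
proof (induction xs arbitrary: ds rule: length_induct)
  case (1 xs)
  have take_drop: "lift (take p xs) \<in> part (sum_list (take p ds) + 1 - int p)"
    "lift (drop p xs) \<in> part (sum_list (drop p ds) + 1 - int (length xs - p))"
    if p: "1 \<le> p" "p < length xs" for p
  proof -
    have "lift (take p xs) \<in> part (sum_list (take p ds) + 1 - int (length (take p xs)))"
      using p homogeneous_take_drop[OF 1(3), of p]
      by (intro 1(1)[rule_format, of "take p xs" "take p ds"]) auto
    then show "lift (take p xs) \<in> part (sum_list (take p ds) + 1 - int p)" using p by simp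
    have "lift (drop p xs) \<in> part (sum_list (drop p ds) + 1 - int (length (drop p xs)))"
      using p homogeneous_take_drop[OF 1(3), of p]
      by (intro 1(1)[rule_format, of "drop p xs" "drop p ds"]) auto
    then show "lift (drop p xs) \<in> part (sum_list (drop p ds) + 1 - int (length xs - p))" by simp
  qed
  have "conv lift xs + d (naive xs) \<in> part (sum_list ds + 2 - int (length xs))"
    using conv_part[of xs lift ds] take_drop d_part[OF naive_part[OF 1(2,3)]]
    by (intro subspace_add[OF subspace_part]) (auto simp: algebra_simps)
  from s_part[OF this] naive_part[OF 1(2,3)] show ?case
    by (subst lift.simps) (auto intro!: subspace_diff[OF subspace_part] simp: algebra_simps)
qed

text \<open>The \<open>k\<close>-th of \<open>n\<close> arguments is replaced by its image under \<open>\<tau>\<^bsup>n-k\<^esup>\<close>. On homogeneous elements this is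
  the sign of the decalage isomorphism, but in a form that does not mention degrees, as a morphism
  is a function of the elements alone.\<close>

fun twist :: "'a list \<Rightarrow> 'a list" where
  "twist [] = []"
| "twist (x # xs) = (\<tau> ^^ length xs) x # twist xs"

lemma twist_length [simp]: "length (twist xs) = length xs"
  by (induction xs) auto

lemma \<tau>_power_linear: "(\<tau> ^^ n) (sm c x + y) = sm c ((\<tau> ^^ n) x) + (\<tau> ^^ n) y"
  by (induction n) (simp_all add: \<tau>.add \<tau>.scale)

lemma twist_update: "k < length xs \<Longrightarrow> twist (xs[k := v]) = (twist xs)[k := (\<tau> ^^ (length xs - Suc k)) v]"
  by (induction xs arbitrary: k) (auto split: nat.split)

lemma twist_nth: "k < length xs \<Longrightarrow> twist xs ! k = (\<tau> ^^ (length xs - Suc k)) (xs ! k)"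
  by (induction xs arbitrary: k) (auto simp: nth_Cons split: nat.split)

lemma \<tau>_power_part: "x \<in> part n \<Longrightarrow> (\<tau> ^^ m) x = sm ((- 1) powi (int m * n)) x"
  by (induction m) (auto simp: \<tau>.scale \<tau>_part minus_one_powi)

definition twisted_lift :: "'a list \<Rightarrow> 'a" where
  "twisted_lift xs = lift (twist xs)"

lemma multilinear_twisted_lift: "multilinear sm twisted_lift"
  unfolding multilinear_def twisted_lift_def
proof (intro allI impI)
  fix xs :: "'a list" and k c y
  assume k: "k < length xs"
  then show "lift (twist (xs[k := sm c (xs ! k) + y])) = sm c (lift (twist xs)) + lift (twist (xs[k := y]))"
    using multilinearD[OF multilinear_lift, of k "twist xs"]
    by (simp add: twist_update \<tau>_power_linear twist_nth)
qed

text \<open>The exponent \<open>\<Sum> (n - k) |x\<^sub>k|\<close> of the sign introduced by \<^const>\<open>twist\<close>.\<close>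

fun decalage :: "int list \<Rightarrow> int" where
  "decalage [] = 0"
| "decalage (n # ds) = int (length ds) * n + decalage ds"

lemma decalage_append:
  "decalage (as @ bs) = decalage as + int (length bs) * sum_list as + decalage bs"
  by (induction as) (auto simp: algebra_simps)

lemma twisted_lift_eq:
  assumes "homogeneous alg ds xs"
  shows "twisted_lift xs = sm ((- 1) powi (decalage ds)) (lift xs)"
proof -
  have "lift (us @ twist xs) = sm ((- 1) powi (decalage ds)) (lift (us @ xs))" for us
    using assms
  proof (induction xs arbitrary: us ds)
    case (Cons x xs)
    then obtain n es where ds: "ds = n # es" "x \<in> part n" "homogeneous alg es xs"
      by (auto simp: homogeneous_Cons_right)
    have "lift (us @ twist (x # xs))
        = sm ((- 1) powi (int (length xs) * n)) (lift (us @ x # twist xs))"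
      using ds by (simp add: \<tau>_power_part multilinear_scale[OF multilinear_lift])
    also have "lift (us @ x # twist xs) = sm ((- 1) powi (decalage es)) (lift (us @ x # xs))"
      using Cons.IH[OF ds(3), of "us @ [x]"] by simp
    finally show ?case
      using homogeneous_length[OF ds(3)] by (simp add: ds(1) power_int_add)
  qed simp
  from this[of "[]"] show ?thesis by (simp add: twisted_lift_def)
qed

lemma twisted_lift_part:
  assumes "xs \<noteq> []" "homogeneous alg ds xs"
  shows "twisted_lift xs \<in> part (sum_list ds + 1 - int (length xs))"
  using assms by (simp add: twisted_lift_eq lift_part subspace_scale[OF subspace_part])

text \<open>Comparison of signs. With \<open>D\<close> the total degree of the first \<open>p\<close> arguments and \<open>q = n - p\<close>, the
  decalage exponent of the list is that of the two blocks plus \<open>q D\<close>, and \<open>\<tau>\<close> contributes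
  \<open>D + 1 - p\<close>, the degree of \<open>lift\<close> on the first block. Together this differs by an odd number from
  the exponent \<open>p - 1 + (1 - q) D\<close> in the definition of a morphism, which accounts for the minus
  sign in \<open>d_lift\<close>.\<close>

lemma d_twisted_lift:
  assumes "xs \<noteq> []" and hom: "homogeneous alg ds xs" and "set xs \<subseteq> liftable"
  shows "d (twisted_lift xs) + (\<Sum>p\<in>{1..<length xs}.
      sm ((- 1) powi (int p - 1 + (1 - int (length xs - p)) * sum_list (take p ds)))
        (twisted_lift (take p xs) \<odot> twisted_lift (drop p xs))) = 0"
proof -
  let ?n = "length xs"
  have len: "length ds = ?n" using homogeneous_length[OF hom] .
  have "sm ((- 1) powi (int p - 1 + (1 - int (?n - p)) * sum_list (take p ds)))
        (twisted_lift (take p xs) \<odot> twisted_lift (drop p xs))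
      = sm ((- 1) powi decalage ds) (\<tau> (lift (take p xs)) \<odot> lift (drop p xs))"
    if p: "p \<in> {1..<?n}" for p
  proof -
    let ?D = "sum_list (take p ds)"
    note td = homogeneous_take_drop[OF hom, of p]
    have parity: "even (a + q * e + b + (e + 1 - r)) \<longleftrightarrow> even (r - 1 + (1 - q) * e + (a + b))" for a b e q r :: int
      by auto
    have "take p xs \<noteq> []" using p by auto
    then have \<tau>: "\<tau> (lift (take p xs)) = sm ((- 1) powi (?D + 1 - int p)) (lift (take p xs))"
      using lift_part[of "take p xs" "take p ds"] td p by (simp add: \<tau>_part)
    have "decalage ds = decalage (take p ds) + int (?n - p) * ?D + decalage (drop p ds)"
      using decalage_append[of "take p ds" "drop p ds"] len by simp
    then have "even (decalage ds + (?D + 1 - int p)) \<longleftrightarrow>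
        even (int p - 1 + (1 - int (?n - p)) * ?D + (decalage (take p ds) + decalage (drop p ds)))"
      using parity[of "decalage (take p ds)" "int (?n - p)" ?D "decalage (drop p ds)" "int p"] by (simp only:)
    then have "(- 1 :: 'k) powi (decalage ds + (?D + 1 - int p))
        = (- 1) powi (int p - 1 + (1 - int (?n - p)) * ?D + (decalage (take p ds) + decalage (drop p ds)))"
      by (simp only: minus_one_powi)
    then have sign: "(- 1 :: 'k) powi decalage ds * (- 1) powi (?D + 1 - int p)
        = (- 1) powi (int p - 1 + (1 - int (?n - p)) * ?D)
          * ((- 1) powi decalage (take p ds) * (- 1) powi decalage (drop p ds))"
      by (simp only: power_int_add[symmetric] neg_equal_0_iff_equal one_neq_zero not_False_eq_True simp_thms)
    have "twisted_lift (take p xs) \<odot> twisted_lift (drop p xs)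
        = sm ((- 1) powi decalage (take p ds) * (- 1) powi decalage (drop p ds))
            (lift (take p xs) \<odot> lift (drop p xs))"
      unfolding twisted_lift_eq[OF td[THEN conjunct1]] twisted_lift_eq[OF td[THEN conjunct2]]
      by (simp add: mul_scale_left mul_scale_right mult.commute)
    then show ?thesis
      by (simp only: \<tau> mul_scale_left scale_scale sign)
  qed
  then have "(\<Sum>p\<in>{1..<?n}. sm ((- 1) powi (int p - 1 + (1 - int (?n - p)) * sum_list (take p ds)))
        (twisted_lift (take p xs) \<odot> twisted_lift (drop p xs)))
      = sm ((- 1) powi decalage ds) (conv lift xs)"
    by (simp add: conv_def scale_sum_right)
  moreover have "d (twisted_lift xs) = - sm ((- 1) powi decalage ds) (conv lift xs)"
    using d_lift[OF assms(1,3)] by (simp add: twisted_lift_eq[OF hom] d.scale)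
  ultimately show ?thesis by simp
qed

end


subsection \<open>The morphism from cohomology\<close>

text \<open>A choice of representatives: \<open>H n\<close> is a complement of the coboundaries in the cocycles of degree
  \<open>n\<close>. In degree \<open>0\<close> there are no coboundaries, so \<open>H 0\<close> consists of all cocycles.\<close>

locale cohomology_complement =
  graded_null_product_ring sm mul d \<tau> I\<^sub>0 I\<^sub>1 J h\<^sub>0 h\<^sub>1 s part one
  for sm :: "'k::field \<Rightarrow> 'a::ab_group_add \<Rightarrow> 'a"
    and mul (infixl "\<odot>" 70) and d \<tau> I\<^sub>0 I\<^sub>1 J h\<^sub>0 h\<^sub>1 s part one +
  fixes H :: "int \<Rightarrow> 'a set"
  assumes subspace_H: "subspace (H n)"
    and H_cocycle: "x \<in> H n \<Longrightarrow> x \<in> part n \<and> d x = 0"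
    and H_coboundary: "x \<in> H n \<Longrightarrow> x \<in> d ` part (n - 1) \<Longrightarrow> x = 0"
    and H_represents: "x \<in> part n \<Longrightarrow> d x = 0 \<Longrightarrow> \<exists>w\<in>H n. x - w \<in> d ` part (n - 1)"
begin

text \<open>The product induced on cohomology: products of two elements of positive degree vanish, and for
  the remaining ones the product of representatives is again the chosen representative.\<close>

definition hprod :: "'a \<Rightarrow> 'a \<Rightarrow> 'a" where
  "hprod x y = (if x \<in> H 0 \<or> y \<in> H 0 then x \<odot> y else 0)"

definition halg :: "('k, 'a) graded_ops" where
  "halg = \<lparr>smul = sm, part = H, ops = dg_ops (\<lambda>_. 0) hprod\<rparr>"

text \<open>The strictly unital extension: components of arity at least two vanish when an argument has
  degree \<open>0\<close>. An element of \<open>H n\<close> with \<open>n \<noteq> 0\<close> lies in \<open>H 0\<close> only if it is zero, so this is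
  consistent with multilinearity.\<close>

definition hmap :: "'a list \<Rightarrow> 'a" where
  "hmap xs = (if 2 \<le> length xs \<and> (\<exists>x\<in>set xs. x \<in> H 0) then 0 else twisted_lift xs)"

lemma halg_simps [simp]: "smul halg = sm" "graded_ops.part halg = H" "ops halg = dg_ops (\<lambda>_. 0) hprod"
  by (simp_all add: halg_def)

lemma zero_in_H [simp]: "0 \<in> H n"
  using subspace_0[OF subspace_H] .

lemma homogeneous_alg: "homogeneous halg ds xs \<Longrightarrow> homogeneous alg ds xs"
  using H_cocycle by (auto simp: homogeneous_def elim: list_all2_mono)

lemma H_disjoint: "x \<in> H m \<Longrightarrow> x \<in> H n \<Longrightarrow> m \<noteq> n \<Longrightarrow> x = 0"
  using H_cocycle part_disjoint by blast

lemma H_neg: "x \<in> H n \<Longrightarrow> n < 0 \<Longrightarrow> x = 0"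
  using H_cocycle part_neg by blast

lemma H_0: "x \<in> H 0 \<longleftrightarrow> x \<in> part 0 \<and> d x = 0"
  using H_cocycle[of x 0] H_represents[of x 0] part_neg[of "-1"] by (auto simp: d.zero)

lemma H_liftable: "x \<in> H n \<Longrightarrow> n > 0 \<Longrightarrow> x \<in> liftable"
  using H_cocycle[of x n] cocycle_I\<^sub>0[of x n] cocycle_I\<^sub>1[of x n] by (auto simp: liftable_def i_def j_def)

lemma H_0_scalar:
  assumes "x \<in> H n" "n > 0" "x \<noteq> 0" "b \<in> H 0"
  obtains c where "b = sm c one"
  using assms connected_or_acyclic H_coboundary[of x n] H_cocycle[of x n] H_0[of b] by blast

lemma H_0_mul: "x \<in> H 0 \<Longrightarrow> y \<in> H 0 \<Longrightarrow> x \<odot> y \<in> H 0"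
  using mul_part[of x 0 y 0] by (auto simp: H_0 leibniz)

lemma H_scale: "x \<in> H n \<Longrightarrow> sm c x \<in> H n"
  by (rule subspace_scale[OF subspace_H])

lemma hprod_eq:
  assumes "x \<in> H m" "y \<in> H n"
  shows "hprod x y = (if m = 0 \<or> n = 0 then x \<odot> y else 0)"
  using assms H_disjoint[of x m 0] H_disjoint[of y n 0] by (auto simp: hprod_def)

lemma hprod_0 [simp]: "hprod 0 x = 0" "hprod x 0 = 0"
  by (simp_all add: hprod_def)

lemma H_0_mul_cases:
  assumes "b \<in> H 0" "x \<in> H n"
  shows "b \<odot> x \<in> H n" "x \<odot> b \<in> H n"
proof -
  consider "n = 0" | "x = 0" | "n > 0" "x \<noteq> 0" using H_neg[OF assms(2)] by linarith
  then have "b \<odot> x \<in> H n \<and> x \<odot> b \<in> H n"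
  proof cases
    case 3
    then obtain c where "b = sm c one" using H_0_scalar assms by blast
    moreover have "x \<in> part n" using assms H_cocycle by blast
    ultimately show ?thesis
      using assms by (simp add: mul_scale_left mul_scale_right one_mul mul_one H_scale)
  qed (use assms H_0_mul in auto)
  then show "b \<odot> x \<in> H n" "x \<odot> b \<in> H n" by auto
qed

lemma hprod_H: "x \<in> H m \<Longrightarrow> y \<in> H n \<Longrightarrow> hprod x y \<in> H (m + n)"
  using H_0_mul_cases by (auto simp: hprod_eq)

lemma dg_algebra_halg: "dg_algebra halg"
proof (rule dg_algebraI[where d = "\<lambda>_. 0" and mul = hprod])
  show "graded_vector_space halg"
    unfolding graded_vector_space_def halg_simps
    using vector_space_axioms subspace_H part_independent H_cocycle by blast
next
  fix m n c x x' y
  assume "x \<in> graded_ops.part halg m" "x' \<in> graded_ops.part halg m" "y \<in> graded_ops.part halg n"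
  moreover from this have "sm c x + x' \<in> H m"
    by (auto intro: subspace_add[OF subspace_H] H_scale)
  ultimately show "hprod (smul halg c x + x') y = smul halg c (hprod x y) + hprod x' y"
    by (simp add: hprod_eq mul_add_left mul_scale_left)
next
  fix m n c x y y'
  assume "x \<in> graded_ops.part halg m" "y \<in> graded_ops.part halg n" "y' \<in> graded_ops.part halg n"
  moreover from this have "sm c y + y' \<in> H n"
    by (auto intro: subspace_add[OF subspace_H] H_scale)
  ultimately show "hprod x (smul halg c y + y') = smul halg c (hprod x y) + hprod x y'"
    by (simp add: hprod_eq mul_add_right mul_scale_right)
next
  fix l m n x y z
  assume "x \<in> graded_ops.part halg l" "y \<in> graded_ops.part halg m" "z \<in> graded_ops.part halg n"
  then have xyz: "x \<in> H l" "y \<in> H m" "z \<in> H n" by auto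
  show "hprod (hprod x y) z = hprod x (hprod y z)"
  proof (cases "l < 0 \<or> m < 0 \<or> n < 0")
    case True
    then show ?thesis using H_neg[OF xyz(1)] H_neg[OF xyz(2)] H_neg[OF xyz(3)] by auto
  next
    case False
    then show ?thesis
      using xyz hprod_H[OF xyz(1,2)] hprod_H[OF xyz(2,3)]
      by (simp add: hprod_eq) (auto simp: hprod_eq mul_assoc)
  qed
qed (auto simp: hprod_H)

lemma hmap_zero: "0 \<in> set xs \<Longrightarrow> hmap xs = 0"
  by (simp add: hmap_def multilinear_zero_mem[OF vector_space_axioms multilinear_twisted_lift])

lemma hmap_singleton: "x \<in> H n \<Longrightarrow> hmap [x] = i x"
  using H_cocycle by (simp add: hmap_def twisted_lift_def lift_singleton)

lemma hmap_scale: "hmap (us @ sm c x # vs) = sm c (hmap (us @ x # vs))"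
proof (cases "c = 0")
  case True
  then show ?thesis by (simp add: hmap_zero)
next
  case False
  then have "sm c x \<in> H 0 \<longleftrightarrow> x \<in> H 0"
    using H_scale[of x 0 c] H_scale[of "sm c x" 0 "inverse c"] by auto
  then show ?thesis
    by (auto simp: hmap_def multilinear_scale[OF multilinear_twisted_lift])
qed

definition units :: "'a list \<Rightarrow> nat" where
  "units xs = length (filter (\<lambda>x. x \<in> H 0) xs)"

lemma units_append: "units (xs @ ys) = units xs + units ys"
  by (simp add: units_def)

lemma units_le_length: "units xs \<le> length xs"
  by (simp add: units_def)

lemma hmap_degenerate: "2 \<le> length xs \<Longrightarrow> 0 < units xs \<Longrightarrow> hmap xs = 0"
  by (auto simp: hmap_def units_def filter_empty_conv)

lemma hmap_part:
  assumes "xs \<noteq> []" "homogeneous halg ds xs"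
  shows "hmap xs \<in> part (sum_list ds + 1 - int (length xs))"
  using twisted_lift_part[OF assms(1) homogeneous_alg[OF assms(2)]] subspace_0[OF subspace_part]
  by (simp add: hmap_def)

lemma graded_multilinear_hmap:
  assumes "n \<ge> 1"
  shows "graded_multilinear halg alg n (1 - int n) hmap"
  unfolding graded_multilinear_def
proof (intro allI impI conjI ballI)
  fix ds xs
  assume xs: "length xs = n" "homogeneous halg ds xs"
  with assms show "hmap xs \<in> graded_ops.part alg (sum_list ds + (1 - int n))"
    using hmap_part[of xs ds] by (cases "xs = []") (auto simp: algebra_simps)
  fix k c y
  assume k: "k < n" and y: "y \<in> graded_ops.part halg (ds ! k)"
  let ?u = "xs[k := sm c (xs ! k) + y]"
  have xk: "xs ! k \<in> H (ds ! k)"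
    using xs k by (auto simp: homogeneous_def list_all2_conv_all_nth)
  have uk: "sm c (xs ! k) + y \<in> H (ds ! k)"
    using xk y by (auto intro: subspace_add[OF subspace_H] H_scale)
  have set_upd: "set (xs[k := v]) = insert v {xs ! l |l. l < n \<and> l \<noteq> k}" for v
    using k xs(1) by (auto simp: set_conv_nth nth_list_update)
  have set_xs: "set xs = insert (xs ! k) {xs ! l |l. l < n \<and> l \<noteq> k}"
    using set_upd[of "xs ! k"] by simp
  have lin: "twisted_lift ?u = sm c (twisted_lift xs) + twisted_lift (xs[k := y])"
    using multilinearD[OF multilinear_twisted_lift] k xs(1) by simp
  have "hmap ?u = sm c (hmap xs) + hmap (xs[k := y])"
  proof (cases "2 \<le> n \<and> (\<exists>l<n. l \<noteq> k \<and> xs ! l \<in> H 0)")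
    case True
    then show ?thesis using xs(1) set_upd set_xs by (auto simp: hmap_def)
  next
    case other: False
    show ?thesis
    proof (cases "2 \<le> n \<and> ds ! k = 0")
      case True
      then show ?thesis using xs(1) set_upd set_xs xk uk y by (auto simp: hmap_def)
    next
      case False
      have "hmap (xs[k := v]) = twisted_lift (xs[k := v])" if "v \<in> H (ds ! k)" for v
      proof (cases "2 \<le> n \<and> v \<in> H 0")
        case True
        with False that have "v = 0" using H_disjoint by blast
        then have "0 \<in> set (xs[k := v])" using set_upd by blast
        then show ?thesis
          by (simp add: hmap_zero multilinear_zero_mem[OF vector_space_axioms multilinear_twisted_lift])
      next
        case False
        with other show ?thesis using xs(1) set_upd[of v] by (auto simp: hmap_def)
      qed
      from this[OF uk] this[of y] this[OF xk] y lin show ?thesis by simp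
    qed
  qed
  then show "hmap (xs[k := smul halg c (xs ! k) + y]) = smul alg c (hmap xs) + hmap (xs[k := y])"
    by simp
qed

text \<open>The two sides of the morphism equation for \<^const>\<open>hmap\<close> are \<open>merge_sum xs\<close> and
  \<open>d (hmap xs) + split_sum ds xs\<close>.\<close>

definition merge_sum :: "'a list \<Rightarrow> 'a" where
  "merge_sum xs = (\<Sum>r<length xs - 1. sm ((- 1) powi int r)
     (hmap (take r xs @ hprod (xs ! r) (xs ! Suc r) # drop (Suc (Suc r)) xs)))"

definition split_sum :: "int list \<Rightarrow> 'a list \<Rightarrow> 'a" where
  "split_sum ds xs = (\<Sum>p\<in>{1..<length xs}.
     sm ((- 1) powi (int p - 1 + (1 - int (length xs - p)) * sum_list (take p ds)))
       (hmap (take p xs) \<odot> hmap (drop p xs)))"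

lemma morphism_with_zero:
  assumes "0 \<in> set xs"
  shows "merge_sum xs = 0" "split_sum ds xs = 0"
proof -
  have split: "0 \<in> set (take p xs) \<or> 0 \<in> set (drop p xs)" for p
    using assms by (metis append_take_drop_id Un_iff set_append)
  have "hmap (take p xs) \<odot> hmap (drop p xs) = 0" for p
    using split[of p] by (auto simp: hmap_zero)
  then show "split_sum ds xs = 0"
    unfolding split_sum_def by (intro sum.neutral) auto
  have "0 \<in> set (take r xs @ hprod (xs ! r) (xs ! Suc r) # drop (Suc (Suc r)) xs)"
    if "r < length xs - 1" for r
  proof -
    have "xs = take r xs @ xs ! r # xs ! Suc r # drop (Suc (Suc r)) xs"
      using that by (simp add: Cons_nth_drop_Suc)
    with assms have "0 \<in> set (take r xs @ xs ! r # xs ! Suc r # drop (Suc (Suc r)) xs)" by metis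
    then show ?thesis by auto
  qed
  then show "merge_sum xs = 0"
    unfolding merge_sum_def by (intro sum.neutral) (auto simp: hmap_zero)
qed

text \<open>In positive degrees all products of cohomology classes are zero, and the equation is the
  Maurer-Cartan equation.\<close>

lemma morphism_positive:
  assumes "xs \<noteq> []" and hom: "homogeneous halg ds xs" and pos: "\<forall>n\<in>set ds. n > 0" and "0 \<notin> set xs"
  shows "merge_sum xs = d (hmap xs) + split_sum ds xs"
proof -
  have mem: "xs ! l \<in> H (ds ! l)" "ds ! l > 0" if "l < length xs" for l
    using that hom pos homogeneous_length[OF hom] by (auto simp: homogeneous_def list_all2_conv_all_nth)
  then have notH: "x \<notin> H 0" if "x \<in> set xs" for x
    using that H_disjoint mem \<open>0 \<notin> set xs\<close> by (metis in_set_conv_nth less_irrefl)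
  have hmap_xs: "hmap ys = twisted_lift ys" if "set ys \<subseteq> set xs" for ys
    using notH that by (auto simp: hmap_def)
  have "hprod (xs ! r) (xs ! Suc r) = 0" if "r < length xs - 1" for r
    using notH[of "xs ! r"] notH[of "xs ! Suc r"] that by (simp add: hprod_def)
  then have "merge_sum xs = 0"
    unfolding merge_sum_def by (intro sum.neutral) (auto simp: hmap_zero)
  moreover have "set xs \<subseteq> liftable"
    using mem H_liftable by (fastforce simp: in_set_conv_nth)
  ultimately show ?thesis
    using d_twisted_lift[OF assms(1) homogeneous_alg[OF hom]]
    by (simp add: split_sum_def hmap_xs set_take_subset set_drop_subset)
qed

lemma i_zero: "i 0 = 0"
  by (simp add: i_def h\<^sub>0.zero d.zero)

lemma i_unital:
  assumes "x \<in> H m" "y \<in> H n" "x \<in> H 0 \<or> y \<in> H 0"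
  shows "i (x \<odot> y) = i x \<odot> i y"
proof -
  have unit: "i (x \<odot> y) = i x \<odot> i y \<and> i (y \<odot> x) = i y \<odot> i x"
    if x: "x \<in> H 0" and y: "y \<in> H n" for x y n
  proof -
    have x': "x \<in> part 0" "y \<in> part n" "i x = x" using x y H_cocycle i_part_0 by auto
    consider "y = 0" | "n = 0" | "n > 0" "y \<noteq> 0" using H_neg[OF y] by linarith
    then show ?thesis
    proof cases
      case 1
      then show ?thesis by (simp add: i_zero)
    next
      case 2
      then show ?thesis using x' mul_part[of x 0 y 0] mul_part[of y 0 x 0] by (simp add: i_part_0)
    next
      case 3
      then obtain c where "x = sm c one" using H_0_scalar x y by blast
      moreover have "i (sm c y) = sm c (i y)"
        using linear_i[of c y 0] by (simp add: i_zero)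
      ultimately show ?thesis
        using x' i_part[OF x'(2)]
        by (simp add: mul_scale_left mul_scale_right one_mul[of _ n] mul_one[of _ n])
    qed
  qed
  then show ?thesis using assms by blast
qed

text \<open>Merging two neighbours leaves at least one argument of degree \<open>0\<close>; of two blocks with at least
  three elements in total, one has two or more elements and contains an argument of degree \<open>0\<close>.
  So every term vanishes.\<close>

lemma morphism_two_units:
  assumes "3 \<le> length xs" "2 \<le> units xs"
  shows "merge_sum xs = d (hmap xs) + split_sum ds xs"
proof -
  have "hmap xs = 0"
    using assms by (intro hmap_degenerate) auto
  moreover have "hmap (take p xs) \<odot> hmap (drop p xs) = 0" if p: "1 \<le> p" "p < length xs" for p
  proof -
    have "units xs = units (take p xs) + units (drop p xs)"
      by (simp flip: units_append)
    moreover have "units (take p xs) \<le> p" "units (drop p xs) \<le> length xs - p"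
      using units_le_length[of "take p xs"] units_le_length[of "drop p xs"] p by simp_all
    ultimately have "2 \<le> p \<and> 0 < units (take p xs) \<or> 2 \<le> length xs - p \<and> 0 < units (drop p xs)"
      using assms p by linarith
    then show ?thesis
      using hmap_degenerate[of "take p xs"] hmap_degenerate[of "drop p xs"] p by auto
  qed
  then have "split_sum ds xs = 0"
    unfolding split_sum_def by (intro sum.neutral) auto
  moreover have "hmap (take r xs @ hprod (xs ! r) (xs ! Suc r) # drop (Suc (Suc r)) xs) = 0"
    if r: "r < length xs - 1" for r
  proof (rule hmap_degenerate)
    have "xs = take r xs @ [xs ! r, xs ! Suc r] @ drop (Suc (Suc r)) xs"
      using r by (simp add: Cons_nth_drop_Suc)
    then have "units xs = units (take r xs) + units [xs ! r, xs ! Suc r] + units (drop (Suc (Suc r)) xs)"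
      by (metis units_append add.assoc)
    then show "0 < units (take r xs @ hprod (xs ! r) (xs ! Suc r) # drop (Suc (Suc r)) xs)"
      using assms(2) H_0_mul
      by (cases "xs ! r \<in> H 0"; cases "xs ! Suc r \<in> H 0") (auto simp: units_def hprod_def)
  qed (use r assms in auto)
  then have "merge_sum xs = 0"
    unfolding merge_sum_def by (intro sum.neutral) auto
  ultimately show ?thesis by (simp add: d.zero)
qed

text \<open>A scalar \<open>b\<close> in the interior can be merged with its left or with its right neighbour, and the two
  terms cancel. At either end only one merger is possible, and it is matched by the splitting that
  isolates \<open>b\<close>.\<close>

lemma morphism_one_unit:
  assumes hom: "homogeneous halg ds xs" and nz: "0 \<notin> set xs" and len: "3 \<le> length xs"
    and xs: "xs = us @ b # vs" and b: "b \<in> H 0" and units: "units us = 0" "units vs = 0"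
  shows "merge_sum xs = d (hmap xs) + split_sum ds xs"
proof -
  let ?n = "length xs"
  have notH: "x \<notin> H 0" if "x \<in> set us \<union> set vs" for x
    using that units by (auto simp: units_def filter_empty_conv)
  have mem: "\<exists>m. x \<in> H m" if x: "x \<in> set xs" for x
    using x hom by (auto simp: homogeneous_def list_all2_conv_all_nth in_set_conv_nth)
  have "us \<noteq> [] \<or> vs \<noteq> []" using len xs by auto
  then obtain x where x: "x \<in> set us \<union> set vs" by (metis UnI1 UnI2 last_in_set)
  then obtain m where "x \<in> H m" "m \<noteq> 0" "x \<noteq> 0" using mem[of x] notH[of x] nz xs by auto
  then obtain c where c: "b = sm c one"
    using H_0_scalar[of x m b] b H_neg[of x m] by (metis linorder_neqE)
  have scalar: "b \<odot> y = sm c y" "y \<odot> b = sm c y" if "y \<in> part k" for y k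
    using that by (simp_all add: c mul_scale_left mul_scale_right one_mul[of _ k] mul_one[of _ k])
  \<comment> \<open>the common value, up to sign, of the at most two mergers that involve \<open>b\<close>\<close>
  define w where "w = sm c (hmap (us @ vs))"
  have merge_term: "sm ((- 1) powi int r) (hmap (take r xs @ hprod (xs ! r) (xs ! Suc r) # drop (Suc (Suc r)) xs))
      = (if Suc r = length us then sm ((- 1) powi int r) w else 0)
        + (if r = length us then sm ((- 1) powi int r) w else 0)"
    if r: "r < ?n - 1" for r
  proof -
    consider "Suc r = length us" | "r = length us" | "Suc r \<noteq> length us" "r \<noteq> length us" by blast
    then show ?thesis
    proof cases
      case 1
      then obtain us' u where us: "us = us' @ [u]" "r = length us'" by (cases us rule: rev_cases) auto
      then obtain k where "u \<in> part k" using mem[of u] xs H_cocycle by auto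
      then have "hprod u b = sm c u" using b by (simp add: hprod_def scalar)
      then show ?thesis using us by (simp add: xs nth_append hmap_scale w_def)
    next
      case 2
      with r xs obtain v vs' where vs: "vs = v # vs'" by (cases vs) auto
      then obtain k where "v \<in> part k" using mem[of v] xs H_cocycle by auto
      then have "hprod b v = sm c v" using b by (simp add: hprod_def scalar)
      then show ?thesis using vs 2 by (simp add: xs nth_append hmap_scale w_def)
    next
      case 3
      have "xs ! l \<in> set us \<union> set vs" if "l < ?n" "l \<noteq> length us" for l
        using that xs by (auto simp: nth_append nth_Cons split: nat.split)
      then have "hprod (xs ! r) (xs ! Suc r) = 0"
        using notH 3 r unfolding hprod_def by (metis Suc_lessD less_diff_conv Suc_eq_plus1)
      then show ?thesis using 3 by (simp add: hmap_zero)
    qed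
  qed
  have merge: "merge_sum xs
      = (\<Sum>r<?n - 1. if Suc r = length us then sm ((- 1) powi int r) w else 0)
        + (\<Sum>r<?n - 1. if r = length us then sm ((- 1) powi int r) w else 0)"
    unfolding merge_sum_def sum.distrib[symmetric]
    by (intro sum.cong refl merge_term) (simp only: lessThan_iff)
  have units_xs: "units xs = 1"
    using b units by (simp add: xs units_def)
  have hmap_xs: "hmap xs = 0"
    using len units_xs by (intro hmap_degenerate) auto
  have split: "hmap (take p xs) \<odot> hmap (drop p xs) = 0"
    if p: "1 \<le> p" "p < ?n" and "\<not> (p = 1 \<and> us = [])" "\<not> (p = ?n - 1 \<and> vs = [])" for p
  proof (cases "p \<le> length us")
    case True
    then have "0 < units (drop p xs)" using b by (simp add: xs units_def)
    moreover have "2 \<le> length (drop p xs)" using True p that(4) xs by (cases vs) auto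
    ultimately show ?thesis by (simp add: hmap_degenerate)
  next
    case False
    then have "0 < units (take p xs)" using b by (simp add: xs units_def take_Cons')
    moreover have "2 \<le> length (take p xs)" using False p that(3) xs by (cases us) auto
    ultimately show ?thesis by (simp add: hmap_degenerate)
  qed
  have part: "\<exists>k. hmap ys \<in> part k" if "ys \<noteq> []" "homogeneous halg es ys" for ys es
    using hmap_part[OF that] by blast
  have i_b: "hmap [b] = b" using b H_cocycle[of b 0] by (simp add: hmap_singleton i_part_0)
  consider "us = []" "vs \<noteq> []" | "vs = []" "us \<noteq> []" | "us \<noteq> []" "vs \<noteq> []"
    using \<open>us \<noteq> [] \<or> vs \<noteq> []\<close> by blast
  then have "merge_sum xs = split_sum ds xs"
  proof cases
    case 1
    obtain e es where ds: "ds = e # es" "b \<in> H e" "homogeneous halg es vs"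
      using hom 1 by (auto simp: xs homogeneous_Cons_right)
    have "e = 0" using H_disjoint[of b e 0] ds(2) b nz xs by auto
    obtain k where "hmap vs \<in> part k" using part[OF 1(2) ds(3)] by blast
    then have w: "w = b \<odot> hmap vs" using 1 by (simp add: w_def scalar)
    have "split_sum ds xs = (\<Sum>p\<in>{1}. sm ((- 1) powi (int p - 1 + (1 - int (?n - p)) * sum_list (take p ds)))
       (hmap (take p xs) \<odot> hmap (drop p xs)))"
      unfolding split_sum_def using len 1 by (intro sum.mono_neutral_right) (auto simp: split)
    also have "\<dots> = w" using 1 \<open>e = 0\<close> by (simp add: xs ds i_b w)
    also have "w = merge_sum xs" unfolding merge using 1 len by (simp add: xs)
    finally show ?thesis by simp
  next
    case 2
    have n: "?n = Suc (length us)" using 2 xs by simp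
    have us: "take (length us) xs = us" "drop (length us) xs = [b]" using 2 xs by auto
    have "homogeneous halg (take (length us) ds) us"
      using homogeneous_take_drop[OF hom, of "length us"] us by simp
    then obtain k where "hmap us \<in> part k" using part[OF 2(2)] by blast
    then have w: "w = hmap us \<odot> b" using 2 by (simp add: w_def scalar)
    have "split_sum ds xs = (\<Sum>p\<in>{length us}. sm ((- 1) powi (int p - 1 + (1 - int (?n - p)) * sum_list (take p ds)))
       (hmap (take p xs) \<odot> hmap (drop p xs)))"
      unfolding split_sum_def using len 2 n by (intro sum.mono_neutral_right) (auto simp: split)
    also have "\<dots> = sm ((- 1) powi (int (length us) - 1)) w" by (simp add: us n i_b w)
    also have "\<dots> = merge_sum xs"
    proof -
      have "Suc r = length us \<longleftrightarrow> r = length us - 1" for r using 2(2) by (cases us) auto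
      then show ?thesis unfolding merge using 2 by (simp add: n of_nat_diff Suc_leI)
    qed
    finally show ?thesis by simp
  next
    case 3
    have "split_sum ds xs = 0"
      unfolding split_sum_def using 3 by (intro sum.neutral) (auto simp: split)
    moreover have "merge_sum xs = 0"
    proof -
      obtain us' u where us: "us = us' @ [u]" using 3 by (cases us rule: rev_cases) auto
      then have "Suc r = length us \<longleftrightarrow> r = length us'" for r by simp
      moreover have "length us' < ?n - 1" "length us < ?n - 1"
        using us 3 by (auto simp: xs neq_Nil_conv)
      ultimately show ?thesis unfolding merge by (simp add: us minus_one_powi)
    qed
    ultimately show ?thesis by simp
  qed
  then show ?thesis by (simp add: hmap_xs d.zero)
qed

lemma morphism_identity:
  assumes "xs \<noteq> []" "homogeneous halg ds xs"
  shows "merge_sum xs = d (hmap xs) + split_sum ds xs"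
proof (cases "0 \<in> set xs")
  case True
  then show ?thesis using morphism_with_zero[OF True] hmap_zero[OF True] by (simp add: d.zero)
next
  case nz: False
  have mem: "xs ! l \<in> H (ds ! l)" if "l < length xs" for l
    using that assms(2) by (auto simp: homogeneous_def list_all2_conv_all_nth)
  have nonneg: "0 \<le> n" if n: "n \<in> set ds" for n
  proof -
    obtain l where l: "l < length xs" "ds ! l = n"
      using n homogeneous_length[OF assms(2)] by (metis in_set_conv_nth)
    then have "xs ! l \<noteq> 0" using nz by (metis nth_mem)
    moreover have "xs ! l \<in> H n" using mem[OF l(1)] l(2) by simp
    ultimately show ?thesis using H_neg[of "xs ! l" n] not_le by blast
  qed
  consider "length xs = 1" | "length xs = 2" | "3 \<le> length xs"
    using assms(1) by (cases xs; cases "tl xs"; cases "tl (tl xs)") auto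
  then show ?thesis
  proof cases
    case 1
    then obtain x n where "xs = [x]" "x \<in> H n"
      using assms(2) by (auto simp: length_Suc_conv homogeneous_Cons_right)
    then show ?thesis
      using d_i[of x] H_cocycle[of x n] by (simp add: merge_sum_def split_sum_def hmap_singleton)
  next
    case 2
    then obtain x y where "xs = [x, y]" by (auto simp: length_Suc_conv numeral_2_eq_2)
    then obtain m n where xy: "xs = [x, y]" "ds = [m, n]" "x \<in> H m" "y \<in> H n"
      using assms(2) by (auto simp: homogeneous_Cons_right)
    show ?thesis
    proof (cases "x \<in> H 0 \<or> y \<in> H 0")
      case True
      then have "hmap xs = 0" using xy(1) by (simp add: hmap_def)
      moreover have "hmap [x \<odot> y] = i (x \<odot> y)"
        using hprod_H[OF xy(3,4)] True by (simp add: hprod_def hmap_singleton)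
      ultimately show ?thesis
        using True i_unital[OF xy(3,4) True] xy
        by (simp add: merge_sum_def split_sum_def hmap_singleton hprod_def d.zero numeral_2_eq_2)
    next
      case False
      then have "m \<noteq> 0" "n \<noteq> 0" using xy by auto
      then show ?thesis
        using morphism_positive[OF assms _ nz] nonneg xy(2) by force
    qed
  next
    case 3
    consider "units xs = 0" | "units xs = 1" | "2 \<le> units xs" by linarith
    then show ?thesis
    proof cases
      case 1
      have "\<forall>n\<in>set ds. n > 0"
      proof
        fix n assume n: "n \<in> set ds"
        then obtain l where "l < length xs" "ds ! l = n"
          using homogeneous_length[OF assms(2)] by (metis in_set_conv_nth)
        moreover from this 1 have "xs ! l \<notin> H 0"
          by (auto simp: units_def filter_empty_conv)
        ultimately have "n \<noteq> 0" using mem[of l] by auto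
        then show "n > 0" using nonneg[OF n] by simp
      qed
      then show ?thesis using morphism_positive[OF assms _ nz] by blast
    next
      case 2
      then obtain b where "b \<in> set xs" "b \<in> H 0"
        by (metis filter_empty_conv list.size(3) units_def zero_neq_one)
      then obtain us vs where "xs = us @ b # vs" by (meson split_list)
      then show ?thesis
        using morphism_one_unit[OF assms(2) nz 3, of us b vs] 2 \<open>b \<in> H 0\<close>
        by (simp add: units_def)
    next
      case units: 3
      show ?thesis by (rule morphism_two_units[OF 3 units])
    qed
  qed
qed

lemma A_inf_morphism_hmap: "A_inf_morphism halg alg hmap"
  unfolding A_inf_morphism_def
proof (intro conjI allI impI)
  fix n :: nat assume "n \<ge> 1"
  then show "graded_multilinear halg alg n (1 - int n) hmap" by (rule graded_multilinear_hmap)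
next
  fix ds xs
  assume xs: "xs \<noteq> []" "homogeneous halg ds xs"
  have "insertion_sum halg sm hmap ds xs = merge_sum xs"
    using insertion_sum_dg[where A = halg and sm = sm and g = hmap and ds = ds and xs = xs
        and d = "\<lambda>_. 0" and mul = hprod]
    by (simp add: hmap_zero merge_sum_def)
  moreover note block_sum_dg[where B = alg and f = hmap and ds = ds and xs = xs
      and d = d and mul = "(\<odot>)", unfolded alg_simps, OF refl scale_zero_right scale_one xs(1)]
  ultimately show "insertion_sum halg (smul alg) hmap ds xs =
        (\<Sum>k = 1..length xs.
           \<Sum>is | length is = k \<and> sum_list is = length xs \<and> (\<forall>i\<in>set is. 1 \<le> i).
             smul alg ((- 1) powi (block_sign is + block_koszul is ds)) (ops alg (map_blocks hmap is xs)))"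
    using morphism_identity[OF xs] by (simp add: split_sum_def)
qed

lemma coboundaries_alg: "coboundaries alg n = d ` part (n - 1)"
  by (simp add: coboundaries_def)

lemma coboundary_class_eq:
  "cohomology_class alg n x = cohomology_class alg n y \<longleftrightarrow> x - y \<in> d ` part (n - 1)"
proof -
  have sub: "subspace (d ` part (n - 1))"
    by (rule d.subspace_image[OF subspace_part])
  show ?thesis
  proof
    assume "cohomology_class alg n x = cohomology_class alg n y"
    moreover have "x \<in> cohomology_class alg n x"
      using subspace_0[OF sub] by (force simp: cohomology_class_def coboundaries_alg)
    ultimately obtain b where "b \<in> d ` part (n - 1)" "x = y + b"
      by (auto simp: cohomology_class_def coboundaries_alg)
    then show "x - y \<in> d ` part (n - 1)" by simp
  next
    assume xy: "x - y \<in> d ` part (n - 1)"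
    have "x + b \<in> (+) y ` d ` part (n - 1)" "y + b \<in> (+) x ` d ` part (n - 1)"
      if b: "b \<in> d ` part (n - 1)" for b
      using image_eqI[OF _ subspace_add[OF sub xy b], of "x + b" "(+) y"]
        image_eqI[OF _ subspace_diff[OF sub b xy], of "y + b" "(+) x"]
      by simp_all
    then show "cohomology_class alg n x = cohomology_class alg n y"
      unfolding cohomology_class_def coboundaries_alg by (intro equalityI image_subsetI) simp_all
  qed
qed

lemma A_inf_quasi_isomorphism_hmap: "A_inf_quasi_isomorphism halg alg hmap"
  unfolding A_inf_quasi_isomorphism_def
proof (intro conjI allI)
  show "A_inf_morphism halg alg hmap" by (rule A_inf_morphism_hmap)
  fix n
  have "coboundaries halg n = {0}"
    by (auto simp: coboundaries_def intro!: image_eqI[of _ _ 0])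
  then have cohomology_halg: "cohomology halg n = (\<lambda>x. {x}) ` H n"
    by (simp add: cohomology_def cohomology_class_def cocycles_def)
  have map: "cohomology_map alg hmap n {x} = cohomology_class alg n x" if "x \<in> H n" for x
  proof -
    have "i x - x \<in> d ` part (n - 1)"
      using that H_cocycle h\<^sub>0_part[of x n] subspace_neg[OF subspace_part]
      by (auto simp: i_def intro!: image_eqI[of _ d "- h\<^sub>0 x"] simp: d.neg)
    then show ?thesis
      using that by (simp add: cohomology_map_def hmap_singleton coboundary_class_eq)
  qed
  show "bij_betw (cohomology_map alg hmap n) (cohomology halg n) (cohomology alg n)"
    unfolding bij_betw_def
  proof
    have "x = y" if "x \<in> H n" "y \<in> H n" "x - y \<in> d ` part (n - 1)" for x y
      using H_coboundary[of "x - y" n] subspace_diff[OF subspace_H] that by simp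
    then show "inj_on (cohomology_map alg hmap n) (cohomology halg n)"
      by (auto simp: inj_on_def cohomology_halg map coboundary_class_eq)
    show "cohomology_map alg hmap n ` cohomology halg n = cohomology alg n"
    proof (intro equalityI subsetI)
      fix c assume "c \<in> cohomology_map alg hmap n ` cohomology halg n"
      then show "c \<in> cohomology alg n"
        using H_cocycle by (auto simp: cohomology_halg map cohomology_def[of alg] cocycles_def)
    next
      fix c assume "c \<in> cohomology alg n"
      then obtain x where x: "x \<in> part n" "d x = 0" "c = cohomology_class alg n x"
        by (auto simp: cohomology_def cocycles_def)
      then obtain w where w: "w \<in> H n" "x - w \<in> d ` part (n - 1)" using H_represents by blast
      then have "c = cohomology_map alg hmap n {w}" using x by (simp add: map coboundary_class_eq)
      then show "c \<in> cohomology_map alg hmap n ` cohomology halg n"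
        using w by (auto simp: cohomology_halg)
    qed
  qed
qed

end

text \<open>Complements of the coboundaries exist over any field, and each choice gives a
  quasi-isomorphism.\<close>

theorem (in graded_null_product_ring) formal: "formal_dg_algebra alg"
proof -
  define complement where "complement n W \<longleftrightarrow> subspace W \<and> W \<subseteq> {x \<in> part n. d x = 0} \<and>
      W \<inter> d ` part (n - 1) = {0} \<and> (\<forall>x\<in>{x \<in> part n. d x = 0}. \<exists>w\<in>W. x - w \<in> d ` part (n - 1))" for n W
  have "\<exists>W. complement n W" for n
  proof -
    have cocycles: "subspace {x \<in> part n. d x = 0}"
      using subspace_part[of n] by (auto simp: subspace_def d.add d.scale d.zero)
    have coboundaries: "d ` part (n - 1) \<subseteq> {x \<in> part n. d x = 0}"
      using d_part[of _ "n - 1"] by (auto simp: d_d)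
    show ?thesis
      by (rule subspace_complement_exists[OF d.subspace_image[OF subspace_part[of "n - 1"]] cocycles coboundaries])
         (unfold complement_def, blast)
  qed
  then have "complement n (SOME W. complement n W)" for n by (rule someI_ex)
  then obtain H where H: "\<And>n. complement n (H n)" by (rule that)
  interpret cohomology_complement sm mul d \<tau> I\<^sub>0 I\<^sub>1 J h\<^sub>0 h\<^sub>1 s part one H
  proof
    fix n x
    note H = H[of n, unfolded complement_def]
    show "subspace (H n)" using H by blast
    show "x \<in> H n \<Longrightarrow> x \<in> part n \<and> d x = 0" using H by blast
    show "x \<in> H n \<Longrightarrow> x \<in> d ` part (n - 1) \<Longrightarrow> x = 0" using H by blast
    show "x \<in> part n \<Longrightarrow> d x = 0 \<Longrightarrow> \<exists>w\<in>H n. x - w \<in> d ` part (n - 1)" using H by blast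
  qed
  have "zero_differential halg" by (simp add: zero_differential_def)
  then show ?thesis
    unfolding formal_dg_algebra_def
    using dg_algebra_alg dg_algebra_halg A_inf_quasi_isomorphism_hmap by blast
qed


section \<open>Singular cochains as a differential graded ring\<close>

subsection \<open>Front and back faces\<close>

text \<open>The affine map onto the face of a simplex spanned by its last vertices, as in
  \<^const>\<open>back_face\<close>.\<close>

definition shift :: "nat \<Rightarrow> (nat \<Rightarrow> real) \<Rightarrow> nat \<Rightarrow> real" where
  "shift p v = (\<lambda>i. if i < p then 0 else v (i - p))"

lemma shift_in_standard_simplex:
  assumes "v \<in> standard_simplex q"
  shows "shift p v \<in> standard_simplex (p + q)"
proof -
  have "(\<Sum>i\<le>p + q. shift p v i) = (\<Sum>i\<in>{p..p + q}. shift p v i)"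
    by (rule sum.mono_neutral_right) (auto simp: shift_def)
  also have "\<dots> = (\<Sum>i\<le>q. v i)"
    by (rule sum.reindex_bij_witness[of _ "\<lambda>i. i + p" "\<lambda>i. i - p"]) (auto simp: shift_def)
  finally show ?thesis
    using assms by (auto simp: standard_simplex_def shift_def)
qed

lemma back_face_eq: "back_face p q \<sigma> = restrict (\<sigma> \<circ> shift p) (standard_simplex q)"
  by (simp add: back_face_def shift_def comp_def)

lemma shift_0 [simp]: "shift 0 v = v"
  by (simp add: shift_def)

lemma shift_shift: "shift p (shift q v) = shift (p + q) v"
  by (auto simp: shift_def fun_eq_iff)

lemma standard_simplex_le: "v \<in> standard_simplex p \<Longrightarrow> p \<le> q \<Longrightarrow> v \<in> standard_simplex q"
  using standard_simplex_mono by blast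

lemma simplical_face_last: "v \<in> standard_simplex p \<Longrightarrow> p < k \<Longrightarrow> simplical_face k v = v"
  by (auto simp: simplical_face_def standard_simplex_def fun_eq_iff)

lemma simplical_face_shift_le: "k \<le> p \<Longrightarrow> simplical_face k (shift p v) = shift (Suc p) v"
  by (auto simp: simplical_face_def shift_def fun_eq_iff)

lemma simplical_face_shift_ge: "p \<le> k \<Longrightarrow> simplical_face k (shift p v) = shift p (simplical_face (k - p) v)"
  by (auto simp: simplical_face_def shift_def fun_eq_iff)

lemma front_face_singular_face_le:
  assumes "k \<le> p" "p \<le> n"
  shows "front_face p (singular_face (Suc n) k \<sigma>) = singular_face (Suc p) k (front_face (Suc p) \<sigma>)"
  using assms simplical_face_in_standard_simplex[of "Suc p" k]
  by (auto simp: front_face_def singular_face_def restrict_def fun_eq_iff standard_simplex_le)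

lemma front_face_singular_face_gt:
  assumes "p < k" "p \<le> n"
  shows "front_face p (singular_face (Suc n) k \<sigma>) = front_face p \<sigma>"
  using assms
  by (auto simp: front_face_def singular_face_def restrict_def fun_eq_iff standard_simplex_le
      simplical_face_last)

lemma singular_face_last_front_face:
  "singular_face (Suc p) (Suc p) (front_face (Suc p) \<sigma>) = front_face p \<sigma>"
  by (auto simp: front_face_def singular_face_def restrict_def fun_eq_iff standard_simplex_le
      simplical_face_last)

lemma back_face_singular_face_le:
  assumes "k \<le> p"
  shows "back_face p q (singular_face (Suc (p + q)) k \<sigma>) = back_face (Suc p) q \<sigma>"
  using assms
  by (auto simp: back_face_eq singular_face_def restrict_def fun_eq_iff shift_in_standard_simplex
      simplical_face_shift_le)

lemma back_face_singular_face_gt: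
  assumes "p < k" "k \<le> Suc (p + q)"
  shows "back_face p q (singular_face (Suc (p + q)) k \<sigma>)
       = singular_face (Suc q) (k - p) (back_face p (Suc q) \<sigma>)"
  using assms simplical_face_in_standard_simplex[of "Suc q" "k - p"]
  by (auto simp: back_face_eq singular_face_def restrict_def fun_eq_iff shift_in_standard_simplex
      simplical_face_shift_ge)

lemma singular_face_first_back_face:
  "singular_face (Suc q) 0 (back_face p (Suc q) \<sigma>) = back_face (Suc p) q \<sigma>"
proof -
  have "shift p (simplical_face 0 v) = shift (Suc p) v" for v :: "nat \<Rightarrow> real"
    using simplical_face_shift_ge[of p p v] simplical_face_shift_le[of p p v] by simp
  then show ?thesis
    using simplical_face_in_standard_simplex[of "Suc q" 0]
    by (intro ext) (auto simp: back_face_eq singular_face_def restrict_def)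
qed

lemma front_face_front_face: "r \<le> p \<Longrightarrow> front_face r (front_face p \<sigma>) = front_face r \<sigma>"
  by (auto simp: front_face_def restrict_def fun_eq_iff standard_simplex_le)

lemma back_face_back_face:
  "back_face q t (back_face r (q + t) \<sigma>) = back_face (r + q) t \<sigma>"
  by (auto simp: back_face_eq restrict_def fun_eq_iff shift_shift shift_in_standard_simplex)

lemma back_face_front_face:
  "back_face r q (front_face (r + q) \<sigma>) = front_face q (back_face r (q + t) \<sigma>)"
  by (auto simp: back_face_eq front_face_def restrict_def fun_eq_iff shift_in_standard_simplex
      standard_simplex_le)

lemma front_face_self: "singular_simplex n X \<sigma> \<Longrightarrow> front_face n \<sigma> = \<sigma>"
  by (simp add: front_face_def singular_simplex_def extensional_restrict)

lemma back_face_self: "singular_simplex n X \<sigma> \<Longrightarrow> back_face 0 n \<sigma> = \<sigma>"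
  by (simp add: back_face_eq singular_simplex_def extensional_restrict comp_def)

lemma singular_simplex_front_face:
  assumes "singular_simplex n X \<sigma>" "p \<le> n"
  shows "singular_simplex p X (front_face p \<sigma>)"
proof -
  have "continuous_map (subtopology (powertop_real UNIV) (standard_simplex p)) X \<sigma>"
    using assms standard_simplex_mono unfolding singular_simplex_def
    by (meson continuous_map_from_subtopology_mono)
  then show ?thesis
    unfolding singular_simplex_def front_face_def
    by (auto intro: continuous_map_eq)
qed

lemma continuous_shift:
  "continuous_map (subtopology (powertop_real UNIV) (standard_simplex q))
     (subtopology (powertop_real UNIV) (standard_simplex (p + q))) (shift p)"
proof -
  have "continuous_map (powertop_real UNIV) euclideanreal (\<lambda>v. shift p v i)" for i
    by (cases "i < p") (auto simp: shift_def intro: continuous_map_product_projection)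
  then show ?thesis
    by (auto simp: continuous_map_in_subtopology continuous_map_componentwise
        shift_in_standard_simplex continuous_map_from_subtopology)
qed

lemma singular_simplex_back_face:
  assumes "singular_simplex (p + q) X \<sigma>"
  shows "singular_simplex q X (back_face p q \<sigma>)"
proof -
  have "continuous_map (subtopology (powertop_real UNIV) (standard_simplex q)) X (\<sigma> \<circ> shift p)"
    using assms continuous_shift unfolding singular_simplex_def by (meson continuous_map_compose)
  then show ?thesis
    unfolding singular_simplex_def back_face_eq
    by (auto intro: continuous_map_eq)
qed

lemma front_face_image: "p \<le> n \<Longrightarrow> front_face p \<sigma> ` standard_simplex p \<subseteq> \<sigma> ` standard_simplex n"
  using standard_simplex_mono by (fastforce simp: front_face_def)

lemma back_face_image: "back_face p q \<sigma> ` standard_simplex q \<subseteq> \<sigma> ` standard_simplex (p + q)"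
  using shift_in_standard_simplex by (fastforce simp: back_face_eq)


subsection \<open>Evaluating cochains on integral chains\<close>

text \<open>Integral chains carry the boundary and the subdivision operators, so cochains with coefficients
  in \<open>'k\<close> are evaluated on them.\<close>

definition eval_chain :: "('a \<Rightarrow> 'k::field) \<Rightarrow> ('a \<Rightarrow>\<^sub>0 int) \<Rightarrow> 'k" where
  "eval_chain f c = (\<Sum>\<sigma>\<in>Poly_Mapping.keys c. of_int (Poly_Mapping.lookup c \<sigma>) * f \<sigma>)"

lemma eval_chain_superset:
  "finite S \<Longrightarrow> Poly_Mapping.keys c \<subseteq> S \<Longrightarrow>
   eval_chain f c = (\<Sum>\<sigma>\<in>S. of_int (Poly_Mapping.lookup c \<sigma>) * f \<sigma>)"
  unfolding eval_chain_def
  by (rule sum.mono_neutral_left) (auto simp: in_keys_iff)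

lemma eval_chain_0 [simp]: "eval_chain f 0 = 0"
  by (simp add: eval_chain_def)

lemma eval_chain_of [simp]: "eval_chain f (frag_of \<sigma>) = f \<sigma>"
  by (simp add: eval_chain_def)

lemma eval_chain_add: "eval_chain f (a + b) = eval_chain f a + eval_chain f b"
proof -
  let ?S = "Poly_Mapping.keys a \<union> Poly_Mapping.keys b"
  have "eval_chain f (a + b) = (\<Sum>\<sigma>\<in>?S. of_int (Poly_Mapping.lookup (a + b) \<sigma>) * f \<sigma>)"
    by (rule eval_chain_superset) (auto dest: set_mp[OF keys_add])
  also have "\<dots> = (\<Sum>\<sigma>\<in>?S. of_int (Poly_Mapping.lookup a \<sigma>) * f \<sigma>)
                + (\<Sum>\<sigma>\<in>?S. of_int (Poly_Mapping.lookup b \<sigma>) * f \<sigma>)"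
    by (simp add: lookup_add distrib_right sum.distrib)
  also have "\<dots> = eval_chain f a + eval_chain f b"
    by (simp add: eval_chain_superset[of ?S])
  finally show ?thesis .
qed

lemma eval_chain_cmul: "eval_chain f (frag_cmul m c) = of_int m * eval_chain f c"
proof -
  have "eval_chain f (frag_cmul m c)
      = (\<Sum>\<sigma>\<in>Poly_Mapping.keys c. of_int (Poly_Mapping.lookup (frag_cmul m c) \<sigma>) * f \<sigma>)"
    by (rule eval_chain_superset) (auto simp: keys_cmul)
  then show ?thesis
    by (simp add: eval_chain_def sum_distrib_left mult.assoc)
qed

lemma eval_chain_diff: "eval_chain f (a - b) = eval_chain f a - eval_chain f b"
  using eval_chain_add[of f "a - b" b] by simp

lemma eval_chain_sum: "eval_chain f (\<Sum>i\<in>I. g i) = (\<Sum>i\<in>I. eval_chain f (g i))"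
  by (induction I rule: infinite_finite_induct) (simp_all add: eval_chain_add)

lemma eval_chain_extend:
  "eval_chain f (frag_extend g c) = eval_chain (\<lambda>\<sigma>. eval_chain f (g \<sigma>)) c"
  by (simp add: frag_extend_def eval_chain_sum eval_chain_cmul eval_chain_def[of _ c])

lemma eval_chain_cong:
  "(\<And>\<sigma>. \<sigma> \<in> Poly_Mapping.keys c \<Longrightarrow> f \<sigma> = g \<sigma>) \<Longrightarrow> eval_chain f c = eval_chain g c"
  by (simp add: eval_chain_def)

lemma eval_chain_linear:
  "eval_chain (\<lambda>\<sigma>. a * f \<sigma>) c = a * eval_chain f c"
  "eval_chain (f + g) c = eval_chain f c + eval_chain g c"
  by (simp_all add: eval_chain_def sum_distrib_left sum.distrib algebra_simps)

lemma coboundary_eq: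
  "coboundary X \<phi> n \<sigma> =
     (if singular_simplex n X \<sigma> then eval_chain (\<phi> (n - 1)) (chain_boundary n (frag_of \<sigma>)) else 0)"
  by (auto simp: coboundary_def chain_boundary_of eval_chain_sum eval_chain_cmul)

lemma eval_chain_coboundary:
  assumes "singular_chain n X c"
  shows "eval_chain (coboundary X \<phi> n) c = eval_chain (\<phi> (n - 1)) (chain_boundary n c)"
proof -
  have "eval_chain (coboundary X \<phi> n) c
      = eval_chain (\<lambda>\<sigma>. eval_chain (\<phi> (n - 1)) (chain_boundary n (frag_of \<sigma>))) c"
    using assms by (intro eval_chain_cong) (auto simp: coboundary_eq singular_chain_def)
  also have "\<dots> = eval_chain (\<phi> (n - 1)) (chain_boundary n c)"
  proof (cases "n = 0")
    case False
    then have "chain_boundary n c = frag_extend (\<lambda>\<sigma>. chain_boundary n (frag_of \<sigma>)) c"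
      by (simp add: chain_boundary_def)
    then show ?thesis
      by (simp add: eval_chain_extend)
  qed (simp add: chain_boundary_def eval_chain_def)
  finally show ?thesis .
qed


subsection \<open>The ring structure\<close>

definition cochain_scale :: "'k::field \<Rightarrow> ('x, 'k) cochains \<Rightarrow> ('x, 'k) cochains" where
  "cochain_scale c \<phi> = (\<lambda>n \<sigma>. c * \<phi> n \<sigma>)"

definition cochain_sign :: "('x, 'k::field) cochains \<Rightarrow> ('x, 'k) cochains" where
  "cochain_sign \<phi> = (\<lambda>n \<sigma>. (- 1) ^ n * \<phi> n \<sigma>)"

lemma coboundary_coboundary: "coboundary X (coboundary X \<phi>) = 0"
proof (intro ext)
  fix n and \<sigma> :: "(nat \<Rightarrow> real) \<Rightarrow> 'a"
  show "coboundary X (coboundary X \<phi>) n \<sigma> = 0 n \<sigma>"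
  proof (cases "singular_simplex n X \<sigma>")
    case True
    then have c: "singular_chain n X (frag_of \<sigma>)"
      by (simp add: singular_chain_of)
    then show ?thesis
      using True eval_chain_coboundary[OF singular_chain_boundary[OF c], of \<phi>]
        chain_boundary_boundary[OF c]
      by (simp add: coboundary_eq)
  qed (simp add: coboundary_eq)
qed

lemma coboundary_0: "coboundary X \<phi> 0 \<sigma> = 0"
  by (simp add: coboundary_def)

text \<open>Among the faces of an \<open>(m + 1)\<close>-simplex, those with index at most \<open>p\<close> affect the front \<open>p\<close>-face
  and the others the back face; this gives the sums \<open>A\<close> and \<open>B\<close>. The two products on the right-hand
  side contain in addition the last face of the front and the first face of the back, with
  opposite signs. Both remove the common vertex, and they give the same term \<open>E\<close>.\<close>

lemma coboundary_cup_product: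
  fixes \<phi> \<psi> :: "('x, 'k::field) cochains"
  shows "coboundary X (cup_product X \<phi> \<psi>)
       = cup_product X (coboundary X \<phi>) \<psi> + cup_product X (cochain_sign \<phi>) (coboundary X \<psi>)"
proof (intro ext)
  fix n and \<sigma> :: "(nat \<Rightarrow> real) \<Rightarrow> 'x"
  show "coboundary X (cup_product X \<phi> \<psi>) n \<sigma>
      = (cup_product X (coboundary X \<phi>) \<psi> + cup_product X (cochain_sign \<phi>) (coboundary X \<psi>)) n \<sigma>"
  proof (cases "singular_simplex n X \<sigma> \<and> n \<noteq> 0")
    case False
    then show ?thesis by (auto simp: coboundary_def cup_product_def)
  next
    case True
    then obtain m where n: "n = Suc m" by (cases n) auto
    with True have \<sigma>: "singular_simplex (Suc m) X \<sigma>" by simp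
    have face: "singular_simplex m X (singular_face (Suc m) k \<sigma>)" if "k \<le> Suc m" for k
      using singular_simplex_singular_face[OF \<sigma>, of k] that by simp
    define A where "A p = (\<Sum>k\<le>p. (- 1) ^ k * \<phi> p (singular_face (Suc p) k (front_face (Suc p) \<sigma>))
        * \<psi> (m - p) (back_face (Suc p) (m - p) \<sigma>))" for p
    define B where "B p = (\<Sum>k\<in>{p<..Suc m}. (- 1) ^ k * \<phi> p (front_face p \<sigma>)
        * \<psi> (m - p) (singular_face (Suc (m - p)) (k - p) (back_face p (Suc (m - p)) \<sigma>)))" for p
    define E where "E p = (- 1) ^ p * \<phi> p (front_face p \<sigma>) * \<psi> (m - p) (back_face (Suc p) (m - p) \<sigma>)" for p
    have "coboundary X (cup_product X \<phi> \<psi>) n \<sigma>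
        = (\<Sum>k\<le>Suc m. \<Sum>p\<le>m. (- 1) ^ k * \<phi> p (front_face p (singular_face (Suc m) k \<sigma>))
             * \<psi> (m - p) (back_face p (m - p) (singular_face (Suc m) k \<sigma>)))"
      using \<sigma> by (auto simp: n coboundary_def cup_product_def face sum_distrib_left mult.assoc
          simp del: sum.atMost_Suc intro!: sum.cong)
    also have "\<dots> = (\<Sum>p\<le>m. \<Sum>k\<le>Suc m. (- 1) ^ k * \<phi> p (front_face p (singular_face (Suc m) k \<sigma>))
             * \<psi> (m - p) (back_face p (m - p) (singular_face (Suc m) k \<sigma>)))"
      by (rule sum.swap)
    also have "\<dots> = (\<Sum>p\<le>m. A p + B p)"
    proof (intro sum.cong refl)
      fix p assume "p \<in> {..m}"
      then have p: "p \<le> m" by simp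
      have split: "{..Suc m} = {..p} \<union> {p<..Suc m}" using p by auto
      have m: "Suc m = Suc (p + (m - p))" using p by simp
      show "(\<Sum>k\<le>Suc m. (- 1) ^ k * \<phi> p (front_face p (singular_face (Suc m) k \<sigma>))
             * \<psi> (m - p) (back_face p (m - p) (singular_face (Suc m) k \<sigma>))) = A p + B p"
        unfolding split A_def B_def
      proof (subst sum.union_disjoint, simp, simp, force, intro arg_cong2[where f = "(+)"] sum.cong refl)
        fix k assume "k \<in> {..p}"
        then show "(- 1) ^ k * \<phi> p (front_face p (singular_face (Suc m) k \<sigma>))
             * \<psi> (m - p) (back_face p (m - p) (singular_face (Suc m) k \<sigma>))
           = (- 1) ^ k * \<phi> p (singular_face (Suc p) k (front_face (Suc p) \<sigma>))
             * \<psi> (m - p) (back_face (Suc p) (m - p) \<sigma>)"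
          using front_face_singular_face_le[of k p m \<sigma>] back_face_singular_face_le[of k p "m - p" \<sigma>] p
          by simp
      next
        fix k assume "k \<in> {p<..Suc m}"
        then show "(- 1) ^ k * \<phi> p (front_face p (singular_face (Suc m) k \<sigma>))
             * \<psi> (m - p) (back_face p (m - p) (singular_face (Suc m) k \<sigma>))
           = (- 1) ^ k * \<phi> p (front_face p \<sigma>)
             * \<psi> (m - p) (singular_face (Suc (m - p)) (k - p) (back_face p (Suc (m - p)) \<sigma>))"
          using front_face_singular_face_gt[of p k m \<sigma>] back_face_singular_face_gt[of p k "m - p" \<sigma>] p
          by simp
      qed
    qed
    also have "\<dots> = (\<Sum>p\<le>m. (A p - E p) + (E p + B p))"
      by (intro sum.cong) simp_all
    also have "\<dots> = (\<Sum>p\<le>m. A p - E p) + (\<Sum>p\<le>m. E p + B p)"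
      by (rule sum.distrib)
    also have "(\<Sum>p\<le>m. A p - E p) = cup_product X (coboundary X \<phi>) \<psi> n \<sigma>"
    proof -
      have "cup_product X (coboundary X \<phi>) \<psi> n \<sigma>
          = (\<Sum>p\<le>m. coboundary X \<phi> (Suc p) (front_face (Suc p) \<sigma>) * \<psi> (m - p) (back_face (Suc p) (m - p) \<sigma>))"
        using \<sigma> by (simp add: n cup_product_def sum.atMost_Suc_shift coboundary_0 del: sum.atMost_Suc)
      also have "\<dots> = (\<Sum>p\<le>m. A p - E p)"
      proof (intro sum.cong refl)
        fix p assume "p \<in> {..m}"
        then have "singular_simplex (Suc p) X (front_face (Suc p) \<sigma>)"
          using singular_simplex_front_face[OF \<sigma>] by simp
        then show "coboundary X \<phi> (Suc p) (front_face (Suc p) \<sigma>) * \<psi> (m - p) (back_face (Suc p) (m - p) \<sigma>)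
            = A p - E p"
          by (simp add: coboundary_def A_def E_def singular_face_last_front_face sum_distrib_left algebra_simps)
      qed
      finally show ?thesis by simp
    qed
    also have "(\<Sum>p\<le>m. E p + B p) = cup_product X (cochain_sign \<phi>) (coboundary X \<psi>) n \<sigma>"
    proof -
      have "cup_product X (cochain_sign \<phi>) (coboundary X \<psi>) n \<sigma>
          = (\<Sum>p\<le>m. (- 1) ^ p * \<phi> p (front_face p \<sigma>) * coboundary X \<psi> (Suc m - p) (back_face p (Suc m - p) \<sigma>))"
        using \<sigma> by (simp add: n cup_product_def cochain_sign_def coboundary_0)
      also have "\<dots> = (\<Sum>p\<le>m. E p + B p)"
      proof (intro sum.cong refl)
        fix p assume "p \<in> {..m}"
        then have p: "p \<le> m" by simp
        then have "singular_simplex (Suc (m - p)) X (back_face p (Suc (m - p)) \<sigma>)"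
          using singular_simplex_back_face[of p "Suc (m - p)" X \<sigma>] \<sigma> by simp
        then have "coboundary X \<psi> (Suc m - p) (back_face p (Suc m - p) \<sigma>)
          = \<psi> (m - p) (back_face (Suc p) (m - p) \<sigma>)
            + (\<Sum>k\<le>m - p. (- 1) ^ Suc k * \<psi> (m - p) (singular_face (Suc (m - p)) (Suc k) (back_face p (Suc (m - p)) \<sigma>)))"
          using p by (simp add: coboundary_def Suc_diff_le sum.atMost_Suc_shift singular_face_first_back_face
              del: sum.atMost_Suc)
        moreover have "B p = (\<Sum>k\<le>m - p. (- 1) ^ (p + Suc k) * \<phi> p (front_face p \<sigma>)
            * \<psi> (m - p) (singular_face (Suc (m - p)) (Suc k) (back_face p (Suc (m - p)) \<sigma>)))"
          unfolding B_def
          by (rule sum.reindex_bij_witness[of _ "\<lambda>k. p + Suc k" "\<lambda>k. k - Suc p"])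
             (use p in \<open>auto simp: Suc_diff_le Suc_diff_Suc\<close>)
        ultimately show "(- 1) ^ p * \<phi> p (front_face p \<sigma>) * coboundary X \<psi> (Suc m - p) (back_face p (Suc m - p) \<sigma>)
            = E p + B p"
          by (simp add: E_def sum_distrib_left power_add algebra_simps)
      qed
      finally show ?thesis by simp
    qed
    finally show ?thesis by simp
  qed
qed

lemma cup_product_assoc:
  fixes \<phi> \<psi> \<theta> :: "('x, 'k::field) cochains"
  shows "cup_product X (cup_product X \<phi> \<psi>) \<theta> = cup_product X \<phi> (cup_product X \<psi> \<theta>)"
proof (intro ext)
  fix n and \<sigma> :: "(nat \<Rightarrow> real) \<Rightarrow> 'x"
  show "cup_product X (cup_product X \<phi> \<psi>) \<theta> n \<sigma> = cup_product X \<phi> (cup_product X \<psi> \<theta>) n \<sigma>"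
  proof (cases "singular_simplex n X \<sigma>")
    case True
    define T where "T r p = \<phi> r (front_face r \<sigma>) * \<psi> (p - r) (back_face r (p - r) (front_face p \<sigma>))
        * \<theta> (n - p) (back_face p (n - p) \<sigma>)" for r p
    have "cup_product X (cup_product X \<phi> \<psi>) \<theta> n \<sigma> = (\<Sum>p\<le>n. \<Sum>r\<le>p. T r p)"
      using True
      by (auto simp: cup_product_def singular_simplex_front_face sum_distrib_right T_def
          front_face_front_face intro!: sum.cong)
    also have "\<dots> = (\<Sum>r\<le>n. \<Sum>p\<in>{r..n}. T r p)"
      by (subst (1 2) sum.Sigma; simp?)
         (rule sum.reindex_bij_witness[of _ "\<lambda>(q, p). (p, q)" "\<lambda>(p, q). (q, p)"]; auto)
    also have "\<dots> = cup_product X \<phi> (cup_product X \<psi> \<theta>) n \<sigma>"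
    proof -
      have "(\<Sum>p\<in>{r..n}. T r p)
          = \<phi> r (front_face r \<sigma>) * cup_product X \<psi> \<theta> (n - r) (back_face r (n - r) \<sigma>)"
        if r: "r \<le> n" for r
      proof -
        have "singular_simplex (n - r) X (back_face r (n - r) \<sigma>)"
          using True r by (simp add: singular_simplex_back_face)
        moreover have "(\<Sum>p\<in>{r..n}. T r p)
          = (\<Sum>q\<le>n - r. \<phi> r (front_face r \<sigma>) * (\<psi> q (front_face q (back_face r (n - r) \<sigma>))
              * \<theta> (n - r - q) (back_face q (n - r - q) (back_face r (n - r) \<sigma>))))"
        proof (rule sum.reindex_bij_witness[of _ "\<lambda>q. r + q" "\<lambda>p. p - r"])
          fix p assume p: "p \<in> {r..n}"
          then show "\<phi> r (front_face r \<sigma>) * (\<psi> (p - r) (front_face (p - r) (back_face r (n - r) \<sigma>))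
              * \<theta> (n - r - (p - r)) (back_face (p - r) (n - r - (p - r)) (back_face r (n - r) \<sigma>))) = T r p"
            using back_face_front_face[of r "p - r" \<sigma> "n - p"] back_face_back_face[of "p - r" "n - p" r \<sigma>]
            by (simp add: T_def mult.assoc)
        qed (use r in auto)
        ultimately show ?thesis
          by (simp add: cup_product_def sum_distrib_left)
      qed
      then show ?thesis
        using True by (simp add: cup_product_def[of X \<phi>])
    qed
    finally show ?thesis .
  qed (simp add: cup_product_def)
qed

lemma vector_space_cochain_scale: "vector_space (cochain_scale :: 'k::field \<Rightarrow> ('x, 'k) cochains \<Rightarrow> _)"
  by unfold_locales (auto simp: cochain_scale_def fun_eq_iff algebra_simps)

lemma linear_cochainI:
  assumes "\<And>\<phi> \<psi> n \<sigma>. f (\<phi> + \<psi>) n \<sigma> = f \<phi> n \<sigma> + f \<psi> n \<sigma>"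
    and "\<And>c \<phi> n \<sigma>. f (cochain_scale c \<phi>) n \<sigma> = c * f \<phi> n \<sigma>"
  shows "Vector_Spaces.linear cochain_scale (cochain_scale :: 'k::field \<Rightarrow> ('x, 'k) cochains \<Rightarrow> _)
           (f :: ('x, 'k) cochains \<Rightarrow> ('x, 'k) cochains)"
  unfolding Vector_Spaces.linear_iff
  using assms by (auto simp: vector_space_cochain_scale fun_eq_iff cochain_scale_def[of _ "f _"])

lemma linear_coboundary:
  "Vector_Spaces.linear cochain_scale cochain_scale (coboundary X :: ('x, 'k::field) cochains \<Rightarrow> _)"
  by (rule linear_cochainI)
     (auto simp: coboundary_def cochain_scale_def sum.distrib sum_distrib_left algebra_simps)

lemma cochain_dg_ring:
  "dg_ring (cochain_scale :: 'k::field \<Rightarrow> ('x, 'k) cochains \<Rightarrow> _)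
     (cup_product X) (coboundary X) cochain_sign"
proof (intro dg_ring.intro dg_ring_axioms.intro vector_space_cochain_scale)
    show "Vector_Spaces.linear cochain_scale cochain_scale (coboundary X :: ('x, 'k) cochains \<Rightarrow> _)"
      by (rule linear_coboundary)
    show "Vector_Spaces.linear cochain_scale cochain_scale (cochain_sign :: ('x, 'k) cochains \<Rightarrow> _)"
      by (rule linear_cochainI) (auto simp: cochain_sign_def cochain_scale_def algebra_simps)
  next
    fix \<phi> \<psi> \<theta> :: "('x, 'k) cochains" and c :: 'k
    show "cup_product X (\<phi> + \<psi>) \<theta> = cup_product X \<phi> \<theta> + cup_product X \<psi> \<theta>"
      by (auto simp: cup_product_def fun_eq_iff sum.distrib algebra_simps)
    show "cup_product X \<phi> (\<psi> + \<theta>) = cup_product X \<phi> \<psi> + cup_product X \<phi> \<theta>"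
      by (auto simp: cup_product_def fun_eq_iff sum.distrib algebra_simps)
    show "cup_product X (cochain_scale c \<phi>) \<psi> = cochain_scale c (cup_product X \<phi> \<psi>)"
      by (auto simp: cup_product_def cochain_scale_def fun_eq_iff sum_distrib_left algebra_simps)
    show "cup_product X \<phi> (cochain_scale c \<psi>) = cochain_scale c (cup_product X \<phi> \<psi>)"
      by (auto simp: cup_product_def cochain_scale_def fun_eq_iff sum_distrib_left algebra_simps)
    show "cup_product X (cup_product X \<phi> \<psi>) \<theta> = cup_product X \<phi> (cup_product X \<psi> \<theta>)"
      by (rule cup_product_assoc)
    show "cochain_sign (cup_product X \<phi> \<psi>) = cup_product X (cochain_sign \<phi>) (cochain_sign \<psi>)"
    proof (intro ext)
      fix n and \<sigma> :: "(nat \<Rightarrow> real) \<Rightarrow> 'x"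
      have "(- 1) ^ n = (- 1 :: 'k) ^ p * (- 1) ^ (n - p)" if "p \<le> n" for p
        using that by (simp flip: power_add)
      then show "cochain_sign (cup_product X \<phi> \<psi>) n \<sigma>
          = cup_product X (cochain_sign \<phi>) (cochain_sign \<psi>) n \<sigma>"
        by (auto simp: cochain_sign_def cup_product_def sum_distrib_left algebra_simps intro!: sum.cong)
    qed
    show "cochain_sign (cochain_sign \<phi>) = \<phi>"
      by (auto simp: cochain_sign_def fun_eq_iff simp flip: mult.assoc power_add mult_2)
    show "coboundary X (coboundary X \<phi>) = 0"
      by (rule coboundary_coboundary)
    show "coboundary X (cochain_sign \<phi>) = - cochain_sign (coboundary X \<phi>)"
    proof (intro ext)
      fix n and \<sigma> :: "(nat \<Rightarrow> real) \<Rightarrow> 'x"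
      show "coboundary X (cochain_sign \<phi>) n \<sigma> = (- cochain_sign (coboundary X \<phi>)) n \<sigma>"
        by (cases n) (auto simp: cochain_sign_def coboundary_def sum_distrib_left
            algebra_simps sum_negf simp del: sum.atMost_Suc intro!: sum.cong)
    qed
    show "coboundary X (cup_product X \<phi> \<psi>)
        = cup_product X (coboundary X \<phi>) \<psi> + cup_product X (cochain_sign \<phi>) (coboundary X \<psi>)"
      by (rule coboundary_cup_product)
qed


section \<open>Cochain homotopies from chain homotopies\<close>

definition dual_op ::
    "'x topology \<Rightarrow> (nat \<Rightarrow> ((nat \<Rightarrow> real) \<Rightarrow> 'x) \<Rightarrow> 'x chain) \<Rightarrow> ('x, 'k::field) cochains \<Rightarrow> ('x, 'k) cochains"
  where "dual_op X D \<phi> = (\<lambda>n \<sigma>. if singular_simplex n X \<sigma> then eval_chain (\<phi> (Suc n)) (D n \<sigma>) else 0)"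

lemma linear_dual_op:
  "Vector_Spaces.linear cochain_scale cochain_scale (dual_op X D :: ('x, 'k::field) cochains \<Rightarrow> _)"
  by (rule linear_cochainI) (auto simp: dual_op_def cochain_scale_def eval_chain_linear)

text \<open>The chain map \<open>\<partial>D + D\<partial>\<close> in degree \<open>n\<close>. In degree \<open>0\<close> the boundary is zero, so the
  truncation of \<open>n - 1\<close> is harmless.\<close>

definition homotopy_term ::
    "(nat \<Rightarrow> ((nat \<Rightarrow> real) \<Rightarrow> 'x) \<Rightarrow> 'x chain) \<Rightarrow> nat \<Rightarrow> 'x chain \<Rightarrow> 'x chain" where
  "homotopy_term D n c = chain_boundary (Suc n) (frag_extend (D n) c)
     + frag_extend (D (n - 1)) (chain_boundary n c)"

lemma dual_op_homotopy:
  assumes "singular_simplex n X \<sigma>" "singular_chain (Suc n) X (D n \<sigma>)"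
  shows "(coboundary X (dual_op X D \<phi>) + dual_op X D (coboundary X \<phi>)) n \<sigma>
       = eval_chain (\<phi> n) (homotopy_term D n (frag_of \<sigma>))"
proof -
  have "coboundary X (dual_op X D \<phi>) n \<sigma>
      = eval_chain (\<phi> n) (frag_extend (D (n - 1)) (chain_boundary n (frag_of \<sigma>)))"
  proof (cases n)
    case (Suc m)
    have "singular_chain m X (chain_boundary n (frag_of \<sigma>))"
      using assms(1) singular_chain_boundary_alt[of m X "frag_of \<sigma>"]
      by (simp add: Suc singular_chain_of)
    then show ?thesis
      using assms(1) unfolding coboundary_eq eval_chain_extend
      by (auto simp: Suc dual_op_def singular_chain_def intro!: eval_chain_cong)
  qed (simp add: coboundary_eq chain_boundary_def)
  moreover have "dual_op X D (coboundary X \<phi>) n \<sigma> = eval_chain (\<phi> n) (chain_boundary (Suc n) (D n \<sigma>))"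
    using assms by (simp add: dual_op_def eval_chain_coboundary)
  ultimately show ?thesis
    by (simp add: homotopy_term_def eval_chain_add)
qed


section \<open>Cones over simplices in a set contractible in the space\<close>

text \<open>Joins the simplex to a new first vertex: along the line from the face opposite the new vertex to
  this vertex the homotopy parameter is the first barycentric coordinate \<open>t 0\<close>. At \<open>t 0 = 1\<close> the
  argument of \<open>\<sigma>\<close> is a division by zero, which is harmless as \<open>H (1, _)\<close> is constant. Because the
  homotopy ends at a point, one simplex takes the place of the usual prism.\<close>

definition cone_simplex ::
    "(real \<times> 'x \<Rightarrow> 'x) \<Rightarrow> nat \<Rightarrow> ((nat \<Rightarrow> real) \<Rightarrow> 'x) \<Rightarrow> (nat \<Rightarrow> real) \<Rightarrow> 'x" where
  "cone_simplex H n \<sigma> =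
     restrict (\<lambda>t. H (t 0, \<sigma> (\<lambda>i. t (Suc i) / (1 - t 0)))) (standard_simplex (Suc n))"

abbreviation simplex_space :: "nat \<Rightarrow> (nat \<Rightarrow> real) topology" where
  "simplex_space n \<equiv> subtopology (powertop_real UNIV) (standard_simplex n)"

text \<open>The quotient map that presents a simplex of dimension \<open>n + 1\<close> as a cone over one of dimension
  \<open>n\<close>. The cone simplex is continuous because its composition with this map is.\<close>

definition join :: "real \<times> (nat \<Rightarrow> real) \<Rightarrow> nat \<Rightarrow> real" where
  "join = (\<lambda>(s, v). case_nat s (\<lambda>i. (1 - s) * v i))"

lemma join_in_standard_simplex:
  assumes "s \<in> {0..1}" "v \<in> standard_simplex n"
  shows "join (s, v) \<in> standard_simplex (Suc n)"
proof -
  have "(1 - s) * v i \<le> 1" for i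
    using assms mult_mono[of "1 - s" 1 "v i" 1] by (auto simp: standard_simplex_def)
  then show ?thesis
    using assms
    by (auto simp: join_def standard_simplex_def sum.atMost_Suc_shift simp del: sum.atMost_Suc
        simp flip: sum_distrib_left split: nat.split)
qed

lemma simplex_coordinates:
  assumes "t \<in> standard_simplex (Suc n)" "t 0 \<noteq> 1"
  shows "(\<lambda>i. t (Suc i) / (1 - t 0)) \<in> standard_simplex n"
proof -
  have sum: "t 0 + (\<Sum>i\<le>n. t (Suc i)) = 1" and t: "\<And>i. 0 \<le> t i" "\<And>i. t i \<le> 1" "\<And>i. i > Suc n \<Longrightarrow> t i = 0"
    using assms by (auto simp: standard_simplex_def sum.atMost_Suc_shift simp del: sum.atMost_Suc)
  have pos: "1 - t 0 > 0" using t(2)[of 0] assms(2) by simp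
  have "t (Suc i) \<le> 1 - t 0" for i
  proof (cases "i \<le> n")
    case True
    then have "t (Suc i) \<le> (\<Sum>i\<le>n. t (Suc i))"
      using t(1) by (intro member_le_sum) auto
    with sum show ?thesis by simp
  qed (use pos t in auto)
  then show ?thesis
    using pos t sum by (auto simp: standard_simplex_def simp flip: sum_divide_distrib)
qed

lemma join_coordinates:
  assumes "t 0 \<noteq> 1"
  shows "join (t 0, \<lambda>i. t (Suc i) / (1 - t 0)) = t"
  using assms by (auto simp: join_def fun_eq_iff split: nat.split)

lemma quotient_map_join:
  "quotient_map (prod_topology (top_of_set {0..1}) (simplex_space n)) (simplex_space (Suc n)) join"
proof (rule continuous_imp_quotient_map)
  let ?Y = "prod_topology (top_of_set {0..1::real}) (simplex_space n)"
  have "continuous_map ?Y euclideanreal (\<lambda>x. join x i)" for i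
  proof -
    have "continuous_map ?Y euclideanreal (\<lambda>x. fst x)"
      using continuous_map_fst[of "top_of_set {0..1::real}" "simplex_space n"]
      by (simp add: continuous_map_in_subtopology)
    moreover have "continuous_map (simplex_space n) euclideanreal (\<lambda>v. v j)" for j
      by (rule continuous_map_from_subtopology) (auto intro: continuous_map_product_projection)
    then have "continuous_map ?Y euclideanreal (\<lambda>x. snd x j)" for j
      by (rule continuous_map_compose[OF continuous_map_snd, unfolded comp_def])
    ultimately show ?thesis
      by (cases i) (auto simp: join_def case_prod_unfold intro!: continuous_intros)
  qed
  then show "continuous_map ?Y (simplex_space (Suc n)) join"
    by (auto simp: continuous_map_in_subtopology continuous_map_componentwise join_in_standard_simplex)
  show "compact_space ?Y"
    by (simp add: compact_space_prod_topology compact_space_subtopology compactin_standard_simplex)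
  show "Hausdorff_space (simplex_space (Suc n))"
    by (simp add: Hausdorff_space_subtopology Hausdorff_space_product_topology)
  show "join ` topspace ?Y = topspace (simplex_space (Suc n))"
  proof (intro equalityI subsetI)
    fix t assume "t \<in> topspace (simplex_space (Suc n))"
    then have t: "t \<in> standard_simplex (Suc n)" by simp
    then have t01: "t 0 \<in> {0..1}" by (auto simp: standard_simplex_def)
    show "t \<in> join ` topspace ?Y"
    proof (cases "t 0 = 1")
      case False
      then show ?thesis
        using t t01 simplex_coordinates[OF t] join_coordinates[of t]
        by (auto intro!: image_eqI[of _ join "(t 0, \<lambda>i. t (Suc i) / (1 - t 0))"])
    next
      case True
      with t have "(\<Sum>i\<le>n. t (Suc i)) = 0" "\<forall>i. 0 \<le> t i" "\<forall>i>Suc n. t i = 0"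
        by (auto simp: standard_simplex_def sum.atMost_Suc_shift simp del: sum.atMost_Suc)
      then have "t (Suc i) = 0" for i
        by (cases "i \<le> n") (auto simp: sum_nonneg_eq_0_iff)
      then have "t = join (1, \<lambda>j. if j = 0 then 1 else 0)"
        using True by (auto simp: join_def fun_eq_iff split: nat.split)
      then show ?thesis
        by (auto intro!: image_eqI[of _ join "(1, \<lambda>j. if j = 0 then 1 else 0)"])
    qed
  qed (auto simp: join_in_standard_simplex)
qed

locale null_homotopy =
  fixes X :: "'x topology" and U :: "'x set" and H :: "real \<times> 'x \<Rightarrow> 'x" and a :: 'x
  assumes continuous_H: "continuous_map (prod_topology (top_of_set {0..1}) (subtopology X U)) X H"
    and H_0: "H (0, x) = x"
    and H_1: "H (1, x) = a"
begin

lemma singular_simplex_cone: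
  assumes "singular_simplex n (subtopology X U) \<sigma>"
  shows "singular_simplex (Suc n) X (cone_simplex H n \<sigma>)"
proof -
  let ?I = "top_of_set {0..1::real}"
  have "continuous_map (prod_topology ?I (simplex_space n)) (prod_topology ?I (subtopology X U)) (\<lambda>(s, v). (s, \<sigma> v))"
    using assms by (simp add: continuous_map_prod_top singular_simplex_def continuous_map_id[unfolded id_def])
  then have "continuous_map (prod_topology ?I (simplex_space n)) X (H \<circ> (\<lambda>(s, v). (s, \<sigma> v)))"
    using continuous_H by (rule continuous_map_compose)
  moreover have "(H \<circ> (\<lambda>(s, v). (s, \<sigma> v))) p = (cone_simplex H n \<sigma> \<circ> join) p"
    if "p \<in> topspace (prod_topology ?I (simplex_space n))" for p
  proof (cases p)
    case (Pair s v)
    with that have "s \<in> {0..1}" "v \<in> standard_simplex n" by auto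
    then show ?thesis
      using join_in_standard_simplex[of s v n] H_1
      by (cases "s = 1") (auto simp: Pair cone_simplex_def join_def)
  qed
  ultimately have "continuous_map (prod_topology ?I (simplex_space n)) X (cone_simplex H n \<sigma> \<circ> join)"
    by (rule continuous_map_eq)
  then have "continuous_map (simplex_space (Suc n)) X (cone_simplex H n \<sigma>)"
    by (rule continuous_compose_quotient_map[OF quotient_map_join])
  then show ?thesis
    by (simp add: singular_simplex_def) (simp add: cone_simplex_def)
qed

lemma first_face_cone:
  assumes "singular_simplex n X \<sigma>"
  shows "singular_face (Suc n) 0 (cone_simplex H n \<sigma>) = \<sigma>"
proof -
  have "singular_face (Suc n) 0 (cone_simplex H n \<sigma>) = restrict \<sigma> (standard_simplex n)"
    using simplical_face_in_standard_simplex[of "Suc n" 0]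
    by (auto simp: singular_face_def cone_simplex_def restrict_def fun_eq_iff simplical_face_def H_0)
  then show ?thesis
    using assms by (simp add: singular_simplex_def extensional_restrict)
qed

lemma face_cone:
  assumes "k \<le> Suc n"
  shows "singular_face (Suc (Suc n)) (Suc k) (cone_simplex H (Suc n) \<sigma>)
       = cone_simplex H n (singular_face (Suc n) k \<sigma>)"
proof -
  have "H (v 0, \<sigma> (\<lambda>i. simplical_face (Suc k) v (Suc i) / (1 - v 0)))
      = H (v 0, singular_face (Suc n) k \<sigma> (\<lambda>i. v (Suc i) / (1 - v 0)))"
    if v: "v \<in> standard_simplex (Suc n)" for v
  proof (cases "v 0 = 1")
    case False
    have "(\<lambda>i. simplical_face (Suc k) v (Suc i) / (1 - v 0)) = simplical_face k (\<lambda>i. v (Suc i) / (1 - v 0))"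
      by (auto simp: simplical_face_def fun_eq_iff)
    then show ?thesis
      using simplex_coordinates[OF v False] by (simp add: singular_face_def)
  qed (simp add: H_1)
  moreover have "simplical_face (Suc k) v 0 = v 0" for v :: "nat \<Rightarrow> real"
    by (simp add: simplical_face_def)
  ultimately show ?thesis
    using simplical_face_in_standard_simplex[of "Suc (Suc n)" "Suc k"] assms
    by (intro ext) (auto simp: singular_face_def[of "Suc (Suc n)"] cone_simplex_def restrict_def)
qed

definition cone_op :: "nat \<Rightarrow> ((nat \<Rightarrow> real) \<Rightarrow> 'x) \<Rightarrow> 'x chain" where
  "cone_op n \<sigma> = (if singular_simplex n (subtopology X U) \<sigma> then frag_of (cone_simplex H n \<sigma>) else 0)"

lemma singular_chain_cone_op: "singular_chain (Suc n) X (cone_op n \<sigma>)"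
  by (simp add: cone_op_def singular_chain_of singular_simplex_cone)

text \<open>The first face of the cone is the simplex itself, and the others are the cones over its faces.
  In degree \<open>0\<close> the identity fails, since the cone over a point has another end.\<close>

lemma homotopy_term_cone_op:
  assumes \<sigma>: "singular_simplex n (subtopology X U) \<sigma>" and "n > 0"
  shows "homotopy_term cone_op n (frag_of \<sigma>) = frag_of \<sigma>"
proof -
  obtain m where n: "n = Suc m" using \<open>n > 0\<close> by (cases n) auto
  have "chain_boundary (Suc n) (cone_op n \<sigma>)
      = frag_of \<sigma> + (\<Sum>k\<le>n. - frag_cmul ((- 1) ^ k) (frag_of (cone_simplex H m (singular_face n k \<sigma>))))"
    using \<sigma> by (simp add: cone_op_def chain_boundary_of sum.atMost_Suc_shift[of _ "Suc m"] n first_face_cone face_cone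
        singular_simplex_subtopology del: sum.atMost_Suc)
  moreover have "frag_extend (cone_op m) (chain_boundary n (frag_of \<sigma>))
      = (\<Sum>k\<le>n. frag_cmul ((- 1) ^ k) (frag_of (cone_simplex H m (singular_face n k \<sigma>))))"
    using singular_simplex_singular_face[OF \<sigma>]
    by (auto simp: chain_boundary_of n frag_extend_sum frag_extend_cmul cone_op_def simp del: sum.atMost_Suc
        intro!: sum.cong)
  ultimately show ?thesis
    by (simp add: homotopy_term_def n sum_negf del: sum.atMost_Suc minus_frag_cmul)
qed

text \<open>The restriction to \<open>U\<close> of a cocycle of positive degree is a coboundary, with a primitive that is
  linear in the cocycle.\<close>

lemma coboundary_dual_cone:
  assumes "singular_simplex n (subtopology X U) \<sigma>" "n > 0" "coboundary X \<phi> = 0"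
  shows "coboundary X (dual_op X cone_op \<phi>) n \<sigma> = \<phi> n \<sigma>"
proof -
  have "singular_simplex n X \<sigma>" using assms by (simp add: singular_simplex_subtopology)
  moreover have "dual_op X cone_op (coboundary X \<phi>) n \<sigma> = 0"
    by (simp add: assms(3) dual_op_def eval_chain_def)
  ultimately show ?thesis
    using dual_op_homotopy[where D = cone_op and \<phi> = \<phi>, OF _ singular_chain_cone_op, of n \<sigma>] assms(1,2)
    by (simp add: homotopy_term_cone_op)
qed

text \<open>The cone over a point of \<open>U\<close> is a path to \<open>a\<close>.\<close>

lemma cocycle_0_constant:
  assumes "singular_simplex 0 (subtopology X U) \<sigma>" "coboundary X \<phi> = 0"
  shows "\<phi> 0 \<sigma> = \<phi> 0 (restrict (\<lambda>_. a) (standard_simplex 0))"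
proof -
  let ?c = "cone_simplex H 0 \<sigma>"
  have "singular_simplex 1 X ?c"
    using singular_simplex_cone[OF assms(1)] by simp
  then have "0 = \<phi> 0 (singular_face 1 0 ?c) - \<phi> 0 (singular_face 1 1 ?c)"
    using fun_cong[OF fun_cong[OF assms(2)], of 1 ?c] by (simp add: coboundary_def)
  moreover have "singular_face 1 0 ?c = \<sigma>"
    using first_face_cone[of 0 \<sigma>] assms(1) by (simp add: singular_simplex_subtopology)
  moreover have "singular_face 1 1 ?c = restrict (\<lambda>_. a) (standard_simplex 0)"
    using simplical_face_in_standard_simplex[of 1 1]
    by (auto simp: singular_face_def cone_simplex_def fun_eq_iff standard_simplex_0 simplical_face_def H_1)
  ultimately show ?thesis by simp
qed

end


section \<open>Contracting the cochains that vanish on small simplices\<close>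

definition small :: "'x set set \<Rightarrow> nat \<Rightarrow> ((nat \<Rightarrow> real) \<Rightarrow> 'x) \<Rightarrow> bool" where
  "small \<U> n \<sigma> \<longleftrightarrow> (\<exists>V\<in>\<U>. \<sigma> ` standard_simplex n \<subseteq> V)"

definition small_chain :: "'x topology \<Rightarrow> 'x set set \<Rightarrow> nat \<Rightarrow> 'x chain \<Rightarrow> bool" where
  "small_chain X \<U> n c \<longleftrightarrow> (\<forall>\<sigma>\<in>Poly_Mapping.keys c. singular_simplex n X \<sigma> \<and> small \<U> n \<sigma>)"

lemma small_chain_0 [simp]: "small_chain X \<U> n 0"
  by (simp add: small_chain_def)

lemma small_chain_of: "small_chain X \<U> n (frag_of \<sigma>) \<longleftrightarrow> singular_simplex n X \<sigma> \<and> small \<U> n \<sigma>"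
  by (simp add: small_chain_def)

lemma small_chain_diff: "small_chain X \<U> n a \<Longrightarrow> small_chain X \<U> n b \<Longrightarrow> small_chain X \<U> n (a - b)"
  using keys_diff[of a b] by (auto simp: small_chain_def)

text \<open>Iterated barycentric subdivision makes the chain small, and the natural homotopy between
  subdivision and the identity maps small chains to small chains. Hence it changes \<open>x\<close> by a boundary
  up to a small chain.\<close>

lemma small_chain_subdivision_homotopy:
  assumes open_cover: "\<forall>V\<in>\<U>. openin X V" "topspace X \<subseteq> \<Union>\<U>"
    and x: "singular_chain n X x" and bx: "small_chain X \<U> (n - 1) (chain_boundary n x)" and "n > 0"
  shows "\<exists>y. singular_chain (Suc n) X y \<and> small_chain X \<U> n (x - chain_boundary (Suc n) y)"
proof -
  have openU: "\<And>V. V \<in> \<U> \<Longrightarrow> openin X V" using open_cover(1) by blast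
  obtain m where m: "\<And>m' f. \<lbrakk>m \<le> m'; f \<in> Poly_Mapping.keys ((singular_subdivision n ^^ m') x)\<rbrakk>
      \<Longrightarrow> \<exists>V\<in>\<U>. f \<in> standard_simplex n \<rightarrow> V"
    using sufficient_iterated_singular_subdivision_exists[where \<C> = \<U> and thesis = thesis]
      openU open_cover(2) x that by metis
  obtain h where h: "\<And>p. h p 0 = (0 :: 'a chain)"
        "\<And>p c1 c2. h p (c1 - c2) = h p c1 - h p c2"
        "\<And>p X c. singular_chain p X c \<Longrightarrow> singular_chain (Suc p) X (h p c)"
        "\<And>p X c. singular_chain p X c \<Longrightarrow> chain_boundary (Suc p) (h p c) + h (p - Suc 0) (chain_boundary p c)
                   = (singular_subdivision p ^^ m) c - c"
    by (blast intro: chain_homotopic_iterated_singular_subdivision)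
  have "singular_chain n X ((singular_subdivision n ^^ m) x)"
    by (induction m) (simp_all add: x singular_chain_singular_subdivision)
  with m[OF order_refl] have Sd: "small_chain X \<U> n ((singular_subdivision n ^^ m) x)"
    unfolding small_chain_def small_def singular_chain_def image_subset_iff_funcset by blast
  have "small_chain X \<U> (Suc p) (h p c)" if "small_chain X \<U> p c" for p c
  proof -
    have "Poly_Mapping.keys c \<subseteq> {\<sigma>. singular_simplex p X \<sigma> \<and> small \<U> p \<sigma>}"
      using that by (auto simp: small_chain_def)
    then show ?thesis
    proof (induction c rule: frag_induction)
      case (one \<sigma>)
      then obtain V where V: "V \<in> \<U>" "\<sigma> ` standard_simplex p \<subseteq> V" "singular_simplex p X \<sigma>"
        by (auto simp: small_def)
      then have "singular_chain p (subtopology X V) (frag_of \<sigma>)"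
        by (simp add: singular_chain_of singular_simplex_subtopology)
      from h(3)[OF this] \<open>V \<in> \<U>\<close> show ?case
        unfolding small_chain_def small_def singular_chain_def
        by (auto simp: subset_iff singular_simplex_subtopology intro!: bexI[of _ V])
    qed (simp_all add: h small_chain_diff)
  qed
  from this[OF bx] \<open>n > 0\<close> have hb: "small_chain X \<U> n (h (n - 1) (chain_boundary n x))" by simp
  have "x - chain_boundary (Suc n) (- h n x) = (singular_subdivision n ^^ m) x - h (n - 1) (chain_boundary n x)"
    using h(4)[OF x] by (simp add: chain_boundary_minus algebra_simps)
  then have "small_chain X \<U> n (x - chain_boundary (Suc n) (- h n x))"
    using small_chain_diff[OF Sd hb] by simp
  moreover have "singular_chain (Suc n) X (- h n x)"
    using h(3)[OF x] by (simp add: singular_chain_minus)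
  ultimately show ?thesis by blast
qed

text \<open>A chain homotopy from the identity to a chain map with small values, chosen simplex by simplex
  by induction on the dimension. It vanishes on small simplices, which makes its dual preserve the
  cochains that vanish on them.\<close>

primrec small_op ::
    "'x topology \<Rightarrow> 'x set set \<Rightarrow> nat \<Rightarrow> ((nat \<Rightarrow> real) \<Rightarrow> 'x) \<Rightarrow> 'x chain" where
  "small_op X \<U> 0 = (\<lambda>\<sigma>. 0)"
| "small_op X \<U> (Suc n) = (\<lambda>\<sigma>. if small \<U> (Suc n) \<sigma> then 0 else
     SOME y. singular_chain (Suc (Suc n)) X y \<and>
       small_chain X \<U> (Suc n)
         (frag_of \<sigma> - frag_extend (small_op X \<U> n) (chain_boundary (Suc n) (frag_of \<sigma>))
           - chain_boundary (Suc (Suc n)) y))"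

lemma small_op_small: "small \<U> n \<sigma> \<Longrightarrow> small_op X \<U> n \<sigma> = 0"
  by (cases n) simp_all

lemma small_chain_boundary_of:
  assumes "singular_simplex n X \<sigma>" "small \<U> n \<sigma>"
  shows "small_chain X \<U> (n - 1) (chain_boundary n (frag_of \<sigma>))"
proof -
  obtain V where V: "V \<in> \<U>" "\<sigma> ` standard_simplex n \<subseteq> V" using assms by (auto simp: small_def)
  with assms have "singular_chain n (subtopology X V) (frag_of \<sigma>)"
    by (simp add: singular_chain_of singular_simplex_subtopology)
  from singular_chain_boundary[OF this] \<open>V \<in> \<U>\<close> show ?thesis
    unfolding small_chain_def small_def singular_chain_def
    by (auto simp: subset_iff singular_simplex_subtopology intro!: bexI[of _ V])
qed

lemma homotopy_term_0 [simp]: "homotopy_term D n 0 = 0"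
  by (simp add: homotopy_term_def)

lemma homotopy_term_diff: "homotopy_term D n (a - b) = homotopy_term D n a - homotopy_term D n b"
  by (simp add: homotopy_term_def frag_extend_diff chain_boundary_diff)

text \<open>The boundary of \<open>x = \<sigma> - D (\<partial> \<sigma>)\<close> is \<open>\<partial> \<sigma> - \<partial> D (\<partial> \<sigma>)\<close>, which is small by the induction
  hypothesis applied to the cycle \<open>\<partial> \<sigma>\<close>. So \<open>x\<close> can be made small by a boundary, and \<open>D \<sigma>\<close> is a
  chain with that boundary.\<close>

lemma small_op_homotopy:
  assumes open_cover: "\<forall>V\<in>\<U>. openin X V" "topspace X \<subseteq> \<Union>\<U>"
    and "singular_simplex n X \<sigma>"
  shows "singular_chain (Suc n) X (small_op X \<U> n \<sigma>)"
    and "small_chain X \<U> n (frag_of \<sigma> - homotopy_term (small_op X \<U>) n (frag_of \<sigma>))"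
proof -
  have "singular_chain (Suc n) X (small_op X \<U> n \<sigma>) \<and>
        small_chain X \<U> n (frag_of \<sigma> - homotopy_term (small_op X \<U>) n (frag_of \<sigma>))"
    using assms(3)
  proof (induction n arbitrary: \<sigma>)
    case 0
    have "\<sigma> ` standard_simplex 0 = {\<sigma> (\<lambda>j. if j = 0 then 1 else 0)}"
      by (simp add: standard_simplex_0)
    moreover have "\<sigma> ` standard_simplex 0 \<subseteq> topspace X"
      using 0 by (auto simp: singular_simplex_def continuous_map_def)
    ultimately have "small \<U> 0 \<sigma>"
      using open_cover(2) by (auto simp: small_def)
    then show ?case
      using 0 by (simp add: homotopy_term_def chain_boundary_def small_chain_of)
  next
    case (Suc n)
    let ?D = "small_op X \<U>" and ?b = "chain_boundary (Suc n) (frag_of \<sigma>)"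
    define x where "x = frag_of \<sigma> - frag_extend (?D n) ?b"
    have b: "singular_chain n X ?b"
      using singular_chain_boundary_alt Suc.prems by (metis singular_chain_of)
    then have ext: "singular_chain (Suc n) X (frag_extend (?D n) ?b)"
      using Suc.IH by (intro singular_chain_extend) (auto simp: singular_chain_def)
    then have x: "singular_chain (Suc n) X x"
      using Suc.prems by (simp add: x_def singular_chain_diff singular_chain_of)
    have "small_chain X \<U> n (c - homotopy_term ?D n c)" if "singular_chain n X c" for c
      using that[unfolded singular_chain_def]
    proof (induction c rule: frag_induction)
      case (diff a b)
      then show ?case
        using small_chain_diff[OF diff] by (simp add: homotopy_term_diff algebra_simps)
    qed (use Suc.IH in auto)
    from this[OF b] have "small_chain X \<U> n (?b - homotopy_term ?D n ?b)" .
    moreover have "?b - homotopy_term ?D n ?b = chain_boundary (Suc n) x"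
      using Suc.prems chain_boundary_boundary_alt[of n X "frag_of \<sigma>"]
        chain_boundary_boundary[of "Suc n" X "frag_of \<sigma>"]
      by (simp add: homotopy_term_def x_def chain_boundary_diff singular_chain_of)
    ultimately have bx: "small_chain X \<U> n (chain_boundary (Suc n) x)" by simp
    show ?case
    proof (cases "small \<U> (Suc n) \<sigma>")
      case True
      have "small_chain X \<U> n ?b"
        using small_chain_boundary_of[OF Suc.prems True] by simp
      then have "frag_extend (?D n) ?b = 0"
        by (intro frag_extend_eq_0) (auto simp: small_chain_def small_op_small)
      then show ?thesis
        using True Suc.prems by (simp add: homotopy_term_def small_chain_of)
    next
      case False
      then have "?D (Suc n) \<sigma> = (SOME y. singular_chain (Suc (Suc n)) X y \<and>
          small_chain X \<U> (Suc n) (x - chain_boundary (Suc (Suc n)) y))"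
        by (simp add: x_def)
      with someI_ex[OF small_chain_subdivision_homotopy[OF open_cover x]] bx
      have "singular_chain (Suc (Suc n)) X (?D (Suc n) \<sigma>) \<and>
          small_chain X \<U> (Suc n) (x - chain_boundary (Suc (Suc n)) (?D (Suc n) \<sigma>))"
        by simp
      moreover have "x - chain_boundary (Suc (Suc n)) (?D (Suc n) \<sigma>)
          = frag_of \<sigma> - homotopy_term ?D (Suc n) (frag_of \<sigma>)"
        by (simp add: x_def homotopy_term_def del: small_op.simps)
      ultimately show ?thesis by simp
    qed
  qed
  then show "singular_chain (Suc n) X (small_op X \<U> n \<sigma>)"
    and "small_chain X \<U> n (frag_of \<sigma> - homotopy_term (small_op X \<U>) n (frag_of \<sigma>))"
    by auto
qed

definition vanishing_on_small :: "'x topology \<Rightarrow> 'x set set \<Rightarrow> ('x, 'k::field) cochains set" where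
  "vanishing_on_small X \<U> =
     {\<phi>. \<forall>n \<sigma>. \<phi> n \<sigma> \<noteq> 0 \<longrightarrow> singular_simplex n X \<sigma> \<and> \<not> small \<U> n \<sigma>}"

text \<open>A cochain that vanishes on small chains does not see the difference between the identity and
  the homotopic chain map.\<close>

lemma small_op_contraction:
  assumes open_cover: "\<forall>V\<in>\<U>. openin X V" "topspace X \<subseteq> \<Union>\<U>"
    and \<phi>: "\<phi> \<in> vanishing_on_small X \<U>"
  shows "coboundary X (dual_op X (small_op X \<U>) \<phi>) + dual_op X (small_op X \<U>) (coboundary X \<phi>) = \<phi>"
proof (intro ext)
  fix n \<sigma>
  let ?D = "small_op X \<U>"
  show "(coboundary X (dual_op X ?D \<phi>) + dual_op X ?D (coboundary X \<phi>)) n \<sigma> = \<phi> n \<sigma>"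
  proof (cases "singular_simplex n X \<sigma>")
    case True
    have "eval_chain (\<phi> n) (frag_of \<sigma> - homotopy_term ?D n (frag_of \<sigma>))
        = eval_chain (\<lambda>_. 0) (frag_of \<sigma> - homotopy_term ?D n (frag_of \<sigma>))"
      using small_op_homotopy(2)[OF open_cover True] \<phi>
      by (intro eval_chain_cong) (auto simp: small_chain_def vanishing_on_small_def)
    then have "eval_chain (\<phi> n) (homotopy_term ?D n (frag_of \<sigma>)) = \<phi> n \<sigma>"
      by (simp add: eval_chain_diff) (simp add: eval_chain_def)
    then show ?thesis
      using dual_op_homotopy[where D = ?D and \<phi> = \<phi>, OF True] small_op_homotopy(1)[of \<U> X n \<sigma>] open_cover True
      by simp
  next
    case False
    moreover from this \<phi> have "\<phi> n \<sigma> = 0" by (auto simp: vanishing_on_small_def)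
    ultimately show ?thesis by (simp add: coboundary_def dual_op_def)
  qed
qed

lemma vanishing_on_small_dual_op:
  "dual_op X (small_op X \<U>) \<phi> \<in> vanishing_on_small X \<U>"
  by (auto simp: vanishing_on_small_def dual_op_def small_op_small)


section \<open>Spaces covered by two open sets contractible in them\<close>

lemma singular_simplex_constant:
  "x \<in> topspace X \<Longrightarrow> x \<in> U \<Longrightarrow> singular_simplex n (subtopology X U) (restrict (\<lambda>_. x) (standard_simplex n))"
  unfolding singular_simplex_def by (auto intro: continuous_map_eq[where f = "\<lambda>_. x"])

lemma small_cases:
  assumes "singular_simplex n X \<sigma>" "small {U, V} n \<sigma>"
  shows "singular_simplex n (subtopology X U) \<sigma> \<or> singular_simplex n (subtopology X V) \<sigma>"
  using assms by (auto simp: small_def singular_simplex_subtopology)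

text \<open>The image of a simplex is connected.\<close>

lemma simplex_in_disjoint_cover:
  assumes "openin X U" "openin X V" "topspace X \<subseteq> U \<union> V" "U \<inter> V = {}" "singular_simplex n X \<sigma>"
  shows "small {U, V} n \<sigma>"
proof -
  have "connectedin (simplex_space n) (standard_simplex n)"
    using connectedin_standard_simplex by (simp add: connectedin_subtopology)
  then have "connectedin X (\<sigma> ` standard_simplex n)"
    using assms(5) unfolding singular_simplex_def by (meson connectedin_continuous_map_image)
  then have conn: "\<sigma> ` standard_simplex n \<subseteq> topspace X"
    "\<nexists>E1 E2. openin X E1 \<and> openin X E2 \<and> \<sigma> ` standard_simplex n \<subseteq> E1 \<union> E2 \<and>
       E1 \<inter> E2 \<inter> \<sigma> ` standard_simplex n = {} \<and> E1 \<inter> \<sigma> ` standard_simplex n \<noteq> {} \<and>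
       E2 \<inter> \<sigma> ` standard_simplex n \<noteq> {}"
    unfolding connectedin by auto
  have "\<sigma> ` standard_simplex n \<subseteq> U \<union> V" using conn(1) assms(3) by blast
  moreover have "U \<inter> V \<inter> \<sigma> ` standard_simplex n = {}" using assms(4) by simp
  ultimately have "U \<inter> \<sigma> ` standard_simplex n = {} \<or> V \<inter> \<sigma> ` standard_simplex n = {}"
    using conn(2)[unfolded not_ex, rule_format, of U V] assms(1,2) by argo
  with \<open>\<sigma> ` standard_simplex n \<subseteq> U \<union> V\<close> show ?thesis
    by (auto simp: small_def)
qed

definition vanishing_on :: "'x topology \<Rightarrow> 'x set \<Rightarrow> ('x, 'k::field) cochains set" where
  "vanishing_on X U = {\<phi>. \<forall>n \<sigma>. singular_simplex n (subtopology X U) \<sigma> \<longrightarrow> \<phi> n \<sigma> = 0}"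

definition unit_cochain :: "'x topology \<Rightarrow> ('x, 'k::field) cochains" where
  "unit_cochain X = (\<lambda>n \<sigma>. if n = 0 \<and> singular_simplex 0 X \<sigma> then 1 else 0)"

lemma unit_cup_product: "\<phi> \<in> singular_cochains X n \<Longrightarrow> cup_product X (unit_cochain X) \<phi> = \<phi>"
proof (intro ext)
  fix m \<sigma>
  assume \<phi>: "\<phi> \<in> singular_cochains X n"
  show "cup_product X (unit_cochain X) \<phi> m \<sigma> = \<phi> m \<sigma>"
  proof (cases "singular_simplex m X \<sigma>")
    case True
    have "cup_product X (unit_cochain X) \<phi> m \<sigma>
        = (\<Sum>p\<in>{0}. unit_cochain X p (front_face p \<sigma>) * \<phi> (m - p) (back_face p (m - p) \<sigma>))"
      using True unfolding cup_product_def
      by (simp only: if_True) (intro sum.mono_neutral_right, auto simp: unit_cochain_def)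
    then show ?thesis
      using True singular_simplex_front_face[OF True, of 0]
      by (simp add: unit_cochain_def back_face_self)
  next
    case False
    then show ?thesis using \<phi> by (auto simp: cup_product_def singular_cochains_def)
  qed
qed

lemma cup_product_unit: "\<phi> \<in> singular_cochains X n \<Longrightarrow> cup_product X \<phi> (unit_cochain X) = \<phi>"
proof (intro ext)
  fix m \<sigma>
  assume \<phi>: "\<phi> \<in> singular_cochains X n"
  show "cup_product X \<phi> (unit_cochain X) m \<sigma> = \<phi> m \<sigma>"
  proof (cases "singular_simplex m X \<sigma>")
    case True
    have "cup_product X \<phi> (unit_cochain X) m \<sigma>
        = (\<Sum>p\<in>{m}. \<phi> p (front_face p \<sigma>) * unit_cochain X (m - p) (back_face p (m - p) \<sigma>))"
      using True unfolding cup_product_def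
      by (simp only: if_True) (intro sum.mono_neutral_right, auto simp: unit_cochain_def)
    then show ?thesis
      using True singular_simplex_back_face[of m 0 X \<sigma>]
      by (simp add: unit_cochain_def front_face_self)
  next
    case False
    then show ?thesis using \<phi> by (auto simp: cup_product_def singular_cochains_def)
  qed
qed

lemma cup_product_nonzero:
  assumes "cup_product X \<phi> \<psi> n \<sigma> \<noteq> 0"
  obtains p where "singular_simplex n X \<sigma>" "p \<le> n"
    "\<phi> p (front_face p \<sigma>) \<noteq> 0" "\<psi> (n - p) (back_face p (n - p) \<sigma>) \<noteq> 0"
proof -
  have \<sigma>: "singular_simplex n X \<sigma>" using assms by (auto simp: cup_product_def split: if_splits)
  then have "(\<Sum>p\<le>n. \<phi> p (front_face p \<sigma>) * \<psi> (n - p) (back_face p (n - p) \<sigma>)) \<noteq> 0"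
    using assms by (simp add: cup_product_def)
  then obtain p where "p \<le> n" "\<phi> p (front_face p \<sigma>) * \<psi> (n - p) (back_face p (n - p) \<sigma>) \<noteq> 0"
    by (meson sum.neutral atMost_iff)
  with \<sigma> that show thesis by auto
qed

lemma front_face_in:
  "singular_simplex n (subtopology X U) \<sigma> \<Longrightarrow> p \<le> n \<Longrightarrow> singular_simplex p (subtopology X U) (front_face p \<sigma>)"
  by (rule singular_simplex_front_face)

lemma back_face_in:
  "singular_simplex n (subtopology X U) \<sigma> \<Longrightarrow> p \<le> n \<Longrightarrow>
   singular_simplex (n - p) (subtopology X U) (back_face p (n - p) \<sigma>)"
  by (simp add: singular_simplex_back_face)

lemma small_front_face: "small \<U> n \<sigma> \<Longrightarrow> p \<le> n \<Longrightarrow> small \<U> p (front_face p \<sigma>)"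
  unfolding small_def by (meson front_face_image order_trans)

lemma small_back_face: "small \<U> n \<sigma> \<Longrightarrow> p \<le> n \<Longrightarrow> small \<U> (n - p) (back_face p (n - p) \<sigma>)"
  unfolding small_def using back_face_image[of p "n - p" \<sigma>] by (metis le_add_diff_inverse order_trans)

lemma cup_product_vanishing:
  assumes "\<phi> \<in> vanishing_on X U"
  shows "cup_product X \<phi> \<psi> \<in> vanishing_on X U"
  unfolding vanishing_on_def
proof (intro CollectI allI impI, rule ccontr)
  fix n \<sigma> assume \<sigma>: "singular_simplex n (subtopology X U) \<sigma>" and nz: "cup_product X \<phi> \<psi> n \<sigma> \<noteq> 0"
  from nz obtain p where "singular_simplex n X \<sigma>" "p \<le> n"
    "\<phi> p (front_face p \<sigma>) \<noteq> 0" "\<psi> (n - p) (back_face p (n - p) \<sigma>) \<noteq> 0"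
    by (rule cup_product_nonzero)
  then show False using assms front_face_in[OF \<sigma>] by (simp add: vanishing_on_def)
qed

text \<open>If the simplex lies in \<open>U\<close> then so does its front face, and the first factor is zero; if it lies
  in \<open>V\<close>, the second factor is zero on the back face.\<close>

lemma cup_product_vanishing_vanishing:
  assumes "\<phi> \<in> vanishing_on X U" "\<psi> \<in> vanishing_on X V"
  shows "cup_product X \<phi> \<psi> \<in> vanishing_on_small X {U, V}"
  unfolding vanishing_on_small_def
proof (intro CollectI allI impI)
  fix n \<sigma> assume "cup_product X \<phi> \<psi> n \<sigma> \<noteq> 0"
  then obtain p where p: "singular_simplex n X \<sigma>" "p \<le> n"
    "\<phi> p (front_face p \<sigma>) \<noteq> 0" "\<psi> (n - p) (back_face p (n - p) \<sigma>) \<noteq> 0"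
    by (rule cup_product_nonzero)
  then show "singular_simplex n X \<sigma> \<and> \<not> small {U, V} n \<sigma>"
    using assms small_cases[OF p(1)] front_face_in[of n X U \<sigma> p] back_face_in[of n X V \<sigma> p]
    unfolding vanishing_on_def by blast
qed

lemma cup_product_vanishing_on_small:
  assumes "\<phi> \<in> vanishing_on_small X \<U>"
  shows "cup_product X \<phi> \<psi> \<in> vanishing_on_small X \<U>" "cup_product X \<psi> \<phi> \<in> vanishing_on_small X \<U>"
  using assms unfolding vanishing_on_small_def
  by (auto elim!: cup_product_nonzero dest: small_front_face small_back_face)

lemma dual_op_part:
  assumes "\<phi> \<in> singular_cochains X n"
  shows "dual_op X D \<phi> \<in> singular_cochains X (n - 1)"
  unfolding singular_cochains_def
proof (intro CollectI allI impI)
  fix m \<sigma> assume nz: "dual_op X D \<phi> m \<sigma> \<noteq> 0"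
  then have "eval_chain (\<phi> (Suc m)) (D m \<sigma>) \<noteq> 0" "singular_simplex m X \<sigma>"
    by (auto simp: dual_op_def split: if_splits)
  moreover from this obtain \<rho> where "\<phi> (Suc m) \<rho> \<noteq> 0"
    by (force simp: eval_chain_def intro: sum.neutral)
  ultimately show "int m = n - 1 \<and> singular_simplex m X \<sigma>"
    using assms by (force simp: singular_cochains_def)
qed

lemma coboundary_part:
  assumes "\<phi> \<in> singular_cochains X n"
  shows "coboundary X \<phi> \<in> singular_cochains X (n + 1)"
  unfolding singular_cochains_def
proof (intro CollectI allI impI)
  fix m \<sigma> assume nz: "coboundary X \<phi> m \<sigma> \<noteq> 0"
  then have m: "m \<ge> 1" "singular_simplex m X \<sigma>"
    and "(\<Sum>k\<le>m. (- 1) ^ k * \<phi> (m - 1) (singular_face m k \<sigma>)) \<noteq> 0"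
    by (auto simp: coboundary_def split: if_splits)
  then obtain \<rho> where "\<phi> (m - 1) \<rho> \<noteq> 0"
    by (metis (no_types, lifting) mult_zero_right sum.neutral)
  then show "int m = n + 1 \<and> singular_simplex m X \<sigma>"
    using assms m by (force simp: singular_cochains_def)
qed

lemma singular_cochains_add:
  "\<phi> \<in> singular_cochains X n \<Longrightarrow> \<psi> \<in> singular_cochains X n \<Longrightarrow>
   (\<phi> + \<psi> :: ('x, 'k::field) cochains) \<in> singular_cochains X n"
  by (simp add: singular_cochains_def) (metis add.right_neutral)

lemma (in null_homotopy) cocycle_vanishing_on:
  assumes "\<phi> \<in> singular_cochains X n" "n > 0" "coboundary X \<phi> = 0"
  shows "\<phi> - coboundary X (dual_op X cone_op \<phi>) \<in> vanishing_on X U"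
  unfolding vanishing_on_def
proof (intro CollectI allI impI)
  fix m \<sigma> assume \<sigma>: "singular_simplex m (subtopology X U) \<sigma>"
  show "(\<phi> - coboundary X (dual_op X cone_op \<phi>)) m \<sigma> = 0"
  proof (cases "m = 0")
    case True
    have "\<phi> 0 \<sigma> = 0" using assms(1,2) unfolding singular_cochains_def by force
    with True show ?thesis by (simp add: coboundary_0)
  next
    case False
    then show ?thesis using coboundary_dual_cone[OF \<sigma> _ assms(3)] by simp
  qed
qed

lemma (in null_homotopy) coboundary_dual_cone_disjoint:
  assumes "singular_simplex n (subtopology X V) \<sigma>" "U \<inter> V = {}"
  shows "coboundary X (dual_op X cone_op \<phi>) n \<sigma> = 0"
proof -
  have "dual_op X cone_op \<phi> (n - 1) (singular_face n k \<sigma>) = 0" if "k \<le> n" "n \<ge> 1" for k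
  proof -
    have "singular_simplex (n - 1) (subtopology X V) (singular_face n k \<sigma>)"
      using singular_simplex_singular_face[OF assms(1) that(2,1)] by simp
    then have "\<not> singular_simplex (n - 1) (subtopology X U) (singular_face n k \<sigma>)"
      using assms(2) nonempty_standard_simplex[of "n - 1"]
      unfolding singular_simplex_subtopology by blast
    then show ?thesis by (simp add: dual_op_def cone_op_def)
  qed
  then show ?thesis by (auto simp: coboundary_def intro!: sum.neutral)
qed

locale two_contractible_sets =
  U: null_homotopy X U H a + V: null_homotopy X V G b for X :: "'x topology" and U H a V G b +
  assumes open_sets: "openin X U" "openin X V" and cover: "topspace X = U \<union> V"
begin

lemma open_cover: "\<forall>W\<in>{U, V}. openin X W" "topspace X \<subseteq> \<Union>{U, V}"
  using open_sets cover by auto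

text \<open>If \<open>U\<close> and \<open>V\<close> are disjoint, the two primitives of a cocycle, one for \<open>U\<close> and one for \<open>V\<close>, add up
  to a primitive on \<open>X\<close>. Otherwise the values of a cocycle of degree \<open>0\<close> on \<open>U\<close> and on \<open>V\<close> agree
  at a common point.\<close>

lemma connected_or_acyclic:
  "(\<forall>\<phi>\<in>singular_cochains X 0. coboundary X \<phi> = (0 :: ('x, 'k::field) cochains) \<longrightarrow>
      (\<exists>c. \<phi> = cochain_scale c (unit_cochain X))) \<or>
   (\<forall>n>0. \<forall>\<phi>\<in>singular_cochains X n. coboundary X \<phi> = (0 :: ('x, 'k::field) cochains) \<longrightarrow>
      \<phi> \<in> coboundary X ` singular_cochains X (n - 1))"
proof (cases "U \<inter> V = {}")
  case True
  have "\<phi> \<in> coboundary X ` singular_cochains X (n - 1)"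
    if "n > 0" and \<phi>: "\<phi> \<in> singular_cochains X n" "coboundary X \<phi> = 0" for n and \<phi> :: "('x, 'k) cochains"
  proof
    let ?u = "dual_op X U.cone_op \<phi>" and ?v = "dual_op X V.cone_op \<phi>"
    show "?u + ?v \<in> singular_cochains X (n - 1)"
      by (intro singular_cochains_add dual_op_part \<phi>(1))
    show "\<phi> = coboundary X (?u + ?v)"
    proof (intro ext)
      fix m \<sigma>
      have add: "coboundary X (?u + ?v) m \<sigma> = coboundary X ?u m \<sigma> + coboundary X ?v m \<sigma>"
        by (simp add: coboundary_def sum.distrib algebra_simps)
      show "\<phi> m \<sigma> = coboundary X (?u + ?v) m \<sigma>"
      proof (cases "m > 0 \<and> singular_simplex m X \<sigma>")
        case False
        then have "\<phi> m \<sigma> = 0"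
          using \<phi>(1) \<open>n > 0\<close> unfolding singular_cochains_def by force
        then show ?thesis using False by (auto simp: coboundary_def)
      next
        case \<sigma>: True
        then have "small {U, V} m \<sigma>"
          using simplex_in_disjoint_cover[OF open_sets] cover True by auto
        then consider "singular_simplex m (subtopology X U) \<sigma>" | "singular_simplex m (subtopology X V) \<sigma>"
          using small_cases \<sigma> by blast
        then show ?thesis
        proof cases
          case 1
          then show ?thesis
            using \<sigma> \<phi>(2) V.coboundary_dual_cone_disjoint[OF 1, of \<phi>] U.coboundary_dual_cone[OF 1, of \<phi>] True
            by (simp add: add Int_commute)
        next
          case 2
          then show ?thesis
            using \<sigma> \<phi>(2) U.coboundary_dual_cone_disjoint[OF 2, of \<phi>] V.coboundary_dual_cone[OF 2, of \<phi>] True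
            by (simp add: add)
        qed
      qed
    qed
  qed
  then show ?thesis by blast
next
  case False
  then obtain x where x: "x \<in> U" "x \<in> V" by blast
  have xX: "x \<in> topspace X" using x cover by blast
  let ?x = "restrict (\<lambda>_. x) (standard_simplex 0)"
  have "\<phi> = cochain_scale (\<phi> 0 ?x) (unit_cochain X)"
    if \<phi>: "\<phi> \<in> singular_cochains X 0" "coboundary X \<phi> = 0" for \<phi> :: "('x, 'k) cochains"
  proof (intro ext)
    fix n \<sigma>
    show "\<phi> n \<sigma> = cochain_scale (\<phi> 0 ?x) (unit_cochain X) n \<sigma>"
    proof (cases "n = 0 \<and> singular_simplex 0 X \<sigma>")
      case True
      then have "small {U, V} 0 \<sigma>"
        using cover continuous_map_image_subset_topspace[of "simplex_space 0" X \<sigma>]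
        by (auto simp: small_def singular_simplex_def standard_simplex_0)
      then have "\<phi> 0 \<sigma> = \<phi> 0 ?x"
        using True small_cases[of 0 X \<sigma> U V] U.cocycle_0_constant[OF _ \<phi>(2)] V.cocycle_0_constant[OF _ \<phi>(2)]
          singular_simplex_constant[OF xX x(1), of 0] singular_simplex_constant[OF xX x(2), of 0]
        by metis
      then show ?thesis using True by (simp add: cochain_scale_def unit_cochain_def)
    next
      case False
      then show ?thesis using \<phi>(1) by (auto simp: cochain_scale_def unit_cochain_def singular_cochains_def)
    qed
  qed
  then show ?thesis by blast
qed

lemma graded_null_product_ring:
  "graded_null_product_ring (cochain_scale :: 'k::field \<Rightarrow> ('x, 'k) cochains \<Rightarrow> _)
     (cup_product X) (coboundary X) cochain_sign (vanishing_on X U) (vanishing_on X V)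
     (vanishing_on_small X {U, V}) (dual_op X U.cone_op) (dual_op X V.cone_op)
     (dual_op X (small_op X {U, V})) (singular_cochains X) (unit_cochain X)"
proof (intro graded_null_product_ring.intro null_product_ring.intro cochain_dg_ring
    null_product_ring_axioms.intro graded_null_product_ring_axioms.intro linear_dual_op)
  interpret vector_space "cochain_scale :: 'k \<Rightarrow> ('x, 'k) cochains \<Rightarrow> _"
    by (rule vector_space_cochain_scale)
  show "module.subspace cochain_scale (vanishing_on_small X {U, V} :: ('x, 'k) cochains set)"
    by (auto simp: subspace_def vanishing_on_small_def cochain_scale_def)
       (metis add.right_neutral)+
  fix n show "module.subspace cochain_scale (singular_cochains X n :: ('x, 'k) cochains set)"
    by (auto simp: subspace_def singular_cochains_def cochain_scale_def)
       (metis add.right_neutral)+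
next
  fix \<phi> \<psi> :: "('x, 'k) cochains"
  show "\<phi> \<in> vanishing_on X U \<Longrightarrow> cup_product X \<phi> \<psi> \<in> vanishing_on X U"
    by (rule cup_product_vanishing)
  show "\<phi> \<in> vanishing_on X U \<Longrightarrow> cochain_sign \<phi> \<in> vanishing_on X U"
    by (simp add: vanishing_on_def cochain_sign_def)
  show "\<phi> \<in> vanishing_on X U \<Longrightarrow> \<psi> \<in> vanishing_on X V \<Longrightarrow> cup_product X \<phi> \<psi> \<in> vanishing_on_small X {U, V}"
    by (rule cup_product_vanishing_vanishing)
  show "\<phi> \<in> vanishing_on_small X {U, V} \<Longrightarrow> cup_product X \<psi> \<phi> \<in> vanishing_on_small X {U, V}"
    "\<phi> \<in> vanishing_on_small X {U, V} \<Longrightarrow> cup_product X \<phi> \<psi> \<in> vanishing_on_small X {U, V}"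
    by (simp_all add: cup_product_vanishing_on_small)
  show "\<phi> \<in> vanishing_on_small X {U, V} \<Longrightarrow> cochain_sign \<phi> \<in> vanishing_on_small X {U, V}"
    by (simp add: vanishing_on_small_def cochain_sign_def)
  show "dual_op X (small_op X {U, V}) \<phi> \<in> vanishing_on_small X {U, V}"
    by (rule vanishing_on_small_dual_op)
  show "\<phi> \<in> vanishing_on_small X {U, V} \<Longrightarrow>
    coboundary X (dual_op X (small_op X {U, V}) \<phi>) + dual_op X (small_op X {U, V}) (coboundary X \<phi>) = \<phi>"
    by (rule small_op_contraction[OF open_cover])
next
  fix N and z :: "int \<Rightarrow> ('x, 'k) cochains"
  assume N: "finite N" "\<forall>n\<in>N. z n \<in> singular_cochains X n" "(\<Sum>n\<in>N. z n) = 0"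
  show "\<forall>n\<in>N. z n = 0"
  proof (intro ballI ext)
    fix n m \<sigma> assume n: "n \<in> N"
    show "z n m \<sigma> = 0 m \<sigma>"
    proof (cases "int m = n")
      case True
      have "z k m \<sigma> = 0" if "k \<in> N - {n}" for k
        using that N(2) True by (auto simp: singular_cochains_def)
      then have "(\<Sum>k\<in>N. z k m \<sigma>) = z n m \<sigma>"
        using sum.remove[OF N(1) n, of "\<lambda>k. z k m \<sigma>"] by simp
      moreover have "(\<Sum>k\<in>N. z k) m \<sigma> = (\<Sum>k\<in>N. z k m \<sigma>)"
        using N(1) by (induction N rule: finite_induct) auto
      ultimately show ?thesis using N(3) by simp
    next
      case False
      then show ?thesis using n N(2) by (auto simp: singular_cochains_def)
    qed
  qed
next
  fix n :: int assume "n < 0"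
  then show "singular_cochains X n = ({0} :: ('x, 'k) cochains set)"
    by (auto simp: singular_cochains_def fun_eq_iff)
next
  fix m n and \<phi> \<psi> :: "('x, 'k) cochains"
  show "\<phi> \<in> singular_cochains X n \<Longrightarrow> coboundary X \<phi> \<in> singular_cochains X (n + 1)"
    by (rule coboundary_part)
  show "\<phi> \<in> singular_cochains X m \<Longrightarrow> \<psi> \<in> singular_cochains X n \<Longrightarrow> cup_product X \<phi> \<psi> \<in> singular_cochains X (m + n)"
    by (fastforce simp: singular_cochains_def elim!: cup_product_nonzero)
  show "\<phi> \<in> singular_cochains X n \<Longrightarrow> cochain_sign \<phi> = cochain_scale ((- 1) powi n) \<phi>"
  proof (intro ext)
    fix m \<sigma> assume "\<phi> \<in> singular_cochains X n"
    then have "\<phi> m \<sigma> \<noteq> 0 \<Longrightarrow> int m = n" by (simp add: singular_cochains_def)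
    then show "cochain_sign \<phi> m \<sigma> = cochain_scale ((- 1) powi n) \<phi> m \<sigma>"
      by (cases "\<phi> m \<sigma> = 0") (auto simp: cochain_sign_def cochain_scale_def)
  qed
  show "\<phi> \<in> singular_cochains X n \<Longrightarrow> dual_op X U.cone_op \<phi> \<in> singular_cochains X (n - 1)"
    "\<phi> \<in> singular_cochains X n \<Longrightarrow> dual_op X V.cone_op \<phi> \<in> singular_cochains X (n - 1)"
    "\<phi> \<in> singular_cochains X n \<Longrightarrow> dual_op X (small_op X {U, V}) \<phi> \<in> singular_cochains X (n - 1)"
    by (rule dual_op_part; assumption)+
  show "\<phi> \<in> singular_cochains X n \<Longrightarrow> 0 < n \<Longrightarrow> coboundary X \<phi> = 0 \<Longrightarrow>
      \<phi> - coboundary X (dual_op X U.cone_op \<phi>) \<in> vanishing_on X U"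
    by (rule U.cocycle_vanishing_on)
  show "\<phi> \<in> singular_cochains X n \<Longrightarrow> 0 < n \<Longrightarrow> coboundary X \<phi> = 0 \<Longrightarrow>
      \<phi> - coboundary X (dual_op X V.cone_op \<phi>) \<in> vanishing_on X V"
    by (rule V.cocycle_vanishing_on)
  show "\<phi> \<in> singular_cochains X n \<Longrightarrow> cup_product X (unit_cochain X) \<phi> = \<phi>"
    by (rule unit_cup_product)
  show "\<phi> \<in> singular_cochains X n \<Longrightarrow> cup_product X \<phi> (unit_cochain X) = \<phi>"
    by (rule cup_product_unit)
next
  show "(\<forall>\<phi>\<in>singular_cochains X 0. coboundary X \<phi> = 0 \<longrightarrow> (\<exists>c :: 'k. \<phi> = cochain_scale c (unit_cochain X))) \<or>
   (\<forall>n>0. \<forall>\<phi>\<in>singular_cochains X n. coboundary X \<phi> = (0 :: ('x, 'k) cochains) \<longrightarrow>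
      \<phi> \<in> coboundary X ` singular_cochains X (n - 1))"
    by (rule connected_or_acyclic)
qed

theorem formal_space: "formal_space TYPE('k::field) X"
proof -
  interpret graded_null_product_ring "cochain_scale :: 'k \<Rightarrow> ('x, 'k) cochains \<Rightarrow> _"
     "cup_product X" "coboundary X" cochain_sign "vanishing_on X U" "vanishing_on X V"
     "vanishing_on_small X {U, V}" "dual_op X U.cone_op" "dual_op X V.cone_op"
     "dual_op X (small_op X {U, V})" "singular_cochains X" "unit_cochain X"
    by (rule graded_null_product_ring)
  have "(cochain_algebra X :: ('k, ('x, 'k) cochains) graded_ops) = alg"
    by (auto simp: cochain_algebra_def alg_def dg_ops_def cochain_scale_def fun_eq_iff)
  then show ?thesis
    using formal by (simp add: formal_space_def)
qed

end

lemma contractible_in_null_homotopy: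
  assumes "contractible_in X U"
  obtains H a where "null_homotopy X U H a"
  using assms unfolding contractible_in_def homotopic_with_def null_homotopy_def by auto

text \<open>The infimum of a nonempty set of extended natural numbers is attained. A covering by a single set
  is treated as one by two equal sets.\<close>

lemma cat_LS_le_1:
  assumes "cat_LS X \<le> 1"
  obtains U V where "openin X U" "openin X V" "contractible_in X U" "contractible_in X V"
    "topspace X = U \<union> V"
proof -
  define S where "S = {enat n |n. \<exists>U. (\<forall>i\<le>n. openin X (U i) \<and> contractible_in X (U i)) \<and>
      (\<Union>i\<le>n. U i) = topspace X}"
  have cat: "cat_LS X = Inf S" by (simp only: cat_LS_def S_def)
  have "S \<noteq> {}"
  proof
    assume "S = {}"
    with cat have "cat_LS X = \<infinity>" by (simp add: top_enat_def)
    with assms show False by simp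
  qed
  then have "cat_LS X \<in> S" unfolding cat by (meson ex_in_conv wellorder_InfI)
  with assms obtain n U where n: "n \<le> Suc 0"
    and U: "\<forall>i\<le>n. openin X (U i) \<and> contractible_in X (U i)" "(\<Union>i\<le>n. U i) = topspace X"
    unfolding S_def one_enat_def by auto
  from n have "{..n} = {0, n}" by auto
  with U that[of "U 0" "U n"] show thesis by auto
qed

theorem theorem8:
  fixes X :: "'x topology"
  assumes "cat_LS X \<le> 1"
  shows "formal_space TYPE('k::field_char_0) X"
proof -
  obtain U V where UV: "openin X U" "openin X V" "contractible_in X U" "contractible_in X V" "topspace X = U \<union> V"
    using cat_LS_le_1[OF assms] .
  obtain H a where "null_homotopy X U H a" using contractible_in_null_homotopy[OF UV(3)] .
  moreover obtain G b where "null_homotopy X V G b" using contractible_in_null_homotopy[OF UV(4)] .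
  ultimately interpret two_contractible_sets X U H a V G b
    using UV by (simp add: two_contractible_sets_def two_contractible_sets_axioms_def)
  show ?thesis by (rule formal_space)
qed

end
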